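(* Let $m,n$ be positive integers with $m\leq n$, and let $G$ be a group of order $n$. Then there are a ring $R$ and a skew group ring $R\ast G$ of $G$ over $R$ such that $\mathrm{gn}(R)=n$ and $\mathrm{gn}(R\ast G)=m$.
   Context: Rings are unital; "module" means right module. For a ring $S$, the generating number $\mathrm{gn}(S)$ is the smallest positive integer $n$ for which there is an $S$-module epimorphism $S^n\to S^{n+1}$, if such an $n$ exists, and $\mathrm{gn}(S):=\aleph_0$ otherwise. Given an action of a group $G$ on a ring $R$ by ring automorphisms (a group homomorphism $G\to\mathrm{Aut}(R)$, written $r\mapsto g\cdot r$), the associated skew group ring $R\ast G$ is the set of formal finite sums $\sum_{g\in G}r_g g$ with $r_g\in R$, with componentwise addition and multiplication determined by $(r_g g)(r_h h)=r_g(g\cdot r_h)\,gh$. *)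

theory Defs
  imports "HOL-Algebra.Module" "HOL-Algebra.Bij" "HOL-Algebra.Coset" "HOL-Library.Extended_Nat"
begin

section \<open>Right modules and the generating number\<close>

text \<open>
  A right module is represented by the library's \<open>module\<close> record, where \<open>a \<odot>\<^bsub>M\<^esub> x\<close> is to be read
  as \<open>x\<cdot>a\<close>. The library locale \<open>module\<close> requires a commutative ring of scalars, so it
  cannot be used here.
\<close>

locale right_module = R?: ring R + M?: abelian_group M
  for R :: "('a, 'r) ring_scheme" (structure) and M :: "('a, 'b, 'c) module_scheme" (structure) +
  assumes smult_closed:
      "\<lbrakk>a \<in> carrier R; x \<in> carrier M\<rbrakk> \<Longrightarrow> a \<odot>\<^bsub>M\<^esub> x \<in> carrier M"
    and smult_l_distr:
      "\<lbrakk>a \<in> carrier R; b \<in> carrier R; x \<in> carrier M\<rbrakk> \<Longrightarrow>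
       (a \<oplus> b) \<odot>\<^bsub>M\<^esub> x = a \<odot>\<^bsub>M\<^esub> x \<oplus>\<^bsub>M\<^esub> b \<odot>\<^bsub>M\<^esub> x"
    and smult_r_distr:
      "\<lbrakk>a \<in> carrier R; x \<in> carrier M; y \<in> carrier M\<rbrakk> \<Longrightarrow>
       a \<odot>\<^bsub>M\<^esub> (x \<oplus>\<^bsub>M\<^esub> y) = a \<odot>\<^bsub>M\<^esub> x \<oplus>\<^bsub>M\<^esub> a \<odot>\<^bsub>M\<^esub> y"
    and smult_assoc:
      "\<lbrakk>a \<in> carrier R; b \<in> carrier R; x \<in> carrier M\<rbrakk> \<Longrightarrow>
       (a \<otimes> b) \<odot>\<^bsub>M\<^esub> x = b \<odot>\<^bsub>M\<^esub> (a \<odot>\<^bsub>M\<^esub> x)"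
    and smult_one:
      "x \<in> carrier M \<Longrightarrow> \<one> \<odot>\<^bsub>M\<^esub> x = x"

definition rmod_hom ::
    "('a, 'r) ring_scheme \<Rightarrow> ('a, 'b, 'p) module_scheme \<Rightarrow> ('a, 'c, 'q) module_scheme \<Rightarrow> ('b \<Rightarrow> 'c) set" where
  "rmod_hom S M N = {f \<in> carrier M \<rightarrow> carrier N.
     (\<forall>x\<in>carrier M. \<forall>y\<in>carrier M. f (x \<oplus>\<^bsub>M\<^esub> y) = f x \<oplus>\<^bsub>N\<^esub> f y) \<and>
     (\<forall>a\<in>carrier S. \<forall>x\<in>carrier M. f (a \<odot>\<^bsub>M\<^esub> x) = a \<odot>\<^bsub>N\<^esub> f x)}"

definition rmod_epi ::
    "('a, 'r) ring_scheme \<Rightarrow> ('a, 'b, 'p) module_scheme \<Rightarrow> ('a, 'c, 'q) module_scheme \<Rightarrow> ('b \<Rightarrow> 'c) set" where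
  "rmod_epi S M N = {f \<in> rmod_hom S M N. f ` carrier M = carrier N}"

text \<open>
  The right module \<open>S\<^sup>k\<close>. The fields \<open>mult\<close> and \<open>one\<close> belong to the
  record type but play no role for a module.
\<close>

definition free_rmod :: "('a, 'r) ring_scheme \<Rightarrow> nat \<Rightarrow> ('a, nat \<Rightarrow> 'a) module" where
  "free_rmod S k =
    \<lparr>carrier = {..<k} \<rightarrow>\<^sub>E carrier S,
     mult = undefined,
     one = undefined,
     zero = (\<lambda>i\<in>{..<k}. \<zero>\<^bsub>S\<^esub>),
     add = (\<lambda>x y. \<lambda>i\<in>{..<k}. x i \<oplus>\<^bsub>S\<^esub> y i),
     smult = (\<lambda>a x. \<lambda>i\<in>{..<k}. x i \<otimes>\<^bsub>S\<^esub> a)\<rparr>"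

lemma free_rmod_right_module:
  assumes "ring S"
  shows "right_module S (free_rmod S k)"
proof -
  interpret ring S by fact
  have "abelian_group (free_rmod S k)"
  proof (rule abelian_groupI)
    fix x assume x: "x \<in> carrier (free_rmod S k)"
    show "\<exists>y\<in>carrier (free_rmod S k). y \<oplus>\<^bsub>free_rmod S k\<^esub> x = \<zero>\<^bsub>free_rmod S k\<^esub>"
      using x by (intro bexI[of _ "\<lambda>i\<in>{..<k}. \<ominus>\<^bsub>S\<^esub> x i"])
        (auto simp: free_rmod_def PiE_iff l_neg intro!: restrict_ext)
  qed (auto simp: free_rmod_def PiE_iff a_ac extensional_def fun_eq_iff)
  then show ?thesis
    by (intro right_module.intro right_module_axioms.intro assms)
      (auto simp: free_rmod_def PiE_iff extensional_def fun_eq_iff m_assoc l_distr r_distr)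
qed

text \<open>The value \<open>\<infinity>\<close> stands for \<open>\<aleph>\<^sub>0\<close>.\<close>

definition gn :: "('a, 'r) ring_scheme \<Rightarrow> enat" where
  "gn S =
    (if \<exists>n>0. rmod_epi S (free_rmod S n) (free_rmod S (n + 1)) \<noteq> {}
     then enat (LEAST n. n > 0 \<and> rmod_epi S (free_rmod S n) (free_rmod S (n + 1)) \<noteq> {})
     else \<infinity>)"


section \<open>Skew group rings\<close>

text \<open>As in the library's \<open>AutoGroup\<close>, automorphisms are extensional outside the carrier.\<close>

definition ring_Aut :: "('a, 'r) ring_scheme \<Rightarrow> ('a \<Rightarrow> 'a) monoid" where
  "ring_Aut R = BijGroup (carrier R) \<lparr>carrier := ring_hom R R \<inter> Bij (carrier R)\<rparr>"

lemma (in ring) group_ring_Aut: "group (ring_Aut R)"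
proof -
  have "subgroup (ring_hom R R \<inter> Bij (carrier R)) (BijGroup (carrier R))"
  proof (rule group.subgroupI[OF group_BijGroup])
    have "(\<lambda>x\<in>carrier R. x) \<in> ring_hom R R \<inter> Bij (carrier R)"
      using id_Bij[of "carrier R"] by (auto simp: ring_hom_def)
    then show "ring_hom R R \<inter> Bij (carrier R) \<noteq> {}" by blast
  next
    fix f assume f: "f \<in> ring_hom R R \<inter> Bij (carrier R)"
    let ?g = "inv_into (carrier R) f"
    have "?g \<one> = ?g (f \<one>)" using f by (simp add: ring_hom_def)
    also have "\<dots> = \<one>" using f by (auto simp: Bij_def bij_betw_def)
    finally have "?g \<one> = \<one>" .
    then show "inv\<^bsub>BijGroup (carrier R)\<^esub> f \<in> ring_hom R R \<inter> Bij (carrier R)"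
      using f Bij_inv_into_lemma[of "carrier R" f "(\<otimes>)"] Bij_inv_into_lemma[of "carrier R" f "(\<oplus>)"]
      by (auto simp: inv_BijGroup restrict_inv_into_Bij Bij_inv_into_mem ring_hom_def)
  qed (auto simp: BijGroup_def ring_hom_def compose_def Pi_iff compose_Bij[unfolded compose_def])
  then show ?thesis
    by (simp add: ring_Aut_def subgroup.subgroup_is_group group_BijGroup)
qed

text \<open>
  The formal sum \<open>\<Sum>\<^sub>g r\<^sub>g g\<close> is represented by its coefficient function
  \<open>g \<mapsto> r\<^sub>g\<close>, which is \<open>undefined\<close> outside \<open>carrier G\<close>. The coefficient of \<open>k\<close> in
  a product collects all \<open>(r\<^sub>g g)(s\<^sub>h h) = r\<^sub>g (g\<cdot>s\<^sub>h) gh\<close> with \<open>gh = k\<close>.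
\<close>

definition coeff_support ::
    "('g, 'h) monoid_scheme \<Rightarrow> ('a, 'r) ring_scheme \<Rightarrow> ('g \<Rightarrow> 'a) \<Rightarrow> 'g set" where
  "coeff_support G R r = {g \<in> carrier G. r g \<noteq> \<zero>\<^bsub>R\<^esub>}"

definition skew_group_ring ::
    "('a, 'r) ring_scheme \<Rightarrow> ('g, 'h) monoid_scheme \<Rightarrow> ('g \<Rightarrow> 'a \<Rightarrow> 'a) \<Rightarrow> ('g \<Rightarrow> 'a) ring" where
  "skew_group_ring R G \<phi> =
    \<lparr>carrier = {r \<in> carrier G \<rightarrow>\<^sub>E carrier R. finite (coeff_support G R r)},
     mult = (\<lambda>r s. \<lambda>k\<in>carrier G.
       \<Oplus>\<^bsub>R\<^esub>p\<in>{(g, h). g \<in> coeff_support G R r \<and> h \<in> coeff_support G R s \<and> g \<otimes>\<^bsub>G\<^esub> h = k}.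
         case p of (g, h) \<Rightarrow> r g \<otimes>\<^bsub>R\<^esub> \<phi> g (s h)),
     one = (\<lambda>k\<in>carrier G. if k = \<one>\<^bsub>G\<^esub> then \<one>\<^bsub>R\<^esub> else \<zero>\<^bsub>R\<^esub>),
     zero = (\<lambda>k\<in>carrier G. \<zero>\<^bsub>R\<^esub>),
     add = (\<lambda>r s. \<lambda>k\<in>carrier G. r k \<oplus>\<^bsub>R\<^esub> s k)\<rparr>"

lemma (in abelian_monoid) finsum_swap:
  assumes "finite A" "finite B" "\<And>a b. a \<in> A \<Longrightarrow> b \<in> B \<Longrightarrow> f a b \<in> carrier G"
  shows "(\<Oplus>a\<in>A. \<Oplus>b\<in>B. f a b) = (\<Oplus>b\<in>B. \<Oplus>a\<in>A. f a b)"
  using assms(1,3)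
proof (induction A rule: finite_induct)
  case (insert x F)
  have "(\<Oplus>b\<in>B. \<Oplus>a\<in>insert x F. f a b) = (\<Oplus>b\<in>B. f x b \<oplus> (\<Oplus>a\<in>F. f a b))"
    using insert by (intro finsum_cong') (auto intro!: finsum_insert a_closed finsum_closed)
  also have "\<dots> = (\<Oplus>b\<in>B. f x b) \<oplus> (\<Oplus>b\<in>B. \<Oplus>a\<in>F. f a b)"
    using insert by (intro finsum_addf) (auto intro!: finsum_closed)
  finally show ?case
    using insert by (simp add: finsum_closed Pi_iff)
qed simp

lemma (in abelian_monoid) finsum_Sigma:
  assumes "finite A" "finite B" "\<And>a b. a \<in> A \<Longrightarrow> b \<in> B \<Longrightarrow> f a b \<in> carrier G"
  shows "(\<Oplus>p\<in>A \<times> B. case p of (a, b) \<Rightarrow> f a b) = (\<Oplus>a\<in>A. \<Oplus>b\<in>B. f a b)"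
  using assms(1,3)
proof (induction A rule: finite_induct)
  case (insert x F)
  have eq: "insert x F \<times> B = Pair x ` B \<union> F \<times> B" by auto
  have "(\<Oplus>p\<in>Pair x ` B. case p of (a, b) \<Rightarrow> f a b) = (\<Oplus>b\<in>B. f x b)"
    using insert by (subst finsum_reindex) (auto simp: inj_on_def)
  then show ?case
    unfolding eq using insert assms(2)
    by (subst finsum_Un_disjoint) (auto simp: finsum_closed Pi_iff)
qed simp

lemma skew_group_ring_mult:
  assumes R: "ring R" and G: "group G" and \<phi>: "\<phi> \<in> hom G (ring_Aut R)"
    and r: "r \<in> carrier (skew_group_ring R G \<phi>)" and s: "s \<in> carrier (skew_group_ring R G \<phi>)"
    and A: "finite A" "A \<subseteq> carrier G" "coeff_support G R r \<subseteq> A"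
    and B: "finite B" "B \<subseteq> carrier G" "coeff_support G R s \<subseteq> B"
    and k: "k \<in> carrier G"
  shows "(r \<otimes>\<^bsub>skew_group_ring R G \<phi>\<^esub> s) k =
    (\<Oplus>\<^bsub>R\<^esub>a\<in>A. \<Oplus>\<^bsub>R\<^esub>b\<in>B. if a \<otimes>\<^bsub>G\<^esub> b = k then r a \<otimes>\<^bsub>R\<^esub> \<phi> a (s b) else \<zero>\<^bsub>R\<^esub>)"
proof -
  interpret ring R by fact
  interpret G: group G by fact
  have hom: "\<phi> g \<in> ring_hom R R" if "g \<in> carrier G" for g
    using \<phi> that by (auto simp: hom_def ring_Aut_def)
  have \<phi>c: "\<phi> g x \<in> carrier R" if "g \<in> carrier G" "x \<in> carrier R" for g x
    using ring_hom_closed[OF hom] that .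
  have \<phi>0: "\<phi> g \<zero>\<^bsub>R\<^esub> = \<zero>\<^bsub>R\<^esub>" if "g \<in> carrier G" for g
    using ring_hom_zero[OF hom[OF that] R R] .
  have c: "r g \<in> carrier R" "s g \<in> carrier R" if "g \<in> carrier G" for g
    using r s that by (auto simp: skew_group_ring_def)
  let ?t = "\<lambda>a b. if a \<otimes>\<^bsub>G\<^esub> b = k then r a \<otimes>\<^bsub>R\<^esub> \<phi> a (s b) else \<zero>\<^bsub>R\<^esub>"
  have t: "?t a b \<in> carrier R" if "a \<in> A" "b \<in> B" for a b
    using that A B by (auto intro!: c \<phi>c)
  have "(\<Oplus>\<^bsub>R\<^esub>a\<in>A. \<Oplus>\<^bsub>R\<^esub>b\<in>B. ?t a b) = (\<Oplus>\<^bsub>R\<^esub>p\<in>A \<times> B. case p of (a, b) \<Rightarrow> ?t a b)"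
    by (rule finsum_Sigma[symmetric, OF A(1) B(1) t])
  also have "\<dots> = (\<Oplus>\<^bsub>R\<^esub>p\<in>{(g, h). g \<in> coeff_support G R r \<and> h \<in> coeff_support G R s \<and> g \<otimes>\<^bsub>G\<^esub> h = k}.
         case p of (g, h) \<Rightarrow> r g \<otimes>\<^bsub>R\<^esub> \<phi> g (s h))"
  proof (rule add.finprod_mono_neutral_cong_right)
    show "(\<lambda>(a, b). ?t a b) \<in> A \<times> B \<rightarrow> carrier R"
    proof (rule Pi_I)
      fix p assume "p \<in> A \<times> B"
      then show "(case p of (a, b) \<Rightarrow> ?t a b) \<in> carrier R"
        using t[of "fst p" "snd p"] by (simp only: case_prod_beta mem_Times_iff)
    qed
    fix p assume "p \<in> A \<times> B - {(g, h). g \<in> coeff_support G R r \<and> h \<in> coeff_support G R s \<and> g \<otimes>\<^bsub>G\<^esub> h = k}"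
    then obtain a b where p: "p = (a, b)" "a \<in> carrier G" "b \<in> carrier G"
        and "\<not> (a \<in> coeff_support G R r \<and> b \<in> coeff_support G R s \<and> a \<otimes>\<^bsub>G\<^esub> b = k)"
      using A(2) B(2) by blast
    then have "r a = \<zero>\<^bsub>R\<^esub> \<or> s b = \<zero>\<^bsub>R\<^esub> \<or> a \<otimes>\<^bsub>G\<^esub> b \<noteq> k"
      by (simp add: coeff_support_def)
    then show "(case p of (a, b) \<Rightarrow> ?t a b) = \<zero>\<^bsub>R\<^esub>"
      using p c[of a] c[of b] \<phi>c[of a "s b"] \<phi>0[of a] by auto
  next
    show "finite (A \<times> B)" using A(1) B(1) by simp
    show "{(g, h). g \<in> coeff_support G R r \<and> h \<in> coeff_support G R s \<and> g \<otimes>\<^bsub>G\<^esub> h = k} \<subseteq> A \<times> B"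
      using A(3) B(3) by blast
  qed auto
  finally show ?thesis
    using k by (simp add: skew_group_ring_def)
qed

lemma skew_group_ring_ring:
  fixes R :: "('a, 'r) ring_scheme" and G :: "('g, 'h) monoid_scheme"
  assumes R: "ring R" and G: "group G" and \<phi>: "\<phi> \<in> hom G (ring_Aut R)"
  shows "ring (skew_group_ring R G \<phi>)"
proof -
  interpret ring R by fact
  interpret G: group G by fact
  let ?S = "skew_group_ring R G \<phi>"
  let ?s = "coeff_support G R"
  note mult = skew_group_ring_mult[OF R G \<phi>]
  have hom: "\<phi> g \<in> ring_hom R R" if "g \<in> carrier G" for g
    using \<phi> that by (auto simp: hom_def ring_Aut_def)
  have \<phi>c: "\<phi> g x \<in> carrier R" if "g \<in> carrier G" "x \<in> carrier R" for g x
    using ring_hom_closed[OF hom] that .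
  have \<phi>0: "\<phi> g \<zero>\<^bsub>R\<^esub> = \<zero>\<^bsub>R\<^esub>" if "g \<in> carrier G" for g
    using ring_hom_zero[OF hom[OF that] R R] .
  have \<phi>m: "\<phi> (g \<otimes>\<^bsub>G\<^esub> h) x = \<phi> g (\<phi> h x)" if "g \<in> carrier G" "h \<in> carrier G" "x \<in> carrier R" for g h x
  proof -
    have "\<phi> (g \<otimes>\<^bsub>G\<^esub> h) = \<phi> g \<otimes>\<^bsub>ring_Aut R\<^esub> \<phi> h" "\<phi> g \<in> Bij (carrier R)" "\<phi> h \<in> Bij (carrier R)"
      using \<phi> that by (auto simp: hom_def ring_Aut_def)
    then show ?thesis using that by (simp add: ring_Aut_def BijGroup_def compose_def)
  qed
  have \<phi>1: "\<phi> \<one>\<^bsub>G\<^esub> x = x" if "x \<in> carrier R" for x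
  proof -
    have "\<phi> \<one>\<^bsub>G\<^esub> = \<one>\<^bsub>ring_Aut R\<^esub>" using \<phi> G group_ring_Aut by (rule hom_one)
    then show ?thesis using that by (simp add: ring_Aut_def BijGroup_def)
  qed
  have c: "r g \<in> carrier R" if "r \<in> carrier ?S" "g \<in> carrier G" for r g
    using that by (auto simp: skew_group_ring_def)
  have fin: "finite (?s r)" if "r \<in> carrier ?S" for r
    using that by (auto simp: skew_group_ring_def)
  have sc: "?s r \<subseteq> carrier G" for r by (auto simp: coeff_support_def)
  have ext: "r \<in> extensional (carrier G)" if "r \<in> carrier ?S" for r
    using that by (auto simp: skew_group_ring_def PiE_def)
  have mext: "r \<otimes>\<^bsub>?S\<^esub> s \<in> extensional (carrier G)" for r s
    by (simp add: skew_group_ring_def)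
  have prod: "r \<otimes>\<^bsub>?S\<^esub> s \<in> carrier ?S \<and> ?s (r \<otimes>\<^bsub>?S\<^esub> s) \<subseteq> (\<lambda>(a, b). a \<otimes>\<^bsub>G\<^esub> b) ` (?s r \<times> ?s s)"
    if r: "r \<in> carrier ?S" and s: "s \<in> carrier ?S" for r s
  proof -
    have sub: "?s (r \<otimes>\<^bsub>?S\<^esub> s) \<subseteq> (\<lambda>(a, b). a \<otimes>\<^bsub>G\<^esub> b) ` (?s r \<times> ?s s)"
    proof
      fix k assume k: "k \<in> ?s (r \<otimes>\<^bsub>?S\<^esub> s)"
      show "k \<in> (\<lambda>(a, b). a \<otimes>\<^bsub>G\<^esub> b) ` (?s r \<times> ?s s)"
      proof (rule ccontr)
        assume "\<not> ?thesis"
        then have empty: "{(g, h). g \<in> ?s r \<and> h \<in> ?s s \<and> g \<otimes>\<^bsub>G\<^esub> h = k} = {}" by force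
        have "k \<in> carrier G" using k sc by blast
        then have "(r \<otimes>\<^bsub>?S\<^esub> s) k = \<zero>\<^bsub>R\<^esub>"
          by (simp add: skew_group_ring_def empty)
        then show False using k by (simp add: coeff_support_def)
      qed
    qed
    moreover have "finite (?s (r \<otimes>\<^bsub>?S\<^esub> s))"
      by (rule finite_subset[OF sub]) (auto simp: fin r s)
    moreover have "(r \<otimes>\<^bsub>?S\<^esub> s) k \<in> carrier R" if "k \<in> carrier G" for k
      unfolding mult[OF r s fin[OF r] sc order_refl fin[OF s] sc order_refl that]
      by (auto intro!: finsum_closed m_closed \<phi>c c[OF r] c[OF s] dest: subsetD[OF sc])
    ultimately show ?thesis using mext by (auto simp: skew_group_ring_def PiE_def)
  qed
  have add: "r \<oplus>\<^bsub>?S\<^esub> s \<in> carrier ?S \<and> ?s (r \<oplus>\<^bsub>?S\<^esub> s) \<subseteq> ?s r \<union> ?s s"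
    if r: "r \<in> carrier ?S" and s: "s \<in> carrier ?S" for r s
  proof -
    have sub: "?s (r \<oplus>\<^bsub>?S\<^esub> s) \<subseteq> ?s r \<union> ?s s"
      by (auto simp: coeff_support_def skew_group_ring_def)
    then have "finite (?s (r \<oplus>\<^bsub>?S\<^esub> s))"
      by (rule finite_subset) (auto simp: fin r s)
    then show ?thesis using sub c[OF r] c[OF s] by (auto simp: skew_group_ring_def)
  qed
  have addk: "(r \<oplus>\<^bsub>?S\<^esub> s) k = r k \<oplus>\<^bsub>R\<^esub> s k" if "k \<in> carrier G" for r s k
    using that by (simp add: skew_group_ring_def)
  have onek: "\<one>\<^bsub>?S\<^esub> k = (if k = \<one>\<^bsub>G\<^esub> then \<one>\<^bsub>R\<^esub> else \<zero>\<^bsub>R\<^esub>)" if "k \<in> carrier G" for k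
    using that by (simp add: skew_group_ring_def)
  have ones: "?s \<one>\<^bsub>?S\<^esub> \<subseteq> {\<one>\<^bsub>G\<^esub>}"
    by (auto simp: coeff_support_def onek split: if_splits)
  have one: "\<one>\<^bsub>?S\<^esub> \<in> carrier ?S"
    using finite_subset[OF ones] by (auto simp: skew_group_ring_def)
  have abel: "abelian_group ?S"
  proof (rule abelian_groupI)
    fix x assume x: "x \<in> carrier ?S"
    have "?s (\<lambda>i\<in>carrier G. \<ominus>\<^bsub>R\<^esub> x i) \<subseteq> ?s x"
      by (auto simp: coeff_support_def)
    then have "finite (?s (\<lambda>i\<in>carrier G. \<ominus>\<^bsub>R\<^esub> x i))"
      using fin[OF x] by (rule finite_subset)
    then show "\<exists>y\<in>carrier ?S. y \<oplus>\<^bsub>?S\<^esub> x = \<zero>\<^bsub>?S\<^esub>"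
      using c[OF x] by (intro bexI[of _ "\<lambda>i\<in>carrier G. \<ominus>\<^bsub>R\<^esub> x i"])
        (auto simp: skew_group_ring_def l_neg intro!: restrict_ext)
  next
    show "\<zero>\<^bsub>?S\<^esub> \<in> carrier ?S"
      by (auto simp: skew_group_ring_def coeff_support_def)
  qed (use add in \<open>auto simp: skew_group_ring_def PiE_iff a_ac extensional_def fun_eq_iff\<close>)
  have U: "finite (?s x \<union> ?s y)" "?s x \<union> ?s y \<subseteq> carrier G" if "x \<in> carrier ?S" "y \<in> carrier ?S" for x y
    using fin sc that by auto
  have neutral: "\<one>\<^bsub>?S\<^esub> \<otimes>\<^bsub>?S\<^esub> x = x \<and> x \<otimes>\<^bsub>?S\<^esub> \<one>\<^bsub>?S\<^esub> = x" if x: "x \<in> carrier ?S" for x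
  proof (intro conjI extensionalityI[OF mext ext[OF x]])
    fix k assume k: "k \<in> carrier G"
    define B where "B = insert k (?s x)"
    have B: "finite B" "B \<subseteq> carrier G" "?s x \<subseteq> B" and kB: "k \<in> B"
      using fin[OF x] sc k by (auto simp: B_def)
    have xB: "x b \<in> carrier R" "b \<in> carrier G" if "b \<in> B" for b
      using that B c[OF x] by auto
    have one_sub: "finite {\<one>\<^bsub>G\<^esub>}" "{\<one>\<^bsub>G\<^esub>} \<subseteq> carrier G" by auto
    have "(\<one>\<^bsub>?S\<^esub> \<otimes>\<^bsub>?S\<^esub> x) k = (\<Oplus>\<^bsub>R\<^esub>a\<in>{\<one>\<^bsub>G\<^esub>}. \<Oplus>\<^bsub>R\<^esub>b\<in>B.
        if a \<otimes>\<^bsub>G\<^esub> b = k then \<one>\<^bsub>?S\<^esub> a \<otimes>\<^bsub>R\<^esub> \<phi> a (x b) else \<zero>\<^bsub>R\<^esub>)"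
      by (rule mult[OF one x one_sub ones B k])
    also have "\<dots> = (\<Oplus>\<^bsub>R\<^esub>b\<in>B. if \<one>\<^bsub>G\<^esub> \<otimes>\<^bsub>G\<^esub> b = k then \<one>\<^bsub>?S\<^esub> \<one>\<^bsub>G\<^esub> \<otimes>\<^bsub>R\<^esub> \<phi> \<one>\<^bsub>G\<^esub> (x b) else \<zero>\<^bsub>R\<^esub>)"
      by (subst finsum_insert) (auto simp: onek \<phi>c xB intro!: finsum_closed)
    also have "\<dots> = (\<Oplus>\<^bsub>R\<^esub>b\<in>B. if b = k then x b else \<zero>\<^bsub>R\<^esub>)"
      by (intro finsum_cong') (auto simp: onek \<phi>1 xB)
    also have "\<dots> = x k"
      by (intro add.finprod_singleton_swap kB B(1)) (auto simp: xB)
    finally show "(\<one>\<^bsub>?S\<^esub> \<otimes>\<^bsub>?S\<^esub> x) k = x k" .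
    have "(x \<otimes>\<^bsub>?S\<^esub> \<one>\<^bsub>?S\<^esub>) k = (\<Oplus>\<^bsub>R\<^esub>a\<in>B. \<Oplus>\<^bsub>R\<^esub>b\<in>{\<one>\<^bsub>G\<^esub>}.
        if a \<otimes>\<^bsub>G\<^esub> b = k then x a \<otimes>\<^bsub>R\<^esub> \<phi> a (\<one>\<^bsub>?S\<^esub> b) else \<zero>\<^bsub>R\<^esub>)"
      by (rule mult[OF x one B one_sub ones k])
    also have "\<dots> = (\<Oplus>\<^bsub>R\<^esub>a\<in>B. if a = k then x a else \<zero>\<^bsub>R\<^esub>)"
    proof (rule finsum_cong'[OF refl])
      fix a assume "a \<in> B"
      then have a: "a \<in> carrier G" using B by auto
      then show "(\<Oplus>\<^bsub>R\<^esub>b\<in>{\<one>\<^bsub>G\<^esub>}. if a \<otimes>\<^bsub>G\<^esub> b = k then x a \<otimes>\<^bsub>R\<^esub> \<phi> a (\<one>\<^bsub>?S\<^esub> b) else \<zero>\<^bsub>R\<^esub>)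
          = (if a = k then x a else \<zero>\<^bsub>R\<^esub>)"
        using c[OF x] by (subst finsum_insert) (auto simp: onek ring_hom_one[OF hom])
    qed (auto simp: xB)
    also have "\<dots> = x k"
      by (intro add.finprod_singleton_swap kB B(1)) (auto simp: xB)
    finally show "(x \<otimes>\<^bsub>?S\<^esub> \<one>\<^bsub>?S\<^esub>) k = x k" .
  qed
  have assoc: "(x \<otimes>\<^bsub>?S\<^esub> y) \<otimes>\<^bsub>?S\<^esub> z = x \<otimes>\<^bsub>?S\<^esub> (y \<otimes>\<^bsub>?S\<^esub> z)"
    if x: "x \<in> carrier ?S" and y: "y \<in> carrier ?S" and z: "z \<in> carrier ?S" for x y z
  proof (rule extensionalityI[OF mext mext])
    fix k assume k: "k \<in> carrier G"
    define A where "A = ?s x"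
    define B where "B = ?s y"
    define C where "C = ?s z"
    define AB where "AB = (\<lambda>(a, b). a \<otimes>\<^bsub>G\<^esub> b) ` (A \<times> B)"
    define BC where "BC = (\<lambda>(b, c). b \<otimes>\<^bsub>G\<^esub> c) ` (B \<times> C)"
    have A: "finite A" "A \<subseteq> carrier G" "?s x \<subseteq> A" using fin[OF x] sc by (auto simp: A_def)
    have B: "finite B" "B \<subseteq> carrier G" "?s y \<subseteq> B" using fin[OF y] sc by (auto simp: B_def)
    have C: "finite C" "C \<subseteq> carrier G" "?s z \<subseteq> C" using fin[OF z] sc by (auto simp: C_def)
    have xy: "x \<otimes>\<^bsub>?S\<^esub> y \<in> carrier ?S" and yz: "y \<otimes>\<^bsub>?S\<^esub> z \<in> carrier ?S" using prod x y z by auto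
    have AB: "finite AB" "AB \<subseteq> carrier G" "?s (x \<otimes>\<^bsub>?S\<^esub> y) \<subseteq> AB"
      using prod[OF x y] A B by (auto simp: AB_def A_def B_def)
    have BC: "finite BC" "BC \<subseteq> carrier G" "?s (y \<otimes>\<^bsub>?S\<^esub> z) \<subseteq> BC"
      using prod[OF y z] B C by (auto simp: BC_def B_def C_def)
    have ABm: "a \<otimes>\<^bsub>G\<^esub> b \<in> AB" if "a \<in> A" "b \<in> B" for a b using that by (force simp: AB_def)
    have BCm: "b \<otimes>\<^bsub>G\<^esub> c \<in> BC" if "b \<in> B" "c \<in> C" for b c using that by (force simp: BC_def)
    have mem: "a \<in> A \<Longrightarrow> a \<in> carrier G" "a \<in> B \<Longrightarrow> a \<in> carrier G" "a \<in> C \<Longrightarrow> a \<in> carrier G"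
      "a \<in> AB \<Longrightarrow> a \<in> carrier G" "a \<in> BC \<Longrightarrow> a \<in> carrier G" for a
      using A B C AB BC by auto
    note cc = c[OF x] c[OF y] c[OF z] c[OF xy] c[OF yz] mem \<phi>c
    define T where "T = (\<lambda>a b c'. if a \<otimes>\<^bsub>G\<^esub> b \<otimes>\<^bsub>G\<^esub> c' = k
      then x a \<otimes>\<^bsub>R\<^esub> \<phi> a (y b) \<otimes>\<^bsub>R\<^esub> \<phi> (a \<otimes>\<^bsub>G\<^esub> b) (z c') else \<zero>\<^bsub>R\<^esub>)"
    have T: "T a b c' \<in> carrier R" if "a \<in> A" "b \<in> B" "c' \<in> C" for a b c'
      using that by (auto simp: T_def cc)
    have "((x \<otimes>\<^bsub>?S\<^esub> y) \<otimes>\<^bsub>?S\<^esub> z) k = (\<Oplus>\<^bsub>R\<^esub>d\<in>AB. \<Oplus>\<^bsub>R\<^esub>c'\<in>C.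
        if d \<otimes>\<^bsub>G\<^esub> c' = k then (x \<otimes>\<^bsub>?S\<^esub> y) d \<otimes>\<^bsub>R\<^esub> \<phi> d (z c') else \<zero>\<^bsub>R\<^esub>)"
      by (rule mult[OF xy z AB C k])
    also have "\<dots> = (\<Oplus>\<^bsub>R\<^esub>c'\<in>C. \<Oplus>\<^bsub>R\<^esub>d\<in>AB.
        if d \<otimes>\<^bsub>G\<^esub> c' = k then (x \<otimes>\<^bsub>?S\<^esub> y) d \<otimes>\<^bsub>R\<^esub> \<phi> d (z c') else \<zero>\<^bsub>R\<^esub>)"
      using AB C by (intro finsum_swap) (auto simp: cc)
    also have "\<dots> = (\<Oplus>\<^bsub>R\<^esub>c'\<in>C. \<Oplus>\<^bsub>R\<^esub>a\<in>A. \<Oplus>\<^bsub>R\<^esub>b\<in>B. T a b c')"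
    proof (rule finsum_cong'[OF refl])
      show "(\<lambda>c'. \<Oplus>\<^bsub>R\<^esub>a\<in>A. \<Oplus>\<^bsub>R\<^esub>b\<in>B. T a b c') \<in> C \<rightarrow> carrier R"
        using T by (auto intro!: finsum_closed)
      fix c' assume c': "c' \<in> C"
      let ?u = "\<lambda>d a b. if a \<otimes>\<^bsub>G\<^esub> b = d then T a b c' else \<zero>\<^bsub>R\<^esub>"
      have u: "?u d a b \<in> carrier R" if "a \<in> A" "b \<in> B" for d a b using T that c' by auto
      have "(\<Oplus>\<^bsub>R\<^esub>d\<in>AB. if d \<otimes>\<^bsub>G\<^esub> c' = k then (x \<otimes>\<^bsub>?S\<^esub> y) d \<otimes>\<^bsub>R\<^esub> \<phi> d (z c') else \<zero>\<^bsub>R\<^esub>)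
          = (\<Oplus>\<^bsub>R\<^esub>d\<in>AB. \<Oplus>\<^bsub>R\<^esub>a\<in>A. \<Oplus>\<^bsub>R\<^esub>b\<in>B. ?u d a b)"
      proof (rule finsum_cong'[OF refl])
        show "(\<lambda>d. \<Oplus>\<^bsub>R\<^esub>a\<in>A. \<Oplus>\<^bsub>R\<^esub>b\<in>B. ?u d a b) \<in> AB \<rightarrow> carrier R"
          using u by (auto intro!: finsum_closed)
        fix d assume d: "d \<in> AB"
        show "(if d \<otimes>\<^bsub>G\<^esub> c' = k then (x \<otimes>\<^bsub>?S\<^esub> y) d \<otimes>\<^bsub>R\<^esub> \<phi> d (z c') else \<zero>\<^bsub>R\<^esub>)
            = (\<Oplus>\<^bsub>R\<^esub>a\<in>A. \<Oplus>\<^bsub>R\<^esub>b\<in>B. ?u d a b)"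
        proof (cases "d \<otimes>\<^bsub>G\<^esub> c' = k")
          case True
          let ?w = "\<lambda>a b. if a \<otimes>\<^bsub>G\<^esub> b = d then x a \<otimes>\<^bsub>R\<^esub> \<phi> a (y b) else \<zero>\<^bsub>R\<^esub>"
          have z': "\<phi> d (z c') \<in> carrier R" using d c' by (simp add: cc)
          have w: "?w a b \<in> carrier R" if "a \<in> A" "b \<in> B" for a b using that by (simp add: cc)
          have "(x \<otimes>\<^bsub>?S\<^esub> y) d \<otimes>\<^bsub>R\<^esub> \<phi> d (z c') = (\<Oplus>\<^bsub>R\<^esub>a\<in>A. \<Oplus>\<^bsub>R\<^esub>b\<in>B. ?w a b) \<otimes>\<^bsub>R\<^esub> \<phi> d (z c')"
            by (simp only: mult[OF x y A B mem(4)[OF d]])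
          also have "\<dots> = (\<Oplus>\<^bsub>R\<^esub>a\<in>A. (\<Oplus>\<^bsub>R\<^esub>b\<in>B. ?w a b) \<otimes>\<^bsub>R\<^esub> \<phi> d (z c'))"
            using w z' A by (intro finsum_ldistr) (auto intro!: finsum_closed)
          also have "\<dots> = (\<Oplus>\<^bsub>R\<^esub>a\<in>A. \<Oplus>\<^bsub>R\<^esub>b\<in>B. ?u d a b)"
          proof (rule finsum_cong'[OF refl])
            show "(\<lambda>a. \<Oplus>\<^bsub>R\<^esub>b\<in>B. ?u d a b) \<in> A \<rightarrow> carrier R"
              using u by (auto intro!: finsum_closed)
            fix a assume a: "a \<in> A"
            have "(\<Oplus>\<^bsub>R\<^esub>b\<in>B. ?w a b) \<otimes>\<^bsub>R\<^esub> \<phi> d (z c') = (\<Oplus>\<^bsub>R\<^esub>b\<in>B. ?w a b \<otimes>\<^bsub>R\<^esub> \<phi> d (z c'))"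
              using w z' B a by (intro finsum_ldistr) auto
            also have "\<dots> = (\<Oplus>\<^bsub>R\<^esub>b\<in>B. ?u d a b)"
            proof (rule finsum_cong'[OF refl])
              show "(\<lambda>b. ?u d a b) \<in> B \<rightarrow> carrier R" using u[OF a] by blast
              fix b assume "b \<in> B"
              then show "?w a b \<otimes>\<^bsub>R\<^esub> \<phi> d (z c') = ?u d a b"
                using True z' by (auto simp: T_def)
            qed
            finally show "(\<Oplus>\<^bsub>R\<^esub>b\<in>B. ?w a b) \<otimes>\<^bsub>R\<^esub> \<phi> d (z c') = (\<Oplus>\<^bsub>R\<^esub>b\<in>B. ?u d a b)" .
          qed
          finally show ?thesis using True by simp
        next
          case False
          then have "?u d a b = \<zero>\<^bsub>R\<^esub>" for a b by (auto simp: T_def)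
          then show ?thesis using False by simp
        qed
      qed
      also have "\<dots> = (\<Oplus>\<^bsub>R\<^esub>a\<in>A. \<Oplus>\<^bsub>R\<^esub>d\<in>AB. \<Oplus>\<^bsub>R\<^esub>b\<in>B. ?u d a b)"
        using AB A u by (intro finsum_swap) (auto intro!: finsum_closed)
      also have "\<dots> = (\<Oplus>\<^bsub>R\<^esub>a\<in>A. \<Oplus>\<^bsub>R\<^esub>b\<in>B. T a b c')"
      proof (rule finsum_cong'[OF refl])
        show "(\<lambda>a. \<Oplus>\<^bsub>R\<^esub>b\<in>B. T a b c') \<in> A \<rightarrow> carrier R"
          using T c' by (auto intro!: finsum_closed)
        fix a assume a: "a \<in> A"
        have "(\<Oplus>\<^bsub>R\<^esub>d\<in>AB. \<Oplus>\<^bsub>R\<^esub>b\<in>B. ?u d a b) = (\<Oplus>\<^bsub>R\<^esub>b\<in>B. \<Oplus>\<^bsub>R\<^esub>d\<in>AB. ?u d a b)"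
          using AB B u a by (intro finsum_swap) auto
        also have "\<dots> = (\<Oplus>\<^bsub>R\<^esub>b\<in>B. T a b c')"
        proof (rule finsum_cong'[OF refl])
          show "(\<lambda>b. T a b c') \<in> B \<rightarrow> carrier R" using T a c' by auto
          fix b assume b: "b \<in> B"
          show "(\<Oplus>\<^bsub>R\<^esub>d\<in>AB. ?u d a b) = T a b c'"
            using AB ABm[OF a b] T[OF a b c'] by (intro add.finprod_singleton) auto
        qed
        finally show "(\<Oplus>\<^bsub>R\<^esub>d\<in>AB. \<Oplus>\<^bsub>R\<^esub>b\<in>B. ?u d a b) = (\<Oplus>\<^bsub>R\<^esub>b\<in>B. T a b c')" .
      qed
      finally show "(\<Oplus>\<^bsub>R\<^esub>d\<in>AB. if d \<otimes>\<^bsub>G\<^esub> c' = k then (x \<otimes>\<^bsub>?S\<^esub> y) d \<otimes>\<^bsub>R\<^esub> \<phi> d (z c') else \<zero>\<^bsub>R\<^esub>)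
          = (\<Oplus>\<^bsub>R\<^esub>a\<in>A. \<Oplus>\<^bsub>R\<^esub>b\<in>B. T a b c')" .
    qed
    also have "\<dots> = (\<Oplus>\<^bsub>R\<^esub>a\<in>A. \<Oplus>\<^bsub>R\<^esub>c'\<in>C. \<Oplus>\<^bsub>R\<^esub>b\<in>B. T a b c')"
      using A C T by (intro finsum_swap) (auto intro!: finsum_closed)
    also have "\<dots> = (\<Oplus>\<^bsub>R\<^esub>a\<in>A. \<Oplus>\<^bsub>R\<^esub>d\<in>BC.
        if a \<otimes>\<^bsub>G\<^esub> d = k then x a \<otimes>\<^bsub>R\<^esub> \<phi> a ((y \<otimes>\<^bsub>?S\<^esub> z) d) else \<zero>\<^bsub>R\<^esub>)"
    proof (rule finsum_cong'[OF refl])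
      show "(\<lambda>a. \<Oplus>\<^bsub>R\<^esub>d\<in>BC. if a \<otimes>\<^bsub>G\<^esub> d = k then x a \<otimes>\<^bsub>R\<^esub> \<phi> a ((y \<otimes>\<^bsub>?S\<^esub> z) d) else \<zero>\<^bsub>R\<^esub>)
          \<in> A \<rightarrow> carrier R"
        by (auto intro!: finsum_closed simp: cc)
      fix a assume a: "a \<in> A"
      note h = hom[OF mem(1)[OF a]]
      let ?u = "\<lambda>d b c'. if b \<otimes>\<^bsub>G\<^esub> c' = d then T a b c' else \<zero>\<^bsub>R\<^esub>"
      have u: "?u d b c' \<in> carrier R" if "b \<in> B" "c' \<in> C" for d b c' using T that a by auto
      have "(\<Oplus>\<^bsub>R\<^esub>c'\<in>C. \<Oplus>\<^bsub>R\<^esub>b\<in>B. T a b c') = (\<Oplus>\<^bsub>R\<^esub>b\<in>B. \<Oplus>\<^bsub>R\<^esub>c'\<in>C. T a b c')"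
        using B C T a by (intro finsum_swap) auto
      also have "\<dots> = (\<Oplus>\<^bsub>R\<^esub>b\<in>B. \<Oplus>\<^bsub>R\<^esub>d\<in>BC. \<Oplus>\<^bsub>R\<^esub>c'\<in>C. ?u d b c')"
      proof (rule finsum_cong'[OF refl])
        show "(\<lambda>b. \<Oplus>\<^bsub>R\<^esub>d\<in>BC. \<Oplus>\<^bsub>R\<^esub>c'\<in>C. ?u d b c') \<in> B \<rightarrow> carrier R"
          using u by (auto intro!: finsum_closed)
        fix b assume b: "b \<in> B"
        have "(\<Oplus>\<^bsub>R\<^esub>c'\<in>C. T a b c') = (\<Oplus>\<^bsub>R\<^esub>c'\<in>C. \<Oplus>\<^bsub>R\<^esub>d\<in>BC. ?u d b c')"
        proof (rule finsum_cong'[OF refl])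
          show "(\<lambda>c'. \<Oplus>\<^bsub>R\<^esub>d\<in>BC. ?u d b c') \<in> C \<rightarrow> carrier R"
            using u b by (auto intro!: finsum_closed)
          fix c' assume c': "c' \<in> C"
          show "T a b c' = (\<Oplus>\<^bsub>R\<^esub>d\<in>BC. ?u d b c')"
            using BC BCm[OF b c'] T[OF a b c'] by (intro add.finprod_singleton[symmetric]) auto
        qed
        also have "\<dots> = (\<Oplus>\<^bsub>R\<^esub>d\<in>BC. \<Oplus>\<^bsub>R\<^esub>c'\<in>C. ?u d b c')"
          using BC C u b by (intro finsum_swap) auto
        finally show "(\<Oplus>\<^bsub>R\<^esub>c'\<in>C. T a b c') = (\<Oplus>\<^bsub>R\<^esub>d\<in>BC. \<Oplus>\<^bsub>R\<^esub>c'\<in>C. ?u d b c')" .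
      qed
      also have "\<dots> = (\<Oplus>\<^bsub>R\<^esub>d\<in>BC. \<Oplus>\<^bsub>R\<^esub>b\<in>B. \<Oplus>\<^bsub>R\<^esub>c'\<in>C. ?u d b c')"
        using BC B u by (intro finsum_swap) (auto intro!: finsum_closed)
      also have "\<dots> = (\<Oplus>\<^bsub>R\<^esub>d\<in>BC. if a \<otimes>\<^bsub>G\<^esub> d = k then x a \<otimes>\<^bsub>R\<^esub> \<phi> a ((y \<otimes>\<^bsub>?S\<^esub> z) d) else \<zero>\<^bsub>R\<^esub>)"
      proof (rule finsum_cong'[OF refl])
        show "(\<lambda>d. if a \<otimes>\<^bsub>G\<^esub> d = k then x a \<otimes>\<^bsub>R\<^esub> \<phi> a ((y \<otimes>\<^bsub>?S\<^esub> z) d) else \<zero>\<^bsub>R\<^esub>) \<in> BC \<rightarrow> carrier R"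
          using a by (auto simp: cc)
        fix d assume d: "d \<in> BC"
        have zero: "?u d b c' = \<zero>\<^bsub>R\<^esub>" if "a \<otimes>\<^bsub>G\<^esub> d \<noteq> k" "b \<in> B" "c' \<in> C" for b c'
          using that a by (auto simp: T_def cc G.m_assoc)
        show "(\<Oplus>\<^bsub>R\<^esub>b\<in>B. \<Oplus>\<^bsub>R\<^esub>c'\<in>C. ?u d b c')
            = (if a \<otimes>\<^bsub>G\<^esub> d = k then x a \<otimes>\<^bsub>R\<^esub> \<phi> a ((y \<otimes>\<^bsub>?S\<^esub> z) d) else \<zero>\<^bsub>R\<^esub>)"
        proof (cases "a \<otimes>\<^bsub>G\<^esub> d = k")
          case True
          let ?w = "\<lambda>b c'. if b \<otimes>\<^bsub>G\<^esub> c' = d then y b \<otimes>\<^bsub>R\<^esub> \<phi> b (z c') else \<zero>\<^bsub>R\<^esub>"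
          let ?f = "\<lambda>v. x a \<otimes>\<^bsub>R\<^esub> \<phi> a v"
          have w: "?w b c' \<in> carrier R" if "b \<in> B" "c' \<in> C" for b c' using that by (simp add: cc)
          have f0: "?f \<zero>\<^bsub>R\<^esub> = \<zero>\<^bsub>R\<^esub>" using a by (simp add: cc \<phi>0)
          have fsum: "?f (finsum R g F) = (\<Oplus>\<^bsub>R\<^esub>i\<in>F. ?f (g i))"
            if "finite F" "g \<in> F \<rightarrow> carrier R" for F and g :: "'g \<Rightarrow> 'a"
            using that
          proof (induction F rule: finite_induct)
            case empty show ?case by (simp add: f0)
          next
            case (insert i F)
            then show ?case using a h
              by (simp add: Pi_iff finsum_closed cc ring_hom_add[OF h] r_distr)
          qed
          have "?f ((y \<otimes>\<^bsub>?S\<^esub> z) d) = ?f (\<Oplus>\<^bsub>R\<^esub>b\<in>B. \<Oplus>\<^bsub>R\<^esub>c'\<in>C. ?w b c')"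
            by (simp only: mult[OF y z B C mem(5)[OF d]])
          also have "\<dots> = (\<Oplus>\<^bsub>R\<^esub>b\<in>B. ?f (\<Oplus>\<^bsub>R\<^esub>c'\<in>C. ?w b c'))"
            using w B by (intro fsum) (auto intro!: finsum_closed)
          also have "\<dots> = (\<Oplus>\<^bsub>R\<^esub>b\<in>B. \<Oplus>\<^bsub>R\<^esub>c'\<in>C. ?u d b c')"
          proof (rule finsum_cong'[OF refl])
            show "(\<lambda>b. \<Oplus>\<^bsub>R\<^esub>c'\<in>C. ?u d b c') \<in> B \<rightarrow> carrier R"
              using u by (auto intro!: finsum_closed)
            fix b assume b: "b \<in> B"
            have "?f (\<Oplus>\<^bsub>R\<^esub>c'\<in>C. ?w b c') = (\<Oplus>\<^bsub>R\<^esub>c'\<in>C. ?f (?w b c'))"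
              using w C b by (intro fsum) auto
            also have "\<dots> = (\<Oplus>\<^bsub>R\<^esub>c'\<in>C. ?u d b c')"
            proof (rule finsum_cong'[OF refl])
              show "(\<lambda>c'. ?u d b c') \<in> C \<rightarrow> carrier R" using u[OF b] by blast
              fix c' assume c': "c' \<in> C"
              show "?f (?w b c') = ?u d b c'"
                using True a b c'
                by (auto simp: T_def f0 cc G.m_assoc m_assoc \<phi>m ring_hom_mult[OF h])
            qed
            finally show "?f (\<Oplus>\<^bsub>R\<^esub>c'\<in>C. ?w b c') = (\<Oplus>\<^bsub>R\<^esub>c'\<in>C. ?u d b c')" .
          qed
          finally show ?thesis using True by simp
        next
          case False
          have "(\<Oplus>\<^bsub>R\<^esub>b\<in>B. \<Oplus>\<^bsub>R\<^esub>c'\<in>C. ?u d b c') = \<zero>\<^bsub>R\<^esub>"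
            using zero[OF False] by (intro add.finprod_one_eqI)
          then show ?thesis using False by simp
        qed
      qed
      finally show "(\<Oplus>\<^bsub>R\<^esub>c'\<in>C. \<Oplus>\<^bsub>R\<^esub>b\<in>B. T a b c')
          = (\<Oplus>\<^bsub>R\<^esub>d\<in>BC. if a \<otimes>\<^bsub>G\<^esub> d = k then x a \<otimes>\<^bsub>R\<^esub> \<phi> a ((y \<otimes>\<^bsub>?S\<^esub> z) d) else \<zero>\<^bsub>R\<^esub>)" .
    qed
    also have "\<dots> = (x \<otimes>\<^bsub>?S\<^esub> (y \<otimes>\<^bsub>?S\<^esub> z)) k"
      by (rule mult[OF x yz A BC k, symmetric])
    finally show "((x \<otimes>\<^bsub>?S\<^esub> y) \<otimes>\<^bsub>?S\<^esub> z) k = (x \<otimes>\<^bsub>?S\<^esub> (y \<otimes>\<^bsub>?S\<^esub> z)) k" .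
  qed
  have aext: "r \<oplus>\<^bsub>?S\<^esub> s \<in> extensional (carrier G)" for r s
    by (simp add: skew_group_ring_def)
  have finsum2: "(\<Oplus>\<^bsub>R\<^esub>a\<in>A. \<Oplus>\<^bsub>R\<^esub>b\<in>B. f a b) \<oplus>\<^bsub>R\<^esub> (\<Oplus>\<^bsub>R\<^esub>a\<in>A. \<Oplus>\<^bsub>R\<^esub>b\<in>B. g a b) =
      (\<Oplus>\<^bsub>R\<^esub>a\<in>A. \<Oplus>\<^bsub>R\<^esub>b\<in>B. h a b)"
    if "\<And>a b. a \<in> A \<Longrightarrow> b \<in> B \<Longrightarrow> f a b \<in> carrier R \<and> g a b \<in> carrier R \<and> h a b = f a b \<oplus>\<^bsub>R\<^esub> g a b"
    for A B :: "'g set" and f g h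
  proof -
    have "(\<Oplus>\<^bsub>R\<^esub>a\<in>A. \<Oplus>\<^bsub>R\<^esub>b\<in>B. h a b) = (\<Oplus>\<^bsub>R\<^esub>a\<in>A. (\<Oplus>\<^bsub>R\<^esub>b\<in>B. f a b) \<oplus>\<^bsub>R\<^esub> (\<Oplus>\<^bsub>R\<^esub>b\<in>B. g a b))"
    proof (rule finsum_cong'[OF refl])
      show "(\<lambda>a. (\<Oplus>\<^bsub>R\<^esub>b\<in>B. f a b) \<oplus>\<^bsub>R\<^esub> (\<Oplus>\<^bsub>R\<^esub>b\<in>B. g a b)) \<in> A \<rightarrow> carrier R"
        using that by (auto intro!: finsum_closed a_closed)
      fix a assume a: "a \<in> A"
      have "(\<Oplus>\<^bsub>R\<^esub>b\<in>B. h a b) = (\<Oplus>\<^bsub>R\<^esub>b\<in>B. f a b \<oplus>\<^bsub>R\<^esub> g a b)"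
        using that a by (intro finsum_cong') auto
      then show "(\<Oplus>\<^bsub>R\<^esub>b\<in>B. h a b) = (\<Oplus>\<^bsub>R\<^esub>b\<in>B. f a b) \<oplus>\<^bsub>R\<^esub> (\<Oplus>\<^bsub>R\<^esub>b\<in>B. g a b)"
        using that a by (simp add: finsum_addf Pi_iff)
    qed
    also have "\<dots> = (\<Oplus>\<^bsub>R\<^esub>a\<in>A. \<Oplus>\<^bsub>R\<^esub>b\<in>B. f a b) \<oplus>\<^bsub>R\<^esub> (\<Oplus>\<^bsub>R\<^esub>a\<in>A. \<Oplus>\<^bsub>R\<^esub>b\<in>B. g a b)"
      using that by (intro finsum_addf) (auto intro!: finsum_closed)
    finally show ?thesis by simp
  qed
  have distr: "(x \<oplus>\<^bsub>?S\<^esub> y) \<otimes>\<^bsub>?S\<^esub> z = x \<otimes>\<^bsub>?S\<^esub> z \<oplus>\<^bsub>?S\<^esub> y \<otimes>\<^bsub>?S\<^esub> z \<and>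
      z \<otimes>\<^bsub>?S\<^esub> (x \<oplus>\<^bsub>?S\<^esub> y) = z \<otimes>\<^bsub>?S\<^esub> x \<oplus>\<^bsub>?S\<^esub> z \<otimes>\<^bsub>?S\<^esub> y"
    if x: "x \<in> carrier ?S" and y: "y \<in> carrier ?S" and z: "z \<in> carrier ?S" for x y z
  proof (intro conjI extensionalityI[OF mext aext])
    fix k assume k: "k \<in> carrier G"
    define A where "A = ?s x \<union> ?s y"
    have A: "finite A" "A \<subseteq> carrier G" and sx: "?s x \<subseteq> A" and sy: "?s y \<subseteq> A"
      using fin x y sc by (auto simp: A_def)
    have xy: "x \<oplus>\<^bsub>?S\<^esub> y \<in> carrier ?S" "?s (x \<oplus>\<^bsub>?S\<^esub> y) \<subseteq> A"
      using add[OF x y] by (auto simp: A_def)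
    define C where "C = ?s z"
    have C: "finite C" "C \<subseteq> carrier G" "?s z \<subseteq> C" using fin[OF z] sc by (auto simp: C_def)
    have mem: "a \<in> A \<Longrightarrow> a \<in> carrier G" "a \<in> C \<Longrightarrow> a \<in> carrier G" for a using A C by auto
    note cc = c[OF x] c[OF y] c[OF z] mem \<phi>c
    show "((x \<oplus>\<^bsub>?S\<^esub> y) \<otimes>\<^bsub>?S\<^esub> z) k = (x \<otimes>\<^bsub>?S\<^esub> z \<oplus>\<^bsub>?S\<^esub> y \<otimes>\<^bsub>?S\<^esub> z) k"
      unfolding addk[OF k] mult[OF xy(1) z A xy(2) C k] mult[OF x z A sx C k] mult[OF y z A sy C k]
      by (rule finsum2[symmetric]) (auto simp: cc addk l_distr)
    show "(z \<otimes>\<^bsub>?S\<^esub> (x \<oplus>\<^bsub>?S\<^esub> y)) k = (z \<otimes>\<^bsub>?S\<^esub> x \<oplus>\<^bsub>?S\<^esub> z \<otimes>\<^bsub>?S\<^esub> y) k"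
      unfolding addk[OF k] mult[OF z xy(1) C A xy(2) k] mult[OF z x C A sx k] mult[OF z y C A sy k]
      by (rule finsum2[symmetric]) (auto simp: cc addk r_distr ring_hom_add[OF hom])
  qed
  show ?thesis
    by (intro ringI abel monoidI) (use prod one neutral assoc distr in auto)
qed

end

theory Submission
  imports Defs "HOL-Library.Poly_Mapping" "HOL-Library.Z2" "HOL-Library.Countable_Set"
    "HOL-Library.Function_Algebras"
begin

text \<open>
  An epimorphism \<open>S\<^sup>p \<rightarrow> S\<^sup>q\<close> exists iff there are a \<open>q \<times> p\<close> matrix \<open>a\<close> and a \<open>p \<times> q\<close> matrix \<open>b\<close>
  over \<open>S\<close> with \<open>a b = 1\<close>; call this a \<^emph>\<open>rectangular identity\<close> of shape \<open>(p, q)\<close>.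

  Suppose that for every \<open>n > 0\<close> there is a ring \<open>A\<^sub>n\<close> with a rectangular identity of shape
  \<open>(n, N)\<close> for a prescribed large \<open>N\<close>, but with none of shape \<open>(k, k + 1)\<close> for \<open>k < n\<close>. Put
  \<open>R = A\<^sub>m \<times> A\<^sub>n\<^sup>G\<close>, where \<open>G\<close> acts trivially on the first factor and by translation on the functions
  \<open>G \<rightarrow> A\<^sub>n\<close>. As \<open>m \<le> n\<close>, padding with zeros shows that \<open>R\<close> has a rectangular identity of shape
  \<open>(n, n + 1)\<close>, and evaluation at the unit of \<open>G\<close> maps \<open>R\<close> onto \<open>A\<^sub>n\<close>; so \<open>gn R = n\<close>. The skew group
  ring is \<open>A\<^sub>m[G] \<times> M\<^sub>n(A\<^sub>n)\<close>. The second factor has a rectangular identity of shape \<open>(1, m + 1)\<close>,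
  because \<open>A\<^sub>n\<close> has one of shape \<open>(n, (m + 1) n)\<close>; the first factor contains \<open>A\<^sub>m\<close> and is mapped
  to \<open>A\<^sub>m\<close> by the augmentation. So its generating number is \<open>m\<close>.

  The ring \<open>A\<^sub>n\<close> is the universal one over the field of two elements: it is generated by letters
  \<open>c\<^sub>i\<^sub>j\<close> and \<open>d\<^sub>j\<^sub>l\<close> (\<open>i, l\<close> in a finite index set \<open>I\<close>, \<open>j < n\<close>) subject to
  \<open>\<Sum>\<^sub>j c\<^sub>i\<^sub>j d\<^sub>j\<^sub>l = \<delta>\<^sub>i\<^sub>l\<close>. Rewriting \<open>c\<^sub>i\<^sub>0 d\<^sub>0\<^sub>l\<close> as \<open>\<delta>\<^sub>i\<^sub>l + \<Sum>\<^sub>j\<^sub>>\<^sub>0 c\<^sub>i\<^sub>j d\<^sub>j\<^sub>l\<close> gives normal forms, and hence the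
  \<open>syzygy\<close> lemma: if \<open>\<Sum>\<^sub>x p\<^sub>x x\<close> (sum over the letters) has smaller degree than it should, then
  to leading order \<open>p\<close> is a left combination of the defining relations. From this follows, in the manner of
  P. M. Cohn, a weak algorithm for fewer than \<open>n\<close> terms (\<open>weak_algorithm\<close>): if \<open>k < n\<close> and the
  leading terms cancel in \<open>\<Sum>\<^sub>i a\<^sub>i b\<^sub>i\<close> (\<open>i < k\<close>), then some \<open>a\<^sub>i\<close> can be lowered in degree by
  subtracting a right combination of the others. Given a rectangular identity \<open>a b = 1\<close> with
  fewer than \<open>n\<close> columns in \<open>a\<close> and fewer columns than rows, column operations on \<open>a\<close> therefore
  reduce a row of \<open>a\<close> until a column of \<open>a\<close> and the matching row of \<open>b\<close> can be deleted
  together with that row of \<open>a\<close>; iteration ends in \<open>0 = 1\<close> (\<open>no_rectangular_identity\<close>).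
\<close>

section \<open>Epimorphisms of free modules as rectangular matrix identities\<close>

text \<open>
  The columns of \<open>a\<close> are the images of the standard basis of \<open>R\<^sup>k\<close>, and the columns of \<open>b\<close> are preimages
  of the standard basis of \<open>R\<^sup>k'\<close>. Scalars act on the right, so a homomorphism is left multiplication
  by its matrix.
\<close>

lemma (in ring) epi_imp_matrices:
  assumes "rmod_epi R (free_rmod R k) (free_rmod R k') \<noteq> {}"
  shows "\<exists>a b. (\<forall>i<k'. \<forall>j<k. a i j \<in> carrier R) \<and> (\<forall>j<k. \<forall>l<k'. b j l \<in> carrier R) \<and>
    (\<forall>i<k'. \<forall>l<k'. (\<Oplus>j\<in>{..<k}. a i j \<otimes> b j l) = (if i = l then \<one> else \<zero>))"
proof -
  let ?F = "free_rmod R k" and ?F' = "free_rmod R k'"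
  obtain f where f: "f \<in> rmod_hom R ?F ?F'" and surj: "f ` carrier ?F = carrier ?F'"
    using assms by (auto simp: rmod_epi_def)
  have fc: "f x \<in> carrier ?F'" if "x \<in> carrier ?F" for x
    using f that by (auto simp: rmod_hom_def)
  have fc': "f x i \<in> carrier R" if "x \<in> carrier ?F" "i < k'" for x i
    using fc[OF that(1)] that(2) by (auto simp: free_rmod_def)
  have fadd: "f (x \<oplus>\<^bsub>?F\<^esub> y) = f x \<oplus>\<^bsub>?F'\<^esub> f y" if "x \<in> carrier ?F" "y \<in> carrier ?F" for x y
    using f that by (auto simp: rmod_hom_def)
  have fsm: "f (r \<odot>\<^bsub>?F\<^esub> x) = r \<odot>\<^bsub>?F'\<^esub> f x" if "r \<in> carrier R" "x \<in> carrier ?F" for x r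
    using f that by (auto simp: rmod_hom_def)
  define e where "e = (\<lambda>j::nat. \<lambda>i\<in>{..<k}. if i = j then \<one> else \<zero>)"
  have e: "e j \<in> carrier ?F" for j by (auto simp: e_def free_rmod_def)
  \<comment> \<open>Induction over a bound on the support avoids finite sums in the free module.\<close>
  have expand: "f x i = (\<Oplus>j\<in>{..<p}. f (e j) i \<otimes> x j)"
    if "p \<le> k" "x \<in> carrier ?F" "\<And>j. p \<le> j \<Longrightarrow> j < k \<Longrightarrow> x j = \<zero>" and i: "i < k'" for p x i
    using that(1-3)
  proof (induction p arbitrary: x)
    case 0
    have "x = \<zero> \<odot>\<^bsub>?F\<^esub> x"
    proof (rule extensionalityI)
      show "x j = (\<zero> \<odot>\<^bsub>?F\<^esub> x) j" if "j \<in> {..<k}" for j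
        using that 0 by (simp add: free_rmod_def)
    qed (use 0 in \<open>auto simp: free_rmod_def PiE_def\<close>)
    then have "f x i = (\<zero> \<odot>\<^bsub>?F'\<^esub> f x) i" using fsm[of \<zero> x] 0 by simp
    also have "\<dots> = \<zero>" using i fc'[OF 0(2) i] by (simp add: free_rmod_def)
    finally show ?case by simp
  next
    case (Suc p)
    define y where "y = (\<lambda>j\<in>{..<k}. if j = p then \<zero> else x j)"
    have xc: "x j \<in> carrier R" if "j < k" for j using Suc.prems(2) that by (auto simp: free_rmod_def)
    have y: "y \<in> carrier ?F" using xc by (auto simp: y_def free_rmod_def)
    have p: "p < k" using Suc.prems by simp
    have sm: "x p \<odot>\<^bsub>?F\<^esub> e p \<in> carrier ?F" using xc p by (auto simp: e_def free_rmod_def)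
    have "x = y \<oplus>\<^bsub>?F\<^esub> (x p \<odot>\<^bsub>?F\<^esub> e p)"
    proof (rule extensionalityI)
      show "x j = (y \<oplus>\<^bsub>?F\<^esub> (x p \<odot>\<^bsub>?F\<^esub> e p)) j" if "j \<in> {..<k}" for j
        using that xc p by (simp add: free_rmod_def y_def e_def)
    qed (use Suc.prems in \<open>auto simp: free_rmod_def PiE_def\<close>)
    then have "f x i = (f y \<oplus>\<^bsub>?F'\<^esub> (x p \<odot>\<^bsub>?F'\<^esub> f (e p))) i"
      using fadd[OF y sm] fsm[OF xc[OF p] e] by simp
    also have "\<dots> = f y i \<oplus> f (e p) i \<otimes> x p" using i by (simp add: free_rmod_def)
    also have "f y i = (\<Oplus>j\<in>{..<p}. f (e j) i \<otimes> y j)"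
    proof (rule Suc.IH[OF _ y])
      show "y j = \<zero>" if "p \<le> j" "j < k" for j
        using Suc.prems(3)[of j] that by (cases "j = p") (simp_all add: y_def)
    qed (use p in simp)
    also have "\<dots> = (\<Oplus>j\<in>{..<p}. f (e j) i \<otimes> x j)"
      using p xc fc'[OF e i] by (intro finsum_cong') (auto simp: y_def)
    also have "(\<Oplus>j\<in>{..<p}. f (e j) i \<otimes> x j) \<oplus> f (e p) i \<otimes> x p = (\<Oplus>j\<in>{..<Suc p}. f (e j) i \<otimes> x j)"
      unfolding lessThan_Suc using p xc fc'[OF e i]
      by (subst finsum_insert) (auto simp: a_comm intro!: finsum_closed)
    finally show ?case .
  qed
  define d where "d = (\<lambda>l::nat. \<lambda>i\<in>{..<k'}. if i = l then \<one> else \<zero>)"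
  have "\<forall>l. \<exists>x\<in>carrier ?F. f x = d l"
  proof
    fix l
    have "d l \<in> carrier ?F'" by (auto simp: d_def free_rmod_def)
    then show "\<exists>x\<in>carrier ?F. f x = d l" using surj by (metis imageE)
  qed
  then obtain b where b: "\<And>l. b l \<in> carrier ?F" "\<And>l. f (b l) = d l" by metis
  show ?thesis
  proof (rule exI[of _ "\<lambda>i j. f (e j) i"], rule exI[of _ "\<lambda>j l. b l j"], intro conjI allI impI)
    show "f (e j) i \<in> carrier R" if "i < k'" "j < k" for i j using fc'[OF e that(1)] .
    show "b l j \<in> carrier R" if "j < k" "l < k'" for j l using b(1)[of l] that by (auto simp: free_rmod_def)
    show "(\<Oplus>j\<in>{..<k}. f (e j) i \<otimes> b l j) = (if i = l then \<one> else \<zero>)" if "i < k'" "l < k'" for i l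
      using expand[of k "b l" i] b that by (simp add: d_def)
  qed
qed

lemma (in ring) matrices_imp_epi:
  assumes a: "\<And>i j. i < k' \<Longrightarrow> j < k \<Longrightarrow> a i j \<in> carrier R"
    and b: "\<And>j l. j < k \<Longrightarrow> l < k' \<Longrightarrow> b j l \<in> carrier R"
    and ab: "\<And>i l. i < k' \<Longrightarrow> l < k' \<Longrightarrow> (\<Oplus>j\<in>{..<k}. a i j \<otimes> b j l) = (if i = l then \<one> else \<zero>)"
  shows "rmod_epi R (free_rmod R k) (free_rmod R k') \<noteq> {}"
proof -
  let ?F = "free_rmod R k" and ?F' = "free_rmod R k'"
  define f where "f = (\<lambda>x. \<lambda>i\<in>{..<k'}. \<Oplus>j\<in>{..<k}. a i j \<otimes> x j)"
  have c: "x j \<in> carrier R" if "x \<in> carrier ?F" "j < k" for x j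
    using that by (auto simp: free_rmod_def)
  have f: "f x \<in> carrier ?F'" if "x \<in> carrier ?F" for x
    using c[OF that] a by (auto simp: f_def free_rmod_def intro!: finsum_closed)
  have hom: "f \<in> rmod_hom R ?F ?F'"
    unfolding rmod_hom_def
  proof (intro CollectI conjI ballI Pi_I)
    fix x y assume x: "x \<in> carrier ?F" and y: "y \<in> carrier ?F"
    show "f (x \<oplus>\<^bsub>?F\<^esub> y) = f x \<oplus>\<^bsub>?F'\<^esub> f y"
    proof (rule extensionalityI)
      fix i assume i: "i \<in> {..<k'}"
      have "(\<Oplus>j\<in>{..<k}. a i j \<otimes> (x j \<oplus> y j)) = (\<Oplus>j\<in>{..<k}. a i j \<otimes> x j \<oplus> a i j \<otimes> y j)"
        using c[OF x] c[OF y] a i by (intro finsum_cong') (auto simp: r_distr)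
      also have "\<dots> = (\<Oplus>j\<in>{..<k}. a i j \<otimes> x j) \<oplus> (\<Oplus>j\<in>{..<k}. a i j \<otimes> y j)"
        using c[OF x] c[OF y] a i by (intro finsum_addf) auto
      finally show "f (x \<oplus>\<^bsub>?F\<^esub> y) i = (f x \<oplus>\<^bsub>?F'\<^esub> f y) i"
        using i c[OF x] c[OF y] a
        by (simp add: f_def free_rmod_def cong: finsum_cong)
    qed (auto simp: f_def free_rmod_def)
  next
    fix r x assume r: "r \<in> carrier R" and x: "x \<in> carrier ?F"
    show "f (r \<odot>\<^bsub>?F\<^esub> x) = r \<odot>\<^bsub>?F'\<^esub> f x"
    proof (rule extensionalityI)
      fix i assume i: "i \<in> {..<k'}"
      have "(\<Oplus>j\<in>{..<k}. a i j \<otimes> x j) \<otimes> r = (\<Oplus>j\<in>{..<k}. a i j \<otimes> x j \<otimes> r)"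
        using c[OF x] a i r by (intro finsum_ldistr) auto
      also have "\<dots> = (\<Oplus>j\<in>{..<k}. a i j \<otimes> (x j \<otimes> r))"
        using c[OF x] a i r by (intro finsum_cong') (auto simp: m_assoc)
      also have "\<dots> = (\<Oplus>j\<in>{..<k}. a i j \<otimes> (r \<odot>\<^bsub>?F\<^esub> x) j)"
        using c[OF x] a i r by (intro finsum_cong') (auto simp: free_rmod_def)
      finally show "f (r \<odot>\<^bsub>?F\<^esub> x) i = (r \<odot>\<^bsub>?F'\<^esub> f x) i"
        using i by (simp add: f_def free_rmod_def)
    qed (auto simp: f_def free_rmod_def)
  qed (use f in auto)
  have "f ` carrier ?F = carrier ?F'"
  proof (intro equalityI subsetI)
    fix y assume y: "y \<in> carrier ?F'"
    have yc: "y l \<in> carrier R" if "l < k'" for l using y that by (auto simp: free_rmod_def)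
    define x where "x = (\<lambda>j\<in>{..<k}. \<Oplus>l\<in>{..<k'}. b j l \<otimes> y l)"
    have x: "x \<in> carrier ?F" using b yc by (auto simp: x_def free_rmod_def intro!: finsum_closed)
    have "f x = y"
    proof (rule extensionalityI)
      fix i assume "i \<in> {..<k'}"
      then have i: "i < k'" by simp
      have "f x i = (\<Oplus>j\<in>{..<k}. a i j \<otimes> (\<Oplus>l\<in>{..<k'}. b j l \<otimes> y l))"
        using i a b yc by (auto simp: f_def x_def intro!: finsum_cong' finsum_closed)
      also have "\<dots> = (\<Oplus>j\<in>{..<k}. \<Oplus>l\<in>{..<k'}. a i j \<otimes> b j l \<otimes> y l)"
      proof (intro finsum_cong')
        fix j assume j: "j \<in> {..<k}"
        have "a i j \<otimes> (\<Oplus>l\<in>{..<k'}. b j l \<otimes> y l) = (\<Oplus>l\<in>{..<k'}. a i j \<otimes> (b j l \<otimes> y l))"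
          using a b yc i j by (intro finsum_rdistr) auto
        also have "\<dots> = (\<Oplus>l\<in>{..<k'}. a i j \<otimes> b j l \<otimes> y l)"
          using a b yc i j by (intro finsum_cong') (auto simp: m_assoc)
        finally show "a i j \<otimes> (\<Oplus>l\<in>{..<k'}. b j l \<otimes> y l) = (\<Oplus>l\<in>{..<k'}. a i j \<otimes> b j l \<otimes> y l)" .
      qed (use a b yc i in \<open>auto intro!: finsum_closed\<close>)
      also have "\<dots> = (\<Oplus>l\<in>{..<k'}. \<Oplus>j\<in>{..<k}. a i j \<otimes> b j l \<otimes> y l)"
        using a b yc i by (intro finsum_swap) auto
      also have "\<dots> = (\<Oplus>l\<in>{..<k'}. (if l = i then y l else \<zero>))"
      proof (intro finsum_cong')
        fix l assume l: "l \<in> {..<k'}"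
        have "(\<Oplus>j\<in>{..<k}. a i j \<otimes> b j l \<otimes> y l) = (\<Oplus>j\<in>{..<k}. a i j \<otimes> b j l) \<otimes> y l"
          using a b yc i l by (intro finsum_ldistr[symmetric]) auto
        then show "(\<Oplus>j\<in>{..<k}. a i j \<otimes> b j l \<otimes> y l) = (if l = i then y l else \<zero>)"
          using ab[OF i, of l] l yc by auto
      qed (use yc in auto)
      also have "\<dots> = y i" using yc i by (subst add.finprod_singleton_swap) auto
      finally show "f x i = y i" .
    qed (use y in \<open>auto simp: f_def free_rmod_def PiE_def\<close>)
    then show "y \<in> f ` carrier ?F" using x by blast
  qed (use f in auto)
  then show ?thesis using hom by (auto simp: rmod_epi_def)
qed

lemma gn_eqI:
  assumes "0 < N" and "rmod_epi S (free_rmod S N) (free_rmod S (N + 1)) \<noteq> {}"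
    and "\<And>k. k < N \<Longrightarrow> rmod_epi S (free_rmod S k) (free_rmod S (k + 1)) = {}"
  shows "gn S = enat N"
proof -
  have "(LEAST n. n > 0 \<and> rmod_epi S (free_rmod S n) (free_rmod S (n + 1)) \<noteq> {}) = N"
    using assms by (intro Least_equality) (auto simp: not_less[symmetric])
  then show ?thesis using assms by (auto simp: gn_def)
qed

text \<open>
  A rectangular identity of shape \<open>(p, q)\<close> with entries in \<open>T\<close>: a \<open>q \<times> p\<close> matrix \<open>a\<close> and a
  \<open>p \<times> q\<close> matrix \<open>b\<close> whose product is the identity. The set \<open>T\<close> need not be a subring.
\<close>

definition rect_identity :: "'b::ring_1 set \<Rightarrow> nat \<Rightarrow> nat \<Rightarrow> bool" where
  "rect_identity T p q \<longleftrightarrow> (\<exists>a b. (\<forall>i<q. \<forall>j<p. a i j \<in> T) \<and> (\<forall>j<p. \<forall>l<q. b j l \<in> T) \<and>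
    (\<forall>i<q. \<forall>l<q. (\<Sum>j<p. a i j * b j l) = (if i = l then 1 else 0)))"

lemma rect_identityI:
  assumes "\<And>i j. i < q \<Longrightarrow> j < p \<Longrightarrow> a i j \<in> T" "\<And>j l. j < p \<Longrightarrow> l < q \<Longrightarrow> b j l \<in> T"
    and "\<And>i l. i < q \<Longrightarrow> l < q \<Longrightarrow> (\<Sum>j<p. a i j * b j l) = (if i = l then 1 else 0)"
  shows "rect_identity T p q"
  unfolding rect_identity_def by (rule exI[of _ a], rule exI[of _ b]) (simp add: assms)

lemma rect_identityE:
  assumes "rect_identity T p q"
  obtains a b where "\<And>i j. i < q \<Longrightarrow> j < p \<Longrightarrow> a i j \<in> T" "\<And>j l. j < p \<Longrightarrow> l < q \<Longrightarrow> b j l \<in> T"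
    "\<And>i l. i < q \<Longrightarrow> l < q \<Longrightarrow> (\<Sum>j<p. a i j * b j l) = (if i = l then 1 else 0)"
proof -
  from assms obtain a b where *: "\<forall>i<q. \<forall>j<p. a i j \<in> T" "\<forall>j<p. \<forall>l<q. b j l \<in> T"
    "\<forall>i<q. \<forall>l<q. (\<Sum>j<p. a i j * b j l) = (if i = l then 1 else 0)"
    unfolding rect_identity_def by (elim exE conjE) (rule that)
  show thesis by (rule that[of a b]) (simp_all add: *)
qed

lemma rect_identity_mono:
  assumes "rect_identity T p q" "T \<subseteq> T'"
  shows "rect_identity T' p q"
proof -
  from assms(1) obtain a b where ab: "\<And>i j. i < q \<Longrightarrow> j < p \<Longrightarrow> a i j \<in> T"
    "\<And>j l. j < p \<Longrightarrow> l < q \<Longrightarrow> b j l \<in> T"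
    "\<And>i l. i < q \<Longrightarrow> l < q \<Longrightarrow> (\<Sum>j<p. a i j * b j l) = (if i = l then 1 else 0)"
    by (rule rect_identityE) (rule that)
  show ?thesis
    by (rule rect_identityI[of q p a T' b]) (use ab assms(2) in auto)
qed

text \<open>
  A unital ring homomorphism transports rectangular identities; it is how lower bounds on
  generating numbers are obtained.
\<close>

lemma epi_imp_rect_identity:
  fixes h :: "'a \<Rightarrow> 'b::ring_1" and S :: "('a, 'r) ring_scheme"
  assumes "ring S"
    and add: "\<And>x y. x \<in> carrier S \<Longrightarrow> y \<in> carrier S \<Longrightarrow> h (x \<oplus>\<^bsub>S\<^esub> y) = h x + h y"
    and mult: "\<And>x y. x \<in> carrier S \<Longrightarrow> y \<in> carrier S \<Longrightarrow> h (x \<otimes>\<^bsub>S\<^esub> y) = h x * h y"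
    and one: "h \<one>\<^bsub>S\<^esub> = 1"
    and epi: "rmod_epi S (free_rmod S k) (free_rmod S k') \<noteq> {}"
  shows "rect_identity (h ` carrier S) k k'"
proof -
  interpret ring S by fact
  have zero: "h \<zero>\<^bsub>S\<^esub> = 0" using add[of "\<zero>\<^bsub>S\<^esub>" "\<zero>\<^bsub>S\<^esub>"] by simp
  have sum: "h (finsum S f F) = (\<Sum>x\<in>F. h (f x))" if "finite F" "f \<in> F \<rightarrow> carrier S" for f and F :: "nat set"
    using that by (induction F rule: finite_induct) (auto simp: zero add finsum_closed Pi_iff)
  from epi_imp_matrices[OF epi] obtain a b where *: "\<forall>i<k'. \<forall>j<k. a i j \<in> carrier S"
    "\<forall>j<k. \<forall>l<k'. b j l \<in> carrier S"
    "\<forall>i<k'. \<forall>l<k'. (\<Oplus>\<^bsub>S\<^esub>j\<in>{..<k}. a i j \<otimes>\<^bsub>S\<^esub> b j l) = (if i = l then \<one>\<^bsub>S\<^esub> else \<zero>\<^bsub>S\<^esub>)"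
    by (elim exE conjE) (rule that)
  then have ab: "\<And>i j. i < k' \<Longrightarrow> j < k \<Longrightarrow> a i j \<in> carrier S"
    "\<And>j l. j < k \<Longrightarrow> l < k' \<Longrightarrow> b j l \<in> carrier S"
    "\<And>i l. i < k' \<Longrightarrow> l < k' \<Longrightarrow> (\<Oplus>\<^bsub>S\<^esub>j\<in>{..<k}. a i j \<otimes>\<^bsub>S\<^esub> b j l) = (if i = l then \<one>\<^bsub>S\<^esub> else \<zero>\<^bsub>S\<^esub>)"
    by simp_all
  have "(\<Sum>j<k. h (a i j) * h (b j l)) = (if i = l then 1 else 0)" if "i < k'" "l < k'" for i l
  proof -
    have "(\<Sum>j<k. h (a i j) * h (b j l)) = h (\<Oplus>\<^bsub>S\<^esub>j\<in>{..<k}. a i j \<otimes>\<^bsub>S\<^esub> b j l)"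
      using ab that by (subst sum) (auto simp: mult)
    then show ?thesis using ab(3)[OF that] one zero by simp
  qed
  then show ?thesis
    using ab(1,2) by (intro rect_identityI[of _ _ "\<lambda>i j. h (a i j)" _ "\<lambda>j l. h (b j l)"]) auto
qed

section \<open>Countable subrings as rings on the natural numbers, and skew group rings\<close>

text \<open>
  The ring of a countable subset that is closed under the ring operations, transported to natural numbers by the library's
  enumeration \<open>to_nat_on\<close> with inverse \<open>from_nat_into\<close>.
\<close>

definition nat_ring :: "'b::ring_1 set \<Rightarrow> nat ring" where
  "nat_ring S = \<lparr>carrier = to_nat_on S ` S,
     mult = (\<lambda>x y. to_nat_on S (from_nat_into S x * from_nat_into S y)),
     one = to_nat_on S 1, zero = to_nat_on S 0,
     add = (\<lambda>x y. to_nat_on S (from_nat_into S x + from_nat_into S y))\<rparr>"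

locale countable_subring =
  fixes S :: "'b::ring_1 set"
  assumes count: "countable S"
    and S_zero [simp]: "0 \<in> S" and S_one [simp]: "1 \<in> S"
    and S_add: "x \<in> S \<Longrightarrow> y \<in> S \<Longrightarrow> x + y \<in> S"
    and S_uminus: "x \<in> S \<Longrightarrow> - x \<in> S"
    and S_mult: "x \<in> S \<Longrightarrow> y \<in> S \<Longrightarrow> x * y \<in> S"
begin

abbreviation "cd \<equiv> to_nat_on S"
abbreviation "dc \<equiv> from_nat_into S"

lemma dc_cd [simp]: "x \<in> S \<Longrightarrow> dc (cd x) = x"
  using count by simp

lemma carrier_nat_ring: "carrier (nat_ring S) = cd ` S"
  by (simp add: nat_ring_def)

lemma dc_closed: "x \<in> carrier (nat_ring S) \<Longrightarrow> dc x \<in> S"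
  by (auto simp: carrier_nat_ring)

lemma cd_dc: "x \<in> carrier (nat_ring S) \<Longrightarrow> cd (dc x) = x"
  by (auto simp: carrier_nat_ring)

lemma cd_closed: "x \<in> S \<Longrightarrow> cd x \<in> carrier (nat_ring S)"
  by (auto simp: carrier_nat_ring)

lemma S_sum: "(\<And>x. x \<in> F \<Longrightarrow> f x \<in> S) \<Longrightarrow> sum f F \<in> S"
  by (induction F rule: infinite_finite_induct) (auto simp: S_add)

lemma nat_ring_simps:
  "x \<oplus>\<^bsub>nat_ring S\<^esub> y = cd (dc x + dc y)" "x \<otimes>\<^bsub>nat_ring S\<^esub> y = cd (dc x * dc y)"
  "\<one>\<^bsub>nat_ring S\<^esub> = cd 1" "\<zero>\<^bsub>nat_ring S\<^esub> = cd 0"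
  by (simp_all add: nat_ring_def)

lemma ring_nat_ring: "ring (nat_ring S)"
proof (rule ringI)
  show "abelian_group (nat_ring S)"
  proof (rule abelian_groupI)
    fix x assume x: "x \<in> carrier (nat_ring S)"
    show "\<exists>y\<in>carrier (nat_ring S). y \<oplus>\<^bsub>nat_ring S\<^esub> x = \<zero>\<^bsub>nat_ring S\<^esub>"
      using x by (intro bexI[of _ "cd (- dc x)"]) (auto simp: nat_ring_simps carrier_nat_ring S_uminus)
  qed (auto simp: nat_ring_simps carrier_nat_ring S_add algebra_simps)
  show "Group.monoid (nat_ring S)"
    by (rule monoidI) (auto simp: nat_ring_simps carrier_nat_ring S_mult algebra_simps)
qed (auto simp: nat_ring_simps carrier_nat_ring S_add S_mult algebra_simps)

lemma dc_finsum:
  assumes "finite F" "f \<in> F \<rightarrow> carrier (nat_ring S)"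
  shows "dc (finsum (nat_ring S) f F) = (\<Sum>x\<in>F. dc (f x))"
proof -
  interpret ring "nat_ring S" by (rule ring_nat_ring)
  show ?thesis using assms
    by (induction F rule: finite_induct)
      (auto simp: Pi_iff nat_ring_simps(1,4) finsum_closed dc_closed S_add S_sum)
qed

lemma nat_ring_epi_imp_rect_identity:
  assumes "rmod_epi (nat_ring S) (free_rmod (nat_ring S) k) (free_rmod (nat_ring S) k') \<noteq> {}"
  shows "rect_identity S k k'"
proof -
  have im: "dc ` carrier (nat_ring S) = S"
    by (auto simp: carrier_nat_ring image_image)
  show ?thesis
    by (rule epi_imp_rect_identity[OF ring_nat_ring, where h = dc, unfolded im, OF _ _ _ assms])
      (auto simp: nat_ring_simps dc_closed S_add S_mult)
qed

lemma matrices_imp_nat_ring_epi: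
  assumes a: "\<And>i j. i < k' \<Longrightarrow> j < k \<Longrightarrow> a i j \<in> S" and b: "\<And>j l. j < k \<Longrightarrow> l < k' \<Longrightarrow> b j l \<in> S"
    and ab: "\<And>i l. i < k' \<Longrightarrow> l < k' \<Longrightarrow> (\<Sum>j<k. a i j * b j l) = (if i = l then 1 else 0)"
  shows "rmod_epi (nat_ring S) (free_rmod (nat_ring S) k) (free_rmod (nat_ring S) k') \<noteq> {}"
proof -
  interpret ring "nat_ring S" by (rule ring_nat_ring)
  show ?thesis
  proof (rule matrices_imp_epi)
    fix i l assume il: "i < k'" "l < k'"
    let ?s = "\<Oplus>\<^bsub>nat_ring S\<^esub>j\<in>{..<k}. cd (a i j) \<otimes>\<^bsub>nat_ring S\<^esub> cd (b j l)"
    have c: "(\<lambda>j. cd (a i j) \<otimes>\<^bsub>nat_ring S\<^esub> cd (b j l)) \<in> {..<k} \<rightarrow> carrier (nat_ring S)"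
      using a b il by (auto intro!: m_closed cd_closed)
    have "dc ?s = (\<Sum>j<k. a i j * b j l)"
      using a b il by (subst dc_finsum[OF _ c]) (auto simp: nat_ring_simps S_mult)
    moreover have "?s = cd (dc ?s)" using c by (intro cd_dc[symmetric] finsum_closed)
    ultimately show "?s = (if i = l then \<one>\<^bsub>nat_ring S\<^esub> else \<zero>\<^bsub>nat_ring S\<^esub>)"
      using ab[OF il] by (simp add: nat_ring_simps)
  qed (use a b in \<open>auto intro: cd_closed\<close>)
qed

end

text \<open>
  A finite group that acts on a countable subring by automorphisms.
\<close>

locale finite_group_action = countable_subring S + G?: group G
  for S :: "'b::ring_1 set" and G :: "('g, 'h) monoid_scheme" (structure) +
  fixes act :: "'g \<Rightarrow> 'b \<Rightarrow> 'b"
  assumes finite_group: "finite (carrier G)"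
    and act_closed: "g \<in> carrier G \<Longrightarrow> x \<in> S \<Longrightarrow> act g x \<in> S"
    and act_add: "g \<in> carrier G \<Longrightarrow> x \<in> S \<Longrightarrow> y \<in> S \<Longrightarrow> act g (x + y) = act g x + act g y"
    and act_mult: "g \<in> carrier G \<Longrightarrow> x \<in> S \<Longrightarrow> y \<in> S \<Longrightarrow> act g (x * y) = act g x * act g y"
    and act_one: "g \<in> carrier G \<Longrightarrow> act g 1 = 1"
    and act_comp: "g \<in> carrier G \<Longrightarrow> h \<in> carrier G \<Longrightarrow> x \<in> S \<Longrightarrow> act (g \<otimes> h) x = act g (act h x)"
    and act_id: "x \<in> S \<Longrightarrow> act \<one> x = x"
begin

abbreviation "R \<equiv> nat_ring S"

text \<open>
  The action transported to the ring on the natural numbers.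
\<close>

definition nat_act :: "'g \<Rightarrow> nat \<Rightarrow> nat" where
  "nat_act g = (\<lambda>x\<in>carrier R. cd (act g (dc x)))"

abbreviation "RG \<equiv> skew_group_ring R G nat_act"

lemma nat_act_closed: "g \<in> carrier G \<Longrightarrow> x \<in> carrier R \<Longrightarrow> nat_act g x \<in> carrier R"
  by (simp add: nat_act_def act_closed dc_closed cd_closed)

lemma nat_act_hom: "nat_act \<in> hom G (ring_Aut R)"
proof -
  have inv: "nat_act (inv g) (nat_act g x) = x" if "g \<in> carrier G" "x \<in> carrier R" for g x
    using that by (simp add: nat_act_def act_closed dc_closed cd_closed cd_dc act_id
        flip: act_comp)
  have aut: "nat_act g \<in> ring_hom R R \<inter> Bij (carrier R)" if g: "g \<in> carrier G" for g
  proof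
    show "nat_act g \<in> ring_hom R R"
      using g ring.ring_simprules(1,5,6)[OF ring_nat_ring]
      by (intro ring_hom_memI)
        (simp_all add: nat_act_def nat_ring_simps dc_closed cd_closed S_add S_mult act_closed act_add
          act_mult act_one)
    have "bij_betw (nat_act g) (carrier R) (carrier R)"
      using g inv[of g] inv[of "inv g"] nat_act_closed
      by (intro bij_betw_byWitness[of _ "nat_act (inv g)"]) auto
    then show "nat_act g \<in> Bij (carrier R)" by (simp add: Bij_def nat_act_def)
  qed
  moreover have "nat_act (g \<otimes> h) = nat_act g \<otimes>\<^bsub>ring_Aut R\<^esub> nat_act h"
    if "g \<in> carrier G" "h \<in> carrier G" for g h
  proof -
    have "nat_act (g \<otimes> h) = compose (carrier R) (nat_act g) (nat_act h)"
      using that by (auto simp: nat_act_def compose_def act_comp act_closed dc_closed cd_closed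
          intro!: restrict_ext)
    then show ?thesis using aut that by (simp add: ring_Aut_def BijGroup_def)
  qed
  ultimately show ?thesis by (intro homI) (auto simp: ring_Aut_def)
qed

lemma ring_RG: "ring RG"
  by (rule skew_group_ring_ring[OF ring_nat_ring G.is_group nat_act_hom])

lemma carrier_RG: "carrier RG = carrier G \<rightarrow>\<^sub>E carrier R"
  using finite_group by (auto simp: skew_group_ring_def coeff_support_def)

text \<open>
  The coefficient of \<open>g\<close> in an element of the skew group ring, as an element of the original ring.
\<close>

definition coef :: "(('g \<Rightarrow> nat) \<Rightarrow> 'g \<Rightarrow> 'b)" where "coef r g = dc (r g)"

lemma coef_closed: "r \<in> carrier RG \<Longrightarrow> g \<in> carrier G \<Longrightarrow> coef r g \<in> S"
  unfolding carrier_RG coef_def by (rule dc_closed) (rule PiE_mem)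

lemma RG_eqI:
  assumes "r \<in> carrier RG" "s \<in> carrier RG" "\<And>g. g \<in> carrier G \<Longrightarrow> coef r g = coef s g"
  shows "r = s"
proof (rule extensionalityI)
  show "r \<in> extensional (carrier G)" "s \<in> extensional (carrier G)"
    using assms by (auto simp: carrier_RG PiE_def)
  fix g assume g: "g \<in> carrier G"
  then have "r g \<in> carrier R" "s g \<in> carrier R" using assms by (auto simp: carrier_RG)
  then show "r g = s g" using assms(3)[OF g] by (metis cd_dc coef_def)
qed

lemma coef_add: "r \<in> carrier RG \<Longrightarrow> s \<in> carrier RG \<Longrightarrow> g \<in> carrier G \<Longrightarrow>
    coef (r \<oplus>\<^bsub>RG\<^esub> s) g = coef r g + coef s g"
  using coef_closed[of r g] coef_closed[of s g]
  by (simp add: coef_def skew_group_ring_def nat_ring_simps S_add)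

lemma coef_zero: "g \<in> carrier G \<Longrightarrow> coef \<zero>\<^bsub>RG\<^esub> g = 0"
  by (simp add: coef_def skew_group_ring_def nat_ring_simps)

lemma coef_one: "g \<in> carrier G \<Longrightarrow> coef \<one>\<^bsub>RG\<^esub> g = (if g = \<one> then 1 else 0)"
  by (simp add: coef_def skew_group_ring_def nat_ring_simps)

lemma coef_mult:
  assumes r: "r \<in> carrier RG" and s: "s \<in> carrier RG" and k: "k \<in> carrier G"
  shows "coef (r \<otimes>\<^bsub>RG\<^esub> s) k = (\<Sum>g\<in>carrier G. coef r g * act g (coef s (inv g \<otimes> k)))"
proof -
  interpret ring R by (rule ring_nat_ring)
  let ?t = "\<lambda>a b. if a \<otimes> b = k then r a \<otimes>\<^bsub>R\<^esub> nat_act a (s b) else \<zero>\<^bsub>R\<^esub>"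
  have rc: "r g \<in> carrier R" "s g \<in> carrier R" if "g \<in> carrier G" for g
    using r s that by (auto simp: carrier_RG)
  have t: "?t a b \<in> carrier R" if "a \<in> carrier G" "b \<in> carrier G" for a b
    using that rc by (auto intro!: m_closed nat_act_closed)
  have dt: "dc (?t a b) = (if b = inv a \<otimes> k then coef r a * act a (coef s b) else 0)"
    if "a \<in> carrier G" "b \<in> carrier G" for a b
  proof -
    have "a \<otimes> b = k \<longleftrightarrow> b = inv a \<otimes> k" using that k by (metis G.inv_solve_left)
    then show ?thesis
      using that rc by (auto simp: nat_ring_simps nat_act_def coef_def dc_closed act_closed S_mult)
  qed
  have "coef (r \<otimes>\<^bsub>RG\<^esub> s) k = dc (\<Oplus>\<^bsub>R\<^esub>a\<in>carrier G. \<Oplus>\<^bsub>R\<^esub>b\<in>carrier G. ?t a b)"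
    unfolding coef_def
    by (subst skew_group_ring_mult[OF ring_nat_ring G.is_group nat_act_hom r s finite_group _ _ finite_group])
      (use k in \<open>auto simp: coeff_support_def\<close>)
  also have "\<dots> = (\<Sum>a\<in>carrier G. \<Sum>b\<in>carrier G. dc (?t a b))"
    using t finite_group by (subst dc_finsum) (auto intro!: finsum_closed sum.cong dc_finsum)
  also have "\<dots> = (\<Sum>a\<in>carrier G. \<Sum>b\<in>carrier G. if b = inv a \<otimes> k then coef r a * act a (coef s b) else 0)"
    by (intro sum.cong refl dt)
  also have "\<dots> = (\<Sum>g\<in>carrier G. coef r g * act g (coef s (inv g \<otimes> k)))"
    using finite_group k by (intro sum.cong refl) simp
  finally show ?thesis .
qed

lemma coef_finsum:
  assumes "finite F" "f \<in> F \<rightarrow> carrier RG" "g \<in> carrier G"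
  shows "coef (finsum RG f F) g = (\<Sum>x\<in>F. coef (f x) g)"
proof -
  interpret RG: ring RG by (rule ring_RG)
  show ?thesis using assms
    by (induction F rule: finite_induct) (auto simp: Pi_iff coef_zero coef_add RG.finsum_closed)
qed

text \<open>
  The element of the skew group ring with given coefficients.
\<close>

definition of_coef :: "('g \<Rightarrow> 'b) \<Rightarrow> 'g \<Rightarrow> nat" where
  "of_coef u = (\<lambda>g\<in>carrier G. cd (u g))"

lemma of_coef_closed: "(\<And>g. g \<in> carrier G \<Longrightarrow> u g \<in> S) \<Longrightarrow> of_coef u \<in> carrier RG"
  by (auto simp: of_coef_def carrier_RG cd_closed)

lemma coef_of_coef: "g \<in> carrier G \<Longrightarrow> u g \<in> S \<Longrightarrow> coef (of_coef u) g = u g"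
  by (simp add: of_coef_def coef_def)

lemma matrices_imp_skew_epi:
  assumes a: "\<And>i j g. i < p' \<Longrightarrow> j < p \<Longrightarrow> g \<in> carrier G \<Longrightarrow> a i j g \<in> S"
    and b: "\<And>j l g. j < p \<Longrightarrow> l < p' \<Longrightarrow> g \<in> carrier G \<Longrightarrow> b j l g \<in> S"
    and ab: "\<And>i l k. i < p' \<Longrightarrow> l < p' \<Longrightarrow> k \<in> carrier G \<Longrightarrow>
      (\<Sum>j<p. \<Sum>g\<in>carrier G. a i j g * act g (b j l (inv g \<otimes> k))) = (if i = l \<and> k = \<one> then 1 else 0)"
  shows "rmod_epi RG (free_rmod RG p) (free_rmod RG p') \<noteq> {}"
proof -
  interpret RG: ring RG by (rule ring_RG)
  have ac: "i < p' \<Longrightarrow> j < p \<Longrightarrow> of_coef (a i j) \<in> carrier RG"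
    "j < p \<Longrightarrow> l < p' \<Longrightarrow> of_coef (b j l) \<in> carrier RG" for i j l
    using a b by (auto intro!: of_coef_closed)
  show ?thesis
  proof (rule RG.matrices_imp_epi)
    fix i l assume il: "i < p'" "l < p'"
    let ?t = "\<lambda>j. of_coef (a i j) \<otimes>\<^bsub>RG\<^esub> of_coef (b j l)"
    show "(\<Oplus>\<^bsub>RG\<^esub>j\<in>{..<p}. ?t j) = (if i = l then \<one>\<^bsub>RG\<^esub> else \<zero>\<^bsub>RG\<^esub>)"
    proof (rule RG_eqI)
      fix k assume k: "k \<in> carrier G"
      have "coef (\<Oplus>\<^bsub>RG\<^esub>j\<in>{..<p}. ?t j) k = (\<Sum>j<p. coef (?t j) k)"
        using ac il k by (intro coef_finsum) auto
      also have "\<dots> = (\<Sum>j<p. \<Sum>g\<in>carrier G. a i j g * act g (b j l (inv g \<otimes> k)))"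
        using ac il k a b by (intro sum.cong refl) (simp add: coef_mult coef_of_coef)
      finally show "coef (\<Oplus>\<^bsub>RG\<^esub>j\<in>{..<p}. ?t j) k = coef (if i = l then \<one>\<^bsub>RG\<^esub> else \<zero>\<^bsub>RG\<^esub>) k"
        using ab[OF il k] k by (simp add: coef_one coef_zero)
    qed (use ac il in \<open>auto intro!: RG.finsum_closed\<close>)
  qed (use ac in auto)
qed

text \<open>
  The augmentation \<open>\<Sum>\<^sub>g r\<^sub>g g \<mapsto> \<Sum>\<^sub>g \<psi> r\<^sub>g\<close> of an invariant homomorphism \<open>\<psi>\<close> is a homomorphism on the skew
  group ring.
\<close>

lemma skew_epi_imp_rect_identity:
  fixes \<psi> :: "'b \<Rightarrow> 'c::ring_1"
  assumes add: "\<And>x y. x \<in> S \<Longrightarrow> y \<in> S \<Longrightarrow> \<psi> (x + y) = \<psi> x + \<psi> y"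
    and mult: "\<And>x y. x \<in> S \<Longrightarrow> y \<in> S \<Longrightarrow> \<psi> (x * y) = \<psi> x * \<psi> y"
    and one: "\<psi> 1 = 1"
    and invar: "\<And>g x. g \<in> carrier G \<Longrightarrow> x \<in> S \<Longrightarrow> \<psi> (act g x) = \<psi> x"
    and T: "\<And>x. x \<in> S \<Longrightarrow> \<psi> x \<in> T" "\<And>x y. x \<in> T \<Longrightarrow> y \<in> T \<Longrightarrow> x + y \<in> T"
    and epi: "rmod_epi RG (free_rmod RG p) (free_rmod RG p') \<noteq> {}"
  shows "rect_identity T p p'"
proof -
  have zero: "\<psi> 0 = 0" using add[of 0 0] by simp
  have \<psi>sum: "\<psi> (sum f F) = (\<Sum>x\<in>F. \<psi> (f x))" if "\<And>x. x \<in> F \<Longrightarrow> f x \<in> S" for f and F :: "'g set"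
    using that by (induction F rule: infinite_finite_induct) (auto simp: zero add S_sum)
  define h where "h = (\<lambda>r. \<Sum>g\<in>carrier G. \<psi> (coef r g))"
  have hT: "h r \<in> T" if "r \<in> carrier RG" for r
  proof -
    have "(\<Sum>g\<in>F. \<psi> (coef r g)) \<in> T" if "finite F" "F \<subseteq> carrier G" for F
      using that
    proof (induction F rule: finite_induct)
      case empty
      then show ?case using T(1)[of 0] zero by simp
    next
      case (insert g F)
      then show ?case using T coef_closed[OF \<open>r \<in> carrier RG\<close>] by simp
    qed
    then show ?thesis unfolding h_def using finite_group by blast
  qed
  have "rect_identity (h ` carrier RG) p p'"
  proof (rule epi_imp_rect_identity[OF ring_RG _ _ _ epi])
    fix r s assume rs: "r \<in> carrier RG" "s \<in> carrier RG"
    show "h (r \<oplus>\<^bsub>RG\<^esub> s) = h r + h s"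
      unfolding h_def using rs by (simp add: coef_add add coef_closed sum.distrib)
    have "h (r \<otimes>\<^bsub>RG\<^esub> s) = (\<Sum>k\<in>carrier G. \<Sum>g\<in>carrier G. \<psi> (coef r g) * \<psi> (coef s (inv g \<otimes> k)))"
      unfolding h_def using rs
      by (intro sum.cong refl) (simp add: coef_mult \<psi>sum S_mult act_closed coef_closed mult invar)
    also have "\<dots> = (\<Sum>g\<in>carrier G. \<Sum>k\<in>carrier G. \<psi> (coef r g) * \<psi> (coef s (inv g \<otimes> k)))"
      by (rule sum.swap)
    also have "\<dots> = (\<Sum>g\<in>carrier G. \<Sum>k\<in>carrier G. \<psi> (coef r g) * \<psi> (coef s k))"
    proof (rule sum.cong[OF refl])
      fix g assume g: "g \<in> carrier G"
      show "(\<Sum>k\<in>carrier G. \<psi> (coef r g) * \<psi> (coef s (inv g \<otimes> k)))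
          = (\<Sum>k\<in>carrier G. \<psi> (coef r g) * \<psi> (coef s k))"
        by (rule sum.reindex_bij_witness[of _ "\<lambda>k. g \<otimes> k" "\<lambda>k. inv g \<otimes> k"])
          (use g in \<open>auto simp flip: G.m_assoc\<close>)
    qed
    finally show "h (r \<otimes>\<^bsub>RG\<^esub> s) = h r * h s" by (simp add: h_def sum_product)
  next
    have "h \<one>\<^bsub>RG\<^esub> = (\<Sum>g\<in>carrier G. if g = \<one> then 1 else 0)"
      unfolding h_def by (intro sum.cong refl) (simp add: coef_one one zero)
    then show "h \<one>\<^bsub>RG\<^esub> = 1" using finite_group by simp
  qed
  moreover have "h ` carrier RG \<subseteq> T" using hT by blast
  ultimately show ?thesis by (rule rect_identity_mono)
qed

end

section \<open>The endomorphism ring of the space of words\<close>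

text \<open>
  The letters \<open>c\<^sub>i\<^sub>j\<close> and \<open>d\<^sub>j\<^sub>l\<close> are \<open>Cl i j\<close> and \<open>Dl j l\<close>. A list of letters represents a word read from
  right to left: its head is the last letter, so that right multiplication acts at the head. A
  vector is a formal sum of words with coefficients in the field of two elements.
\<close>

datatype letter = Cl nat nat | Dl nat nat

type_synonym vec = "letter list \<Rightarrow>\<^sub>0 bit"

abbreviation bvec :: "letter list \<Rightarrow> vec" where
  "bvec w \<equiv> Poly_Mapping.single w 1"

text \<open>
  The linear extension of \<open>\<phi>\<close>. It is additive when \<open>x + x = 0\<close> holds for the values of \<open>\<phi>\<close>.
\<close>

definition lin :: "(letter list \<Rightarrow> 'b) \<Rightarrow> vec \<Rightarrow> 'b::comm_monoid_add" where
  "lin \<phi> v = (\<Sum>w\<in>Poly_Mapping.keys v. \<phi> w)"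

lemma lin_superset:
  assumes "finite S" "Poly_Mapping.keys v \<subseteq> S"
  shows "lin \<phi> v = (\<Sum>w\<in>S. if Poly_Mapping.lookup v w = 0 then 0 else \<phi> w)"
  unfolding lin_def using assms
  by (intro sum.mono_neutral_cong_left) (auto simp: in_keys_iff)

lemma lin_add:
  assumes "\<And>w. \<phi> w + \<phi> w = (0 :: 'b::comm_monoid_add)"
  shows "lin \<phi> (u + v) = lin \<phi> u + lin \<phi> v"
proof -
  let ?S = "Poly_Mapping.keys u \<union> Poly_Mapping.keys v"
  have S: "finite ?S" "Poly_Mapping.keys (u + v) \<subseteq> ?S"
    by (auto simp: Poly_Mapping.keys_add)
  have bit: "(if a + b = 0 then 0 else \<phi> w) = (if a = 0 then 0 else \<phi> w) + (if b = 0 then 0 else \<phi> w)"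
    for a b :: bit and w using assms by (cases a; cases b) simp_all
  show ?thesis
    using S by (subst (1 2 3) lin_superset[of ?S])
      (auto simp: lookup_add bit assms simp flip: sum.distrib intro!: sum.cong)
qed

lemma lin_bvec [simp]: "lin \<phi> (bvec w) = \<phi> w"
  by (simp add: lin_def)

lemma lin_zero [simp]: "lin \<phi> 0 = 0"
  by (simp add: lin_def)

lemma vec_add_self [simp]: "(v::vec) + v = 0"
  by (rule poly_mapping_eqI) (simp add: lookup_add)

lemma vec_expand: "v = (\<Sum>w\<in>Poly_Mapping.keys v. bvec w)"
proof (rule poly_mapping_eqI)
  fix u
  have "Poly_Mapping.lookup (\<Sum>w\<in>Poly_Mapping.keys v. bvec w) u
      = (\<Sum>w\<in>Poly_Mapping.keys v. if w = u then 1 else 0)"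
    by (simp add: lookup_sum lookup_single when_def)
  also have "\<dots> = Poly_Mapping.lookup v u"
    by (cases "Poly_Mapping.lookup v u") (simp_all add: in_keys_iff)
  finally show "Poly_Mapping.lookup v u = Poly_Mapping.lookup (\<Sum>w\<in>Poly_Mapping.keys v. bvec w) u" ..
qed

lemma additive_eq_lin:
  fixes f :: "vec \<Rightarrow> 'b::ab_group_add"
  assumes "\<And>u v. f (u + v) = f u + f v"
  shows "f v = lin (\<lambda>w. f (bvec w)) v"
proof -
  have "f 0 = 0" using assms[of 0 0] by simp
  then have "f (sum g S) = (\<Sum>w\<in>S. f (g w))" for g :: "letter list \<Rightarrow> vec" and S
    using assms by (induction S rule: infinite_finite_induct) auto
  then show ?thesis
    by (subst vec_expand) (simp add: lin_def)
qed

text \<open>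
  Additive endomorphisms of the space of vectors. The product is composition in reversed order,
  \<open>(f g) v = g (f v)\<close>, since right multiplications are to be represented.
\<close>

typedef endo = "{f :: vec \<Rightarrow> vec. \<forall>u v. f (u + v) = f u + f v}"
  morphisms app Endo
  by (rule exI[of _ "\<lambda>_. 0"]) simp

setup_lifting type_definition_endo

instantiation endo :: ring_1
begin
lift_definition zero_endo :: endo is "\<lambda>_. 0" by simp
lift_definition one_endo :: endo is "\<lambda>v. v" by simp
lift_definition plus_endo :: "endo \<Rightarrow> endo \<Rightarrow> endo" is "\<lambda>f g v. f v + g v"
  by (simp add: add.assoc add.left_commute)
lift_definition minus_endo :: "endo \<Rightarrow> endo \<Rightarrow> endo" is "\<lambda>f g v. f v - g v"
  by (simp add: algebra_simps)
lift_definition uminus_endo :: "endo \<Rightarrow> endo" is "\<lambda>f v. - f v" by simp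
lift_definition times_endo :: "endo \<Rightarrow> endo \<Rightarrow> endo" is "\<lambda>f g v. g (f v)" by simp
instance
proof
  show "(0::endo) \<noteq> 1"
  proof transfer
    show "(\<lambda>_::vec. 0) \<noteq> (\<lambda>v. v)"
      by (metis single_zero zero_neq_one lookup_single_eq lookup_zero)
  qed
qed (transfer; simp add: fun_eq_iff algebra_simps)+
end

lemma app_add_vec: "app r (u + v) = app r u + app r v" using app by auto
lemma app_zero_vec [simp]: "app r 0 = 0" using app_add_vec[of r 0 0] by simp

lemmas app_simps [simp] = zero_endo.rep_eq one_endo.rep_eq plus_endo.rep_eq times_endo.rep_eq

lemma app_sum: "app (sum f S) v = (\<Sum>x\<in>S. app (f x) v)"
  by (induction S rule: infinite_finite_induct) auto

lemma endo_add_self [simp]: "(r::endo) + r = 0"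
  by (metis app_inject app_simps(1,3) vec_add_self ext)

lemma endo_eqI: "(\<And>w. app r (bvec w) = app s (bvec w)) \<Longrightarrow> r = s"
  by (metis (no_types, lifting) additive_eq_lin app_add_vec app_inject ext)

text \<open>
  Appending the last letter \<open>x\<close> to the word \<open>w\<close> creates the reducible factor \<open>c\<^sub>i\<^sub>0 d\<^sub>0\<^sub>l\<close>.
\<close>

fun redex :: "letter \<Rightarrow> letter list \<Rightarrow> bool" where
  "redex (Dl 0 l) (Cl i 0 # w) = True" | "redex _ _ = False"

lemma redex_iff: "redex x w \<longleftrightarrow> (\<exists>l i u. x = Dl 0 l \<and> w = Cl i 0 # u)"
  by (cases "(x, w)" rule: redex.cases) auto

text \<open>
  Right multiplication of a word \<open>w\<close> by a letter \<open>x\<close>, with the factor \<open>c\<^sub>i\<^sub>0 d\<^sub>0\<^sub>l\<close> replaced by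
  \<open>\<delta>\<^sub>i\<^sub>l + \<Sum>\<^sub>0\<^sub><\<^sub>j\<^sub><\<^sub>n c\<^sub>i\<^sub>j d\<^sub>j\<^sub>l\<close>. Signs are absent because the characteristic is 2.
\<close>

definition rstep :: "nat \<Rightarrow> letter \<Rightarrow> letter list \<Rightarrow> vec" where
  "rstep n x w = (case (x, w) of (Dl 0 l, Cl i 0 # u) \<Rightarrow>
       (if i = l then bvec u else 0) + (\<Sum>j\<in>{1..<n}. bvec (Dl j l # Cl i j # u))
     | _ \<Rightarrow> bvec (x # w))"

lemma rstep_redex: "rstep n (Dl 0 l) (Cl i 0 # u) =
       (if i = l then bvec u else 0) + (\<Sum>j\<in>{1..<n}. bvec (Dl j l # Cl i j # u))"
  by (simp add: rstep_def)

lemma rstep_not_redex: "\<not> redex x w \<Longrightarrow> rstep n x w = bvec (x # w)"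
  by (auto simp: rstep_def redex_iff split: letter.splits list.splits nat.splits)

text \<open>
  Right multiplication by a letter, as an endomorphism.
\<close>

lift_definition letter_op :: "nat \<Rightarrow> letter \<Rightarrow> endo" is "\<lambda>n x. lin (rstep n x)"
  by (simp add: lin_add)

lemma app_letter_op: "app (letter_op n x) v = lin (rstep n x) v" by (simp add: letter_op.rep_eq)

text \<open>
  The defining relations hold on all vectors, including those that involve reducible words.
\<close>

lemma letter_op_relation:
  assumes "0 < n"
  shows "(\<Sum>j<n. letter_op n (Cl i j) * letter_op n (Dl j l)) = (if i = l then 1 else 0)"
proof (rule endo_eqI)
  fix w
  have *: "{..<n} = insert 0 {1..<n}" using assms by auto
  have "app (\<Sum>j<n. letter_op n (Cl i j) * letter_op n (Dl j l)) (bvec w)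
      = (\<Sum>j<n. rstep n (Dl j l) (Cl i j # w))"
    by (simp add: app_sum app_letter_op rstep_not_redex redex_iff)
  also have "\<dots> = rstep n (Dl 0 l) (Cl i 0 # w) + (\<Sum>j\<in>{1..<n}. bvec (Dl j l # Cl i j # w))"
    unfolding * by (simp add: rstep_not_redex redex_iff)
  also have "\<dots> = (if i = l then bvec w else 0)"
    by (simp add: rstep_redex add.assoc)
  finally show "app (\<Sum>j<n. letter_op n (Cl i j) * letter_op n (Dl j l)) (bvec w)
      = app (if i = l then 1 else 0) (bvec w)"
    by simp
qed

text \<open>
  A word and a vector as elements of the ring: \<open>word_op\<close> multiplies the letters, \<open>vec_op\<close> is its linear
  extension, and \<open>at_empty\<close> recovers the vector as the image of the empty word. On normal vectors
  \<open>at_empty\<close> inverts \<open>vec_op\<close>, so the normal words are linearly independent in the ring.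
\<close>

fun word_op :: "nat \<Rightarrow> letter list \<Rightarrow> endo" where
  "word_op n [] = 1" | "word_op n (x # w) = word_op n w * letter_op n x"

definition vec_op :: "nat \<Rightarrow> vec \<Rightarrow> endo" where "vec_op n = lin (word_op n)"
definition at_empty :: "endo \<Rightarrow> vec" where "at_empty r = app r (bvec [])"

lemma vec_op_add: "vec_op n (u + v) = vec_op n u + vec_op n v" by (simp add: vec_op_def lin_add)
lemma vec_op_bvec [simp]: "vec_op n (bvec w) = word_op n w" by (simp add: vec_op_def)
lemma vec_op_zero [simp]: "vec_op n 0 = 0" by (simp add: vec_op_def)
lemma vec_op_sum: "vec_op n (sum f S) = (\<Sum>x\<in>S. vec_op n (f x))"
  by (induction S rule: infinite_finite_induct) (auto simp: vec_op_add)

lemma at_empty_add: "at_empty (r + s) = at_empty r + at_empty s" by (simp add: at_empty_def)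
lemma at_empty_zero [simp]: "at_empty 0 = 0" by (simp add: at_empty_def)
lemma at_empty_sum: "at_empty (sum f S) = (\<Sum>x\<in>S. at_empty (f x))" by (simp add: at_empty_def app_sum)
lemma at_empty_one [simp]: "at_empty 1 = bvec []" by (simp add: at_empty_def)
lemma at_empty_times: "at_empty (r * s) = app s (at_empty r)" by (simp add: at_empty_def)

text \<open>
  Rewriting does not change the element of the ring that a vector represents.
\<close>

lemma vec_op_letter_op:
  assumes "0 < n"
  shows "vec_op n (app (letter_op n x) v) = vec_op n v * letter_op n x"
proof -
  have w: "vec_op n (rstep n x w) = word_op n w * letter_op n x" for w
  proof (cases "redex x w")
    case True
    then obtain l i u where xw: "x = Dl 0 l" "w = Cl i 0 # u" by (auto simp: redex_iff)
    have *: "{..<n} = insert 0 {1..<n}" using assms by auto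
    have "word_op n w * letter_op n x = word_op n u * (letter_op n (Cl i 0) * letter_op n (Dl 0 l))"
      by (simp add: xw mult.assoc)
    also have "letter_op n (Cl i 0) * letter_op n (Dl 0 l) = (if i = l then 1 else 0)
        + (\<Sum>j\<in>{1..<n}. letter_op n (Cl i j) * letter_op n (Dl j l))"
      unfolding letter_op_relation[OF assms, symmetric] * by (simp add: add.assoc)
    finally show ?thesis
      by (simp add: xw rstep_redex vec_op_add vec_op_sum algebra_simps sum_distrib_left if_distrib)
  qed (simp add: rstep_not_redex)
  have "vec_op n (app (letter_op n x) v) = lin (\<lambda>w. vec_op n (app (letter_op n x) (bvec w))) v"
    by (rule additive_eq_lin) (simp add: app_add_vec vec_op_add)
  also have "\<dots> = lin (\<lambda>w. vec_op n (bvec w) * letter_op n x) v"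
    by (simp add: app_letter_op w)
  also have "\<dots> = vec_op n v * letter_op n x"
    by (rule additive_eq_lin[symmetric]) (simp add: vec_op_add algebra_simps)
  finally show ?thesis .
qed

section \<open>The ring of generic rectangular identities and its degree filtration\<close>

text \<open>
  Words without a reducible factor.
\<close>

fun normal :: "letter list \<Rightarrow> bool" where
  "normal [] = True" | "normal (x # w) = (\<not> redex x w \<and> normal w)"

lemma at_empty_word_op: "normal w \<Longrightarrow> at_empty (word_op n w) = bvec w"
  by (induction w) (auto simp: at_empty_times app_letter_op rstep_not_redex)

lemma at_empty_vec_op:
  assumes "\<forall>w\<in>Poly_Mapping.keys v. normal w"
  shows "at_empty (vec_op n v) = v"
proof -
  have "at_empty (vec_op n v) = (\<Sum>w\<in>Poly_Mapping.keys v. bvec w)"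
    unfolding vec_op_def lin_def at_empty_sum by (intro sum.cong refl at_empty_word_op) (use assms in auto)
  also have "\<dots> = v" by (rule vec_expand[symmetric])
  finally show ?thesis .
qed

text \<open>
  The finite alphabet: \<open>n\<close> is the inner size and \<open>I\<close> the set of outer indices of the matrices.
\<close>

definition letters :: "nat \<Rightarrow> nat set \<Rightarrow> letter set" where
  "letters n I = case_prod Cl ` (I \<times> {..<n}) \<union> case_prod Dl ` ({..<n} \<times> I)"

lemma letters_iff [simp]:
  "Cl i j \<in> letters n I \<longleftrightarrow> i \<in> I \<and> j < n" "Dl j i \<in> letters n I \<longleftrightarrow> i \<in> I \<and> j < n"
  by (auto simp: letters_def)

lemma finite_letters: "finite I \<Longrightarrow> finite (letters n I)"
  by (auto simp: letters_def)

lemma sum_letters: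
  fixes f :: "letter \<Rightarrow> 'b::comm_monoid_add"
  assumes "finite I"
  shows "(\<Sum>x\<in>letters n I. f x) = (\<Sum>i\<in>I. \<Sum>j<n. f (Cl i j)) + (\<Sum>l\<in>I. \<Sum>j<n. f (Dl j l))"
proof -
  have "(\<Sum>x\<in>letters n I. f x)
      = (\<Sum>x\<in>case_prod Cl ` (I \<times> {..<n}). f x) + (\<Sum>x\<in>case_prod Dl ` ({..<n} \<times> I). f x)"
    unfolding letters_def by (rule sum.union_disjoint) (use assms in auto)
  also have "(\<Sum>x\<in>case_prod Cl ` (I \<times> {..<n}). f x) = (\<Sum>i\<in>I. \<Sum>j<n. f (Cl i j))"
    by (subst sum.reindex) (auto simp: inj_on_def sum.cartesian_product intro!: sum.cong)
  also have "(\<Sum>x\<in>case_prod Dl ` ({..<n} \<times> I). f x) = (\<Sum>j<n. \<Sum>l\<in>I. f (Dl j l))"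
    by (subst sum.reindex) (auto simp: inj_on_def sum.cartesian_product intro!: sum.cong)
  also have "\<dots> = (\<Sum>l\<in>I. \<Sum>j<n. f (Dl j l))" by (rule sum.swap)
  finally show ?thesis .
qed

text \<open>
  The elements of degree less than \<open>t\<close>, where the degree is the length of words. With strict
  inequality, \<open>deg_lt n I 0 = {0}\<close>, and \<open>deg_lt n I 1\<close> consists of the two scalars.
\<close>

primrec deg_lt :: "nat \<Rightarrow> nat set \<Rightarrow> nat \<Rightarrow> endo set" where
  "deg_lt n I 0 = {0}"
| "deg_lt n I (Suc t) = {b + (\<Sum>x\<in>letters n I. p x * letter_op n x) | b p.
     b \<in> {0, 1} \<and> (\<forall>x\<in>letters n I. p x \<in> deg_lt n I t)}"

declare deg_lt.simps(2) [simp del]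

text \<open>
  The normal words of length less than \<open>t\<close> over the alphabet.
\<close>

definition nwords :: "nat \<Rightarrow> nat set \<Rightarrow> nat \<Rightarrow> letter list set" where
  "nwords n I t = {w. normal w \<and> set w \<subseteq> letters n I \<and> length w < t}"

lemma lookup_prepend:
  assumes "\<forall>u\<in>Poly_Mapping.keys v. \<not> redex y u"
  shows "Poly_Mapping.lookup (lin (rstep n y) v) (x # w) = (if x = y then Poly_Mapping.lookup v w else 0)"
proof -
  have "lin (rstep n y) v = (\<Sum>u\<in>Poly_Mapping.keys v. bvec (y # u))"
    unfolding lin_def by (intro sum.cong refl rstep_not_redex) (use assms in auto)
  then have "Poly_Mapping.lookup (lin (rstep n y) v) (x # w)
      = (\<Sum>u\<in>Poly_Mapping.keys v. if u = w then (if x = y then 1 else 0) else 0)"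
    by (auto simp: lookup_sum lookup_single when_def intro!: sum.cong)
  also have "\<dots> = (if x = y then Poly_Mapping.lookup v w else 0)"
    by (cases "Poly_Mapping.lookup v w") (simp_all add: in_keys_iff)
  finally show ?thesis .
qed

text \<open>
  The right cofactor of \<open>x\<close> in \<open>v\<close>: the words of \<open>v\<close> that end in the letter \<open>x\<close>, with that letter removed.
\<close>

definition cof :: "letter \<Rightarrow> vec \<Rightarrow> vec" where
  "cof x v = Poly_Mapping.map_key (Cons x) v"

lemma lookup_cof [simp]: "Poly_Mapping.lookup (cof x v) w = Poly_Mapping.lookup v (x # w)"
  by (simp add: cof_def map_key.rep_eq)

lemma rstep_nwords:
  assumes w: "w \<in> nwords n I t" and x: "x \<in> letters n I"
  shows "Poly_Mapping.keys (rstep n x w) \<subseteq> nwords n I (Suc t)"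
proof (cases "redex x w")
  case True
  then obtain l i u where xw: "x = Dl 0 l" "w = Cl i 0 # u" by (auto simp: redex_iff)
  have "Poly_Mapping.keys (rstep n x w) \<subseteq> {u} \<union> (\<Union>j\<in>{1..<n}. {Dl j l # Cl i j # u})"
    unfolding xw rstep_redex
    by (rule order.trans[OF Poly_Mapping.keys_add Un_mono])
      (auto intro!: order.trans[OF Poly_Mapping.keys_sum] split: if_splits)
  also have "\<dots> \<subseteq> nwords n I (Suc t)"
    using w x by (auto simp: xw nwords_def redex_iff)
  finally show ?thesis .
qed (use w x in \<open>auto simp: rstep_not_redex nwords_def\<close>)

lemma keys_lin:
  assumes "Poly_Mapping.keys v \<subseteq> S" "\<And>w. w \<in> S \<Longrightarrow> Poly_Mapping.keys (f w) \<subseteq> T"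
  shows "Poly_Mapping.keys (lin f v :: vec) \<subseteq> T"
  unfolding lin_def using assms by (intro order.trans[OF Poly_Mapping.keys_sum]) blast

text \<open>
  The ring of the locale is \<open>A\<close>, filtered by the sets \<open>D t\<close>: the subring generated by the letters
  of the finite alphabet \<open>X\<close>.
\<close>

locale alphabet =
  fixes n :: nat and I :: "nat set"
  assumes n_pos: "0 < n" and fin: "finite I"
begin

abbreviation "X \<equiv> letters n I"
abbreviation "D \<equiv> deg_lt n I"
abbreviation "op \<equiv> letter_op n"

text \<open>
  The ring of all elements of finite degree; it is closed under multiplication by \<open>A_mult\<close> below.
\<close>

definition A :: "endo set" where "A = (\<Union>t. D t)"

lemma D_Suc_cases:
  assumes "r \<in> D (Suc t)"
  obtains b p where "b \<in> {0, 1}" "\<And>x. x \<in> X \<Longrightarrow> p x \<in> D t" "r = b + (\<Sum>x\<in>X. p x * op x)"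
proof -
  from assms obtain b p where "r = b + (\<Sum>x\<in>X. p x * op x)" "b \<in> {0, 1}" "\<forall>x\<in>X. p x \<in> D t"
    unfolding deg_lt.simps(2) by blast
  then show thesis using that by blast
qed

lemma D_SucI:
  assumes "b \<in> {0, 1}" "\<And>x. x \<in> X \<Longrightarrow> p x \<in> D t"
  shows "b + (\<Sum>x\<in>X. p x * op x) \<in> D (Suc t)"
  using assms unfolding deg_lt.simps(2) by blast

lemma D_zero [simp]: "0 \<in> D t"
proof (induction t)
  case (Suc t) then show ?case using D_SucI[of 0 "\<lambda>_. 0" t] by simp
qed simp

lemma D_mono1: "D t \<subseteq> D (Suc t)"
proof (induction t)
  case (Suc t)
  show ?case
  proof
    fix r assume "r \<in> D (Suc t)"
    then obtain b p where "b \<in> {0, 1}" "\<And>x. x \<in> X \<Longrightarrow> p x \<in> D t" "r = b + (\<Sum>x\<in>X. p x * op x)"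
      by (rule D_Suc_cases) blast
    then show "r \<in> D (Suc (Suc t))" using D_SucI[of b p "Suc t"] Suc by blast
  qed
qed simp

lemma D_mono: "s \<le> t \<Longrightarrow> D s \<subseteq> D t"
  by (induction rule: dec_induct) (use D_mono1 in auto)

lemma D_monoD: "r \<in> D s \<Longrightarrow> s \<le> t \<Longrightarrow> r \<in> D t"
  using D_mono by blast

lemma D_1: "D (Suc 0) = {0, 1}"
proof
  show "D (Suc 0) \<subseteq> {0, 1}" by (auto elim!: D_Suc_cases)
  show "{0, 1} \<subseteq> D (Suc 0)" using D_SucI[of _ "\<lambda>_. 0" 0] by simp
qed

lemma D_add: "r \<in> D t \<Longrightarrow> s \<in> D t \<Longrightarrow> r + s \<in> D t"
proof (induction t arbitrary: r s)
  case (Suc t)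
  obtain b p where r: "b \<in> {0, 1}" "\<And>x. x \<in> X \<Longrightarrow> p x \<in> D t" "r = b + (\<Sum>x\<in>X. p x * op x)"
    using Suc.prems(1) by (rule D_Suc_cases) blast
  obtain c q where s: "c \<in> {0, 1}" "\<And>x. x \<in> X \<Longrightarrow> q x \<in> D t" "s = c + (\<Sum>x\<in>X. q x * op x)"
    using Suc.prems(2) by (rule D_Suc_cases) blast
  have eq: "r + s = (b + c) + (\<Sum>x\<in>X. (p x + q x) * op x)"
    by (simp add: r s algebra_simps sum.distrib)
  have "b + c \<in> {0, 1}" using r s by auto
  then show ?case unfolding eq by (rule D_SucI) (use Suc.IH r s in blast)
qed simp

lemma D_sum: "(\<And>x. x \<in> S \<Longrightarrow> f x \<in> D t) \<Longrightarrow> sum f S \<in> D t"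
  by (induction S rule: infinite_finite_induct) (auto simp: D_add)

lemma D_op: "r \<in> D t \<Longrightarrow> x \<in> X \<Longrightarrow> r * op x \<in> D (Suc t)"
proof -
  assume r: "r \<in> D t" and x: "x \<in> X"
  have "r * op x = 0 + (\<Sum>y\<in>X. (if y = x then r else 0) * op y)"
    using x finite_letters[OF fin] by (simp add: if_distrib[of "\<lambda>u. u * _"] cong: if_cong)
  then show ?thesis using D_SucI[of 0 "\<lambda>y. if y = x then r else 0" t] r by simp
qed

lemma D_mult: "r \<in> D (Suc s) \<Longrightarrow> q \<in> D t \<Longrightarrow> r * q \<in> D (s + t)"
proof (induction t arbitrary: q)
  case 0 then show ?case by simp
next
  case (Suc t)
  obtain b p where q: "b \<in> {0, 1}" "\<And>x. x \<in> X \<Longrightarrow> p x \<in> D t" "q = b + (\<Sum>x\<in>X. p x * op x)"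
    using Suc.prems(2) by (rule D_Suc_cases) blast
  have "r * b \<in> D (Suc (s + t))"
    using q(1) D_monoD[OF Suc.prems(1), of "Suc (s + t)"] by (auto)
  moreover have "(\<Sum>x\<in>X. r * p x * op x) \<in> D (Suc (s + t))"
    using Suc q by (intro D_sum D_op) auto
  ultimately have "r * b + (\<Sum>x\<in>X. r * p x * op x) \<in> D (Suc (s + t))" by (rule D_add)
  then show ?case by (simp add: q algebra_simps sum_distrib_left)
qed

lemma D_finite: "finite (D t)"
proof (induction t)
  case (Suc t)
  have "D (Suc t) \<subseteq> (\<lambda>(b, p). b + (\<Sum>x\<in>X. p x * op x)) ` ({0, 1} \<times> (X \<rightarrow>\<^sub>E D t))"
  proof
    fix r assume "r \<in> D (Suc t)"
    then obtain b p where r: "b \<in> {0, 1}" "\<And>x. x \<in> X \<Longrightarrow> p x \<in> D t" "r = b + (\<Sum>x\<in>X. p x * op x)"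
      by (rule D_Suc_cases) blast
    then have "r = (\<lambda>(b, p). b + (\<Sum>x\<in>X. p x * op x)) (b, restrict p X)" by simp
    moreover have "(b, restrict p X) \<in> {0, 1} \<times> (X \<rightarrow>\<^sub>E D t)" using r by auto
    ultimately show "r \<in> (\<lambda>(b, p). b + (\<Sum>x\<in>X. p x * op x)) ` ({0, 1} \<times> (X \<rightarrow>\<^sub>E D t))"
      by blast
  qed
  then show ?case
    by (rule finite_subset) (use Suc finite_letters[OF fin] in \<open>auto intro!: finite_PiE\<close>)
qed simp

lemma vec_op_at_empty: "r \<in> D t \<Longrightarrow> vec_op n (at_empty r) = r"
proof (induction t arbitrary: r)
  case (Suc t)
  obtain b p where r: "b \<in> {0, 1}" "\<And>x. x \<in> X \<Longrightarrow> p x \<in> D t" "r = b + (\<Sum>x\<in>X. p x * op x)"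
    using Suc.prems by (rule D_Suc_cases) blast
  have "vec_op n (at_empty b) = b" using r(1) by auto
  then show ?case
    using Suc.IH r by (simp add: at_empty_add vec_op_add at_empty_sum vec_op_sum at_empty_times vec_op_letter_op n_pos)
qed simp

lemma keys_at_empty: "r \<in> D t \<Longrightarrow> Poly_Mapping.keys (at_empty r) \<subseteq> nwords n I t"
proof (induction t arbitrary: r)
  case (Suc t)
  obtain b p where r: "b \<in> {0, 1}" "\<And>x. x \<in> X \<Longrightarrow> p x \<in> D t" "r = b + (\<Sum>x\<in>X. p x * op x)"
    using Suc.prems by (rule D_Suc_cases) blast
  have "Poly_Mapping.keys (at_empty b) \<subseteq> nwords n I (Suc t)" using r(1) by (auto simp: nwords_def)
  moreover have "Poly_Mapping.keys (at_empty (p x * op x)) \<subseteq> nwords n I (Suc t)" if "x \<in> X" for x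
    unfolding at_empty_times app_letter_op using Suc.IH[OF r(2)[OF that]] rstep_nwords[OF _ that]
    by (rule keys_lin)
  ultimately show ?case
    unfolding r(3) at_empty_add at_empty_sum
    by (intro order.trans[OF Poly_Mapping.keys_add] Un_least order.trans[OF Poly_Mapping.keys_sum]) auto
qed simp

lemma D_vec_op: 
  assumes "Poly_Mapping.keys v \<subseteq> nwords n I t"
  shows "vec_op n v \<in> D t"
proof -
  have "set w \<subseteq> X \<Longrightarrow> length w < t \<Longrightarrow> word_op n w \<in> D t" for w
  proof (induction w arbitrary: t)
    case Nil
    then show ?case using D_monoD[of 1 "Suc 0" t] D_1 by (auto)
  next
    case (Cons x w)
    then obtain s where "t = Suc s" by (cases t) auto
    then show ?case using Cons by (auto intro: D_op)
  qed
  then show ?thesis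
    unfolding vec_op_def lin_def using assms by (intro D_sum) (auto simp: nwords_def)
qed

text \<open>
  Within \<open>A\<close> the degree can be read off the normal form.
\<close>

lemma D_iff: "r \<in> D s \<Longrightarrow> r \<in> D t \<longleftrightarrow> Poly_Mapping.keys (at_empty r) \<subseteq> nwords n I t"
  using keys_at_empty D_vec_op vec_op_at_empty by metis

text \<open>
  If all \<open>p\<^sub>x\<close> have degree at most \<open>t\<close> and \<open>\<Sum>\<^sub>x p\<^sub>x x\<close> does too, instead of \<open>t + 1\<close>, then up to terms of
  degree less than \<open>t\<close> the row \<open>p\<close> is a left combination of the relations
  \<open>\<Sum>\<^sub>j c\<^sub>i\<^sub>j d\<^sub>j\<^sub>l = \<delta>\<^sub>i\<^sub>l\<close>, whose coefficients \<open>q\<^sub>i\<^sub>l\<close> have degree less than \<open>t\<close>.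
\<close>

lemma syzygy:
  assumes p: "\<And>x. x \<in> X \<Longrightarrow> p x \<in> D (Suc t)"
    and sum: "(\<Sum>x\<in>X. p x * op x) \<in> D (Suc t)"
  shows "\<exists>q. (\<forall>i\<in>I. \<forall>l\<in>I. q i l \<in> D t) \<and> (\<forall>i\<in>I. \<forall>j<n. p (Cl i j) \<in> D t) \<and>
    (\<forall>l\<in>I. \<forall>j<n. p (Dl j l) + (\<Sum>i\<in>I. q i l * op (Cl i j)) \<in> D t)"
proof -
  \<comment> \<open>Subtracting these multiples of the relations makes the normal form of \<open>p (Dl 0 l)\<close>
    free of words that end in a letter \<open>Cl i 0\<close>; no rewriting is then needed in \<open>\<Sum>\<^sub>x P\<^sub>x x\<close>.\<close>
  define q where "q = (\<lambda>i l. vec_op n (cof (Cl i 0) (at_empty (p (Dl 0 l)))))"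
  define P where "P = (\<lambda>x. case x of Cl i j \<Rightarrow> p x
    | Dl j l \<Rightarrow> p x + (\<Sum>i\<in>I. q i l * op (Cl i j)))"
  have cof: "Poly_Mapping.keys (cof (Cl i 0) (at_empty (p (Dl 0 l)))) \<subseteq> nwords n I t" if "l \<in> I" for i l
  proof
    fix w assume "w \<in> Poly_Mapping.keys (cof (Cl i 0) (at_empty (p (Dl 0 l))))"
    then have "Cl i 0 # w \<in> Poly_Mapping.keys (at_empty (p (Dl 0 l)))" by (simp add: in_keys_iff)
    moreover have "Poly_Mapping.keys (at_empty (p (Dl 0 l))) \<subseteq> nwords n I (Suc t)"
      using that n_pos by (intro keys_at_empty p) simp
    ultimately have "Cl i 0 # w \<in> nwords n I (Suc t)" by blast
    then show "w \<in> nwords n I t" by (simp add: nwords_def)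
  qed
  have q: "q i l \<in> D t" if "l \<in> I" for i l
    unfolding q_def using cof[OF that] by (rule D_vec_op)
  have valq: "at_empty (q i l) = cof (Cl i 0) (at_empty (p (Dl 0 l)))" if "l \<in> I" for i l
    unfolding q_def using cof[OF that, of i] by (intro at_empty_vec_op) (auto simp: nwords_def)
  have P: "P x \<in> D (Suc t)" if "x \<in> X" for x
    using p that q
    by (auto simp: P_def intro!: D_add D_sum D_op split: letter.split)
  have "(\<Sum>x\<in>X. P x * op x) = (\<Sum>x\<in>X. p x * op x)
      + (\<Sum>l\<in>I. \<Sum>j<n. \<Sum>i\<in>I. q i l * (op (Cl i j) * op (Dl j l)))"
    by (simp add: sum_letters[OF fin] P_def algebra_simps sum.distrib sum_distrib_left sum_distrib_right)
  also have "(\<Sum>l\<in>I. \<Sum>j<n. \<Sum>i\<in>I. q i l * (op (Cl i j) * op (Dl j l)))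
      = (\<Sum>l\<in>I. \<Sum>i\<in>I. q i l * (\<Sum>j<n. op (Cl i j) * op (Dl j l)))"
    unfolding sum_distrib_left by (rule sum.cong[OF refl], rule sum.swap)
  also have "\<dots> = (\<Sum>l\<in>I. q l l)"
    using fin by (simp add: letter_op_relation n_pos if_distrib cong: if_cong)
  finally have "(\<Sum>x\<in>X. P x * op x) = (\<Sum>x\<in>X. p x * op x) + (\<Sum>l\<in>I. q l l)" .
  moreover have "(\<Sum>l\<in>I. q l l) \<in> D (Suc t)"
    using q D_monoD[of _ t "Suc t"] by (intro D_sum) auto
  ultimately have Psum: "(\<Sum>x\<in>X. P x * op x) \<in> D (Suc t)" using sum D_add by metis
  have nored: "\<not> redex x w" if x: "x \<in> X" and w: "w \<in> Poly_Mapping.keys (at_empty (P x))" for x w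
  proof
    assume "redex x w"
    then obtain l i u where xw: "x = Dl 0 l" "w = Cl i 0 # u" by (auto simp: redex_iff)
    have l: "l \<in> I" using x xw by simp
    have "w \<in> nwords n I (Suc t)" using keys_at_empty[OF P[OF x]] w by blast
    then have i: "i \<in> I" by (simp add: nwords_def xw)
    have "Poly_Mapping.lookup (at_empty (P x)) w = Poly_Mapping.lookup (at_empty (p (Dl 0 l))) w
       + (\<Sum>k\<in>I. Poly_Mapping.lookup (lin (rstep n (Cl k 0)) (at_empty (q k l))) (Cl i 0 # u))"
      by (simp add: xw P_def at_empty_add at_empty_sum at_empty_times app_letter_op lookup_add lookup_sum)
    also have "(\<Sum>k\<in>I. Poly_Mapping.lookup (lin (rstep n (Cl k 0)) (at_empty (q k l))) (Cl i 0 # u))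
        = (\<Sum>k\<in>I. if k = i then Poly_Mapping.lookup (at_empty (p (Dl 0 l))) w else 0)"
      by (intro sum.cong refl) (auto simp: lookup_prepend redex_iff valq l xw)
    also have "\<dots> = Poly_Mapping.lookup (at_empty (p (Dl 0 l))) w" using i fin by simp
    finally have "Poly_Mapping.lookup (at_empty (P x)) w = 0" by simp
    then show False using w by (simp add: in_keys_iff)
  qed
  have main: "P x \<in> D t" if x: "x \<in> X" for x
  proof -
    have "w \<in> nwords n I t" if w: "w \<in> Poly_Mapping.keys (at_empty (P x))" for w
    proof -
      have w': "w \<in> nwords n I (Suc t)" using keys_at_empty[OF P[OF x]] w by blast
      have "Poly_Mapping.lookup (at_empty (\<Sum>y\<in>X. P y * op y)) (x # w)
          = (\<Sum>y\<in>X. if x = y then Poly_Mapping.lookup (at_empty (P y)) w else 0)"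
        unfolding at_empty_sum lookup_sum at_empty_times app_letter_op
        by (intro sum.cong refl lookup_prepend) (use nored in auto)
      also have "\<dots> = Poly_Mapping.lookup (at_empty (P x)) w"
        using x finite_letters[OF fin] by simp
      finally have "x # w \<in> Poly_Mapping.keys (at_empty (\<Sum>y\<in>X. P y * op y))"
        using w by (simp add: in_keys_iff)
      then have "x # w \<in> nwords n I (Suc t)" using keys_at_empty[OF Psum] by blast
      then show ?thesis using w' by (simp add: nwords_def)
    qed
    then show ?thesis using D_iff[OF P[OF x]] by blast
  qed
  show ?thesis
  proof (intro exI[of _ q] conjI ballI allI impI)
    fix i j assume "i \<in> I" "j < n"
    then show "p (Cl i j) \<in> D t" using main[of "Cl i j"] by (simp add: P_def)
  next
    fix l j assume "l \<in> I" "j < n"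
    then show "p (Dl j l) + (\<Sum>i\<in>I. q i l * op (Cl i j)) \<in> D t"
      using main[of "Dl j l"] by (simp add: P_def)
  qed (use q in auto)
qed


end

section \<open>The weak algorithm\<close>

context alphabet
begin

lemma D_A: "r \<in> D t \<Longrightarrow> r \<in> A"
  by (auto simp: A_def)

lemma A_zero [simp]: "0 \<in> A" and A_one [simp]: "1 \<in> A"
  using D_A[OF D_zero] D_A[of 1 "Suc 0"] D_1 by auto

lemma A_add: "r \<in> A \<Longrightarrow> s \<in> A \<Longrightarrow> r + s \<in> A"
proof -
  assume "r \<in> A" "s \<in> A"
  then obtain t u where "r \<in> D t" "s \<in> D u" by (auto simp: A_def)
  then have "r + s \<in> D (max t u)" by (intro D_add) (auto elim: D_monoD)
  then show ?thesis by (rule D_A)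
qed

lemma A_mult: "r \<in> A \<Longrightarrow> s \<in> A \<Longrightarrow> r * s \<in> A"
proof -
  assume "r \<in> A" "s \<in> A"
  then obtain t u where "r \<in> D t" "s \<in> D u" by (auto simp: A_def)
  then have "r * s \<in> D (t + u)" by (intro D_mult) (auto elim: D_monoD)
  then show ?thesis by (rule D_A)
qed

lemma A_op: "x \<in> X \<Longrightarrow> op x \<in> A"
proof -
  assume "x \<in> X"
  then have "1 * op x \<in> D (Suc (Suc 0))" by (intro D_op) (auto simp: D_1)
  then show ?thesis by (auto intro: D_A)
qed

lemma A_countable: "countable A"
  unfolding A_def using D_finite by (intro countable_UN) (auto intro: countable_finite)

text \<open>
  A matrix over the field of two elements with fewer rows than columns has a nonempty set of
  columns with sum 0, by the pigeonhole principle for the subsets of columns.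
\<close>

lemma dependent_columns:
  assumes J: "finite J" "card J < n"
    and B: "\<And>i j. i \<in> J \<Longrightarrow> j < n \<Longrightarrow> B i j \<in> {0, 1 :: endo}"
  shows "\<exists>S. S \<subseteq> {..<n} \<and> S \<noteq> {} \<and> (\<forall>i\<in>J. (\<Sum>j\<in>S. B i j) = 0)"
proof -
  let ?f = "\<lambda>S. \<lambda>i\<in>J. \<Sum>j\<in>S. B i j"
  have sum01: "(\<Sum>j\<in>S. B i j) \<in> {0, 1}" if "i \<in> J" "S \<subseteq> {..<n}" for i S
  proof -
    have "finite S" using that(2) finite_subset by blast
    then show ?thesis using that
    proof (induction S rule: finite_induct)
      case (insert j S)
      then have "B i j \<in> {0, 1}" "(\<Sum>j\<in>S. B i j) \<in> {0, 1}" using B by auto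
      then show ?case using insert.hyps by auto
    qed simp
  qed
  have "?f ` Pow {..<n} \<subseteq> (J \<rightarrow>\<^sub>E {0, 1})" using sum01 by (intro image_subsetI PiE_I) auto
  then have "card (?f ` Pow {..<n}) \<le> card (J \<rightarrow>\<^sub>E {0, 1 :: endo})"
    using J by (intro card_mono finite_PiE) auto
  also have "\<dots> = 2 ^ card J" using J by (simp add: card_PiE numeral_2_eq_2)
  also have "\<dots> < card (Pow {..<n})" using J by (simp add: card_Pow)
  finally have "\<not> inj_on ?f (Pow {..<n})" using card_image nat_neq_iff by metis
  then obtain S T where ST: "S \<subseteq> {..<n}" "T \<subseteq> {..<n}" "?f S = ?f T" "S \<noteq> T"
    by (auto simp: inj_on_def)
  show ?thesis
  proof (intro exI[of _ "(S - T) \<union> (T - S)"] conjI ballI)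
    fix i assume i: "i \<in> J"
    have finS: "finite S" "finite T" using ST finite_subset by blast+
    have "(\<Sum>j\<in>S. B i j) = (\<Sum>j\<in>T. B i j)"
      using fun_cong[OF ST(3), of i] i by simp
    moreover have "(\<Sum>j\<in>S. B i j) = (\<Sum>j\<in>S \<inter> T. B i j) + (\<Sum>j\<in>S - T. B i j)"
      using sum.Int_Diff[OF finS(1)] .
    moreover have "(\<Sum>j\<in>T. B i j) = (\<Sum>j\<in>S \<inter> T. B i j) + (\<Sum>j\<in>T - S. B i j)"
      using sum.Int_Diff[OF finS(2), of _ S] by (simp add: Int_commute)
    ultimately have "(\<Sum>j\<in>S - T. B i j) = (\<Sum>j\<in>T - S. B i j)" by simp
    moreover have "(\<Sum>j\<in>(S - T) \<union> (T - S). B i j) = (\<Sum>j\<in>S - T. B i j) + (\<Sum>j\<in>T - S. B i j)"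
      using finS by (intro sum.union_disjoint) auto
    ultimately show "(\<Sum>j\<in>(S - T) \<union> (T - S). B i j) = 0" by simp
  qed (use ST in auto)
qed

text \<open>
  Versions of \<open>D_op\<close> and \<open>D_mult\<close> for degree bounds with truncated subtraction: if \<open>s < k\<close> then
  \<open>D (s - k)\<close> contains only 0.
\<close>

lemma D_op': "r \<in> D (s - k) \<Longrightarrow> x \<in> X \<Longrightarrow> r * op x \<in> D (Suc s - k)"
proof -
  assume r: "r \<in> D (s - k)" and x: "x \<in> X"
  show ?thesis
  proof (cases "k \<le> s")
    case True
    then show ?thesis using D_op[OF r x] by (simp add: Suc_diff_le)
  next
    case False
    then show ?thesis using r by simp
  qed
qed

lemma D_mult': "r \<in> D (Suc k) \<Longrightarrow> q \<in> D (s - k) \<Longrightarrow> r * q \<in> D s"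
proof -
  assume r: "r \<in> D (Suc k)" and q: "q \<in> D (s - k)"
  show ?thesis
  proof (cases "k \<le> s")
    case True
    then show ?thesis using D_mult[OF r q] by simp
  next
    case False
    then show ?thesis using q by simp
  qed
qed

lemma D_decompose:
  assumes r: "r \<in> D (Suc s - k)"
  obtains b p where "b \<in> {0, 1}" "s < k \<longrightarrow> b = 0" "\<forall>x\<in>X. p x \<in> D (s - k)"
    "r = b + (\<Sum>x\<in>X. p x * op x)"
proof (cases "k \<le> s")
  case True
  then have "r \<in> D (Suc (s - k))" using r by (simp add: Suc_diff_le)
  then obtain b p where "b \<in> {0, 1}" "\<And>x. x \<in> X \<Longrightarrow> p x \<in> D (s - k)" "r = b + (\<Sum>x\<in>X. p x * op x)"
    by (rule D_Suc_cases) blast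
  then show thesis using that[of b p] True by simp
next
  case False
  then show thesis using that[of 0 "\<lambda>_. 0"] r by simp
qed

lemma D_decompose_family:
  assumes u: "\<And>i. i \<in> J \<Longrightarrow> u i \<in> D (Suc s - \<alpha> i)"
    and zero: "\<And>i. i \<in> J \<Longrightarrow> s \<le> \<alpha> i \<Longrightarrow> u i = 0"
  obtains \<beta> c where "\<And>i. i \<in> J \<Longrightarrow> \<beta> i \<in> {0, 1}" "\<And>i. i \<in> J \<Longrightarrow> s \<le> \<alpha> i \<Longrightarrow> \<beta> i = 0"
    "\<And>i x. i \<in> J \<Longrightarrow> x \<in> X \<Longrightarrow> c i x \<in> D (s - \<alpha> i)"
    "\<And>i. i \<in> J \<Longrightarrow> u i = \<beta> i + (\<Sum>x\<in>X. c i x * op x)"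
proof -
  let ?Q = "\<lambda>i z. fst z \<in> {0, 1} \<and> (s \<le> \<alpha> i \<longrightarrow> fst z = 0) \<and> (\<forall>x\<in>X. snd z x \<in> D (s - \<alpha> i)) \<and>
    u i = fst z + (\<Sum>x\<in>X. snd z x * op x)"
  have "\<exists>z. ?Q i z" if i: "i \<in> J" for i
  proof (cases "s \<le> \<alpha> i")
    case True
    then show ?thesis using zero[OF i] by (intro exI[of _ "(0, \<lambda>_. 0)"]) simp
  next
    case False
    from u[OF i] obtain b p where "b \<in> {0, 1}" "\<forall>x\<in>X. p x \<in> D (s - \<alpha> i)"
      "u i = b + (\<Sum>x\<in>X. p x * op x)"
      by (rule D_decompose)
    then show ?thesis using False by (intro exI[of _ "(b, p)"]) simp
  qed
  then have "\<forall>i\<in>J. \<exists>z. ?Q i z" by blast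
  from bchoice[OF this] obtain f where "\<forall>i\<in>J. ?Q i (f i)" ..
  then show thesis by (intro that[of "\<lambda>i. fst (f i)" "\<lambda>i. snd (f i)"]) simp_all
qed

text \<open>
  Here \<open>\<alpha> i\<close> bounds the degree of \<open>a i\<close>, and \<open>t\<close> bounds the degree of each product \<open>a i * b i\<close>. If the
  terms of degree \<open>t\<close> cancel in the sum and not all \<open>b i\<close> have lower degree than allowed, then some
  \<open>a i\<close> drops in degree modulo a right combination of the others.

  The proof is by induction on \<open>t\<close>, passing from \<open>b i\<close> to its right cofactors. The cofactors of the
  letters \<open>c\<close> satisfy the hypothesis for \<open>t - 1\<close> directly. Those of the letters \<open>d\<^sub>j\<^sub>l\<close> do so only up
  to the left combinations of the rows of \<open>c\<close> from the \<open>syzygy\<close> lemma. There are \<open>n\<close> values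
  of \<open>j\<close> and fewer than \<open>n\<close> values of \<open>i\<close>, so the sum over a nonempty set of these columns
  vanishes in the rows of scalars; its cofactors show that the coefficients of the combination lie, to leading order, in the
  right ideal generated by the \<open>a i\<close>, and the combination can be absorbed into the cofactors.
\<close>

lemma weak_algorithm:
  assumes J: "finite J" "card J < n"
    and a: "\<And>i. i \<in> J \<Longrightarrow> a i \<in> D (Suc (\<alpha> i))"
    and b: "\<And>i. i \<in> J \<Longrightarrow> b i \<in> D (Suc t - \<alpha> i)"
    and ab: "(\<Sum>i\<in>J. a i * b i) \<in> D t"
    and nontriv: "\<exists>i\<in>J. b i \<notin> D (t - \<alpha> i)"
  shows "\<exists>i\<in>J. \<exists>h. (\<forall>j\<in>J. h j \<in> A) \<and> a i + (\<Sum>j\<in>J - {i}. a j * h j) \<in> D (\<alpha> i)"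
proof (rule ccontr)
  assume nc: "\<not> ?thesis"
  \<comment> \<open>If \<open>\<alpha> i = t\<close> and \<open>b i \<noteq> 0\<close>, then \<open>b i = 1\<close> expresses \<open>a i\<close> by the others up to lower degree.\<close>
  have scalar: "b i = 0" if b: "\<And>i. i \<in> J \<Longrightarrow> b i \<in> D (Suc t - \<alpha> i)"
    and ab: "(\<Sum>i\<in>J. a i * b i) \<in> D t" and i: "i \<in> J" "t \<le> \<alpha> i" for t b i
  proof (rule ccontr)
    assume b0: "b i \<noteq> 0"
    then have "\<alpha> i = t" using b[OF i(1)] i(2) by (cases "\<alpha> i = t") auto
    then have "b i = 1" using b[OF i(1)] b0 D_1 by auto
    have "(\<Sum>i\<in>J. a i * b i) = a i * b i + (\<Sum>j\<in>J - {i}. a j * b j)"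
      using J i by (simp add: sum.remove)
    then have "a i + (\<Sum>j\<in>J - {i}. a j * b j) \<in> D (\<alpha> i)"
      using ab \<open>\<alpha> i = t\<close> \<open>b i = 1\<close> by simp
    moreover have "\<forall>j\<in>J. b j \<in> A" using b D_A by blast
    ultimately show False using nc i by blast
  qed
  have "b i \<in> D (t - \<alpha> i)"
    if "\<And>i. i \<in> J \<Longrightarrow> b i \<in> D (Suc t - \<alpha> i)" "(\<Sum>i\<in>J. a i * b i) \<in> D t" "i \<in> J" for b i
    using that
  proof (induction t arbitrary: b i)
    case 0
    then show ?case using scalar[of b 0 i] by simp
  next
    case (Suc s)
    note b = Suc.prems(1) and ab = Suc.prems(2)
    note sc = scalar[OF b ab]
    obtain \<beta> c where \<beta>: "\<And>i. i \<in> J \<Longrightarrow> \<beta> i \<in> {0, 1}" "\<And>i. i \<in> J \<Longrightarrow> Suc s \<le> \<alpha> i \<Longrightarrow> \<beta> i = 0"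
      and c: "\<And>i x. i \<in> J \<Longrightarrow> x \<in> X \<Longrightarrow> c i x \<in> D (Suc s - \<alpha> i)"
      and bc: "\<And>i. i \<in> J \<Longrightarrow> b i = \<beta> i + (\<Sum>x\<in>X. c i x * op x)"
      using D_decompose_family[of J b "Suc s" \<alpha>] b sc by blast
    define p where "p = (\<lambda>x. \<Sum>i\<in>J. a i * c i x)"
    have p: "p x \<in> D (Suc s)" if "x \<in> X" for x
      unfolding p_def using a c that by (intro D_sum D_mult') auto
    have a\<beta>: "(\<Sum>i\<in>J. a i * \<beta> i) \<in> D (Suc s)"
    proof (rule D_sum)
      fix i assume i: "i \<in> J"
      show "a i * \<beta> i \<in> D (Suc s)"
        using \<beta>(1)[OF i] \<beta>(2)[OF i] D_monoD[OF a[OF i], of "Suc s"] by (cases "Suc s \<le> \<alpha> i") auto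
    qed
    have "(\<Sum>i\<in>J. a i * b i) = (\<Sum>i\<in>J. a i * \<beta> i) + (\<Sum>i\<in>J. \<Sum>x\<in>X. a i * c i x * op x)"
      by (simp add: bc distrib_left sum.distrib sum_distrib_left mult.assoc)
    also have "(\<Sum>i\<in>J. \<Sum>x\<in>X. a i * c i x * op x) = (\<Sum>x\<in>X. p x * op x)"
      unfolding p_def sum_distrib_right by (rule sum.swap)
    finally have "(\<Sum>x\<in>X. p x * op x) = (\<Sum>i\<in>J. a i * b i) + (\<Sum>i\<in>J. a i * \<beta> i)"
      by (simp add: add.assoc add.left_commute)
    then have psum: "(\<Sum>x\<in>X. p x * op x) \<in> D (Suc s)" using D_add[OF ab a\<beta>] by simp
    obtain q where q: "\<And>i l. i \<in> I \<Longrightarrow> l \<in> I \<Longrightarrow> q i l \<in> D s"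
      and pC: "\<And>i j. i \<in> I \<Longrightarrow> j < n \<Longrightarrow> p (Cl i j) \<in> D s"
      and pD: "\<And>l j. l \<in> I \<Longrightarrow> j < n \<Longrightarrow> p (Dl j l) + (\<Sum>i\<in>I. q i l * op (Cl i j)) \<in> D s"
      using syzygy[of p s, OF p psum] by blast
    have cC: "c i (Cl k j) \<in> D (s - \<alpha> i)" if "i \<in> J" "k \<in> I" "j < n" for i k j
      using Suc.IH[of "\<lambda>i. c i (Cl k j)" i] c pC[of k j] that by (simp add: p_def)
    have cD: "(\<Sum>j<n. c i (Dl j l) * op (Dl j l)) \<in> D (Suc s - \<alpha> i)" if i: "i \<in> J" and l: "l \<in> I" for i l
    proof -
      \<comment> \<open>The rows \<open>i\<close> with \<open>s \<le> \<alpha> i\<close> of the cofactor matrix \<open>B\<close> are scalar.\<close>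
      define B where "B = (\<lambda>i j. c i (Dl j l))"
      have B: "B i j \<in> D (Suc s - \<alpha> i)" if "i \<in> J" "j < n" for i j
        using c that l by (simp add: B_def)
      have B01: "B i j \<in> {0, 1}" if "i \<in> {i \<in> J. s \<le> \<alpha> i}" "j < n" for i j
      proof -
        have "B i j \<in> D (Suc s - \<alpha> i)" "Suc s - \<alpha> i \<le> Suc 0" using B that by auto
        then show ?thesis using D_monoD D_1 by blast
      qed
      have cardJ: "card {i \<in> J. s \<le> \<alpha> i} < n"
        using J card_mono[of J "{i \<in> J. s \<le> \<alpha> i}"] by force
      have "finite {i \<in> J. s \<le> \<alpha> i}" using J by simp
      from dependent_columns[OF this cardJ B01] obtain S where
        "S \<subseteq> {..<n} \<and> S \<noteq> {} \<and> (\<forall>i\<in>{i \<in> J. s \<le> \<alpha> i}. (\<Sum>j\<in>S. B i j) = 0)" ..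
      then have S: "S \<subseteq> {..<n}" "S \<noteq> {}"
          "\<And>i. i \<in> J \<Longrightarrow> s \<le> \<alpha> i \<Longrightarrow> (\<Sum>j\<in>S. B i j) = 0"
        by simp_all
      obtain j0 where j0: "j0 \<in> S" using S by blast
      have "\<exists>g. (\<forall>i\<in>J. \<forall>k\<in>I. g i k \<in> D (s - \<alpha> i)) \<and> (\<forall>k\<in>I. (\<Sum>i\<in>J. a i * g i k) + q k l \<in> D (s - 1))"
      proof (cases s)
        case 0
        then show ?thesis using q l by (intro exI[of _ "\<lambda>_ _. 0"]) auto
      next
        case (Suc r)
        have uS: "(\<Sum>j\<in>S. B i j) \<in> D (Suc s - \<alpha> i)" if "i \<in> J" for i
          using B S that by (intro D_sum) auto
        obtain \<gamma> g where \<gamma>: "\<And>i. i \<in> J \<Longrightarrow> \<gamma> i \<in> {0, 1}" "\<And>i. i \<in> J \<Longrightarrow> s \<le> \<alpha> i \<Longrightarrow> \<gamma> i = 0"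
          and g: "\<And>i x. i \<in> J \<Longrightarrow> x \<in> X \<Longrightarrow> g i x \<in> D (s - \<alpha> i)"
          and Bg: "\<And>i. i \<in> J \<Longrightarrow> (\<Sum>j\<in>S. B i j) = \<gamma> i + (\<Sum>x\<in>X. g i x * op x)"
          using D_decompose_family[of J "\<lambda>i. \<Sum>j\<in>S. B i j" s \<alpha>] uS S(3) by blast
        define e where "e = (\<lambda>x. case x of Cl k j \<Rightarrow> if j \<in> S then q k l else 0 | Dl j k \<Rightarrow> 0)"
        define P where "P = (\<lambda>x. (\<Sum>i\<in>J. a i * g i x) + e x)"
        have e: "e x \<in> D s" if "x \<in> X" for x
          using that q l by (auto simp: e_def split: letter.split)
        have P: "P x \<in> D (Suc r)" if "x \<in> X" for x
          unfolding P_def using a g e that Suc by (intro D_add D_sum) (auto intro: D_mult')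
        have a\<gamma>: "(\<Sum>i\<in>J. a i * \<gamma> i) \<in> D (Suc r)"
        proof (rule D_sum)
          fix i assume i: "i \<in> J"
          show "a i * \<gamma> i \<in> D (Suc r)"
            using \<gamma>(1)[OF i] \<gamma>(2)[OF i] D_monoD[OF a[OF i], of "Suc r"] Suc
            by (cases "s \<le> \<alpha> i") auto
        qed
        have "(\<Sum>j\<in>S. p (Dl j l) + (\<Sum>k\<in>I. q k l * op (Cl k j))) \<in> D (Suc r)"
          using pD[OF l] S Suc by (intro D_sum) auto
        moreover have "(\<Sum>j\<in>S. p (Dl j l) + (\<Sum>k\<in>I. q k l * op (Cl k j)))
            = (\<Sum>i\<in>J. a i * (\<Sum>j\<in>S. B i j)) + (\<Sum>j\<in>S. \<Sum>k\<in>I. q k l * op (Cl k j))"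
          unfolding sum.distrib p_def B_def sum_distrib_left by (subst sum.swap) simp
        moreover have "(\<Sum>i\<in>J. a i * (\<Sum>j\<in>S. B i j))
            = (\<Sum>i\<in>J. a i * \<gamma> i) + (\<Sum>x\<in>X. (\<Sum>i\<in>J. a i * g i x) * op x)"
          using sum.swap[of "\<lambda>i x. a i * g i x * op x" X J]
          by (simp add: Bg distrib_left sum.distrib sum_distrib_left sum_distrib_right mult.assoc)
        moreover have "(\<Sum>j\<in>S. \<Sum>k\<in>I. q k l * op (Cl k j)) = (\<Sum>x\<in>X. e x * op x)"
        proof -
          have "(\<Sum>j<n. e (Cl k j) * op (Cl k j)) = (\<Sum>j\<in>S. q k l * op (Cl k j))" for k
            using S by (intro sum.mono_neutral_cong_right) (auto simp: e_def)
          moreover have "(\<Sum>j\<in>S. \<Sum>k\<in>I. q k l * op (Cl k j)) = (\<Sum>k\<in>I. \<Sum>j\<in>S. q k l * op (Cl k j))"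
            by (rule sum.swap)
          ultimately show ?thesis by (simp add: sum_letters[OF fin]) (simp add: e_def)
        qed
        ultimately have "(\<Sum>i\<in>J. a i * \<gamma> i) + (\<Sum>x\<in>X. P x * op x) \<in> D (Suc r)"
          by (simp add: P_def distrib_right sum.distrib add.assoc)
        then have "(\<Sum>i\<in>J. a i * \<gamma> i) + ((\<Sum>i\<in>J. a i * \<gamma> i) + (\<Sum>x\<in>X. P x * op x)) \<in> D (Suc r)"
          by (rule D_add[OF a\<gamma>])
        then have "(\<Sum>x\<in>X. P x * op x) \<in> D (Suc r)" by (simp flip: add.assoc)
        then have PC: "\<And>k. k \<in> I \<Longrightarrow> P (Cl k j0) \<in> D r"
          using syzygy[of P r, OF P] j0 S by blast
        have "(\<Sum>i\<in>J. a i * g i (Cl k j0)) + q k l \<in> D (s - 1)" if "k \<in> I" for k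
          using PC[OF that] j0 Suc by (simp add: P_def e_def)
        moreover have "g i (Cl k j0) \<in> D (s - \<alpha> i)" if "i \<in> J" "k \<in> I" for i k
          using g that j0 S by auto
        ultimately show ?thesis by (intro exI[of _ "\<lambda>i k. g i (Cl k j0)"]) blast
      qed
      then obtain g where g: "\<And>i k. i \<in> J \<Longrightarrow> k \<in> I \<Longrightarrow> g i k \<in> D (s - \<alpha> i)"
        and gq: "\<And>k. k \<in> I \<Longrightarrow> (\<Sum>i\<in>J. a i * g i k) + q k l \<in> D (s - 1)"
        by blast
      \<comment> \<open>The relations are absorbed: \<open>B'\<close> and \<open>B\<close> represent the same leading part of \<open>b\<close>, since
        \<open>\<Sum>\<^sub>j c\<^sub>k\<^sub>j d\<^sub>j\<^sub>l\<close> is a scalar, and \<open>B'\<close> satisfies the induction hypothesis.\<close>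
      define B' where "B' = (\<lambda>i j. B i j + (\<Sum>k\<in>I. g i k * op (Cl k j)))"
      have B': "B' i j \<in> D (s - \<alpha> i)" if i: "i \<in> J" and j: "j < n" for i j
      proof (rule Suc.IH[of "\<lambda>i. B' i j"])
        fix i assume "i \<in> J"
        then show "B' i j \<in> D (Suc s - \<alpha> i)"
          unfolding B'_def using B g j by (intro D_add D_sum D_op') auto
      next
        have "(\<Sum>i\<in>J. a i * B' i j) = p (Dl j l) + (\<Sum>i\<in>J. \<Sum>k\<in>I. a i * g i k * op (Cl k j))"
          by (simp add: B'_def B_def p_def distrib_left sum.distrib sum_distrib_left mult.assoc)
        also have "(\<Sum>i\<in>J. \<Sum>k\<in>I. a i * g i k * op (Cl k j)) = (\<Sum>k\<in>I. (\<Sum>i\<in>J. a i * g i k) * op (Cl k j))"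
          unfolding sum_distrib_right by (rule sum.swap)
        also have "\<dots> = (\<Sum>k\<in>I. q k l * op (Cl k j)) + (\<Sum>k\<in>I. ((\<Sum>i\<in>J. a i * g i k) + q k l) * op (Cl k j))"
          unfolding sum.distrib[symmetric] distrib_right
          by (intro sum.cong refl) (simp add: add.left_commute)
        finally have eq: "(\<Sum>i\<in>J. a i * B' i j) = (p (Dl j l) + (\<Sum>k\<in>I. q k l * op (Cl k j)))
            + (\<Sum>k\<in>I. ((\<Sum>i\<in>J. a i * g i k) + q k l) * op (Cl k j))"
          by (simp add: add.assoc)
        have "((\<Sum>i\<in>J. a i * g i k) + q k l) * op (Cl k j) \<in> D s" if "k \<in> I" for k
        proof (cases s)
          case 0
          then show ?thesis using gq[OF that] by simp
        next
          case (Suc r)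
          then show ?thesis using D_op[OF gq[OF that], of "Cl k j"] that j by simp
        qed
        then show "(\<Sum>i\<in>J. a i * B' i j) \<in> D s"
          unfolding eq by (intro D_add[OF pD[OF l j]] D_sum)
      qed fact
      have "(\<Sum>j<n. c i (Dl j l) * op (Dl j l)) = (\<Sum>j<n. B' i j * op (Dl j l))
          + (\<Sum>j<n. \<Sum>k\<in>I. g i k * (op (Cl k j) * op (Dl j l)))"
        unfolding sum.distrib[symmetric]
        by (intro sum.cong refl) (simp add: B'_def B_def distrib_right sum_distrib_right mult.assoc add.assoc)
      also have "(\<Sum>j<n. \<Sum>k\<in>I. g i k * (op (Cl k j) * op (Dl j l)))
          = (\<Sum>k\<in>I. g i k * (\<Sum>j<n. op (Cl k j) * op (Dl j l)))"
        unfolding sum_distrib_left by (rule sum.swap)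
      also have "\<dots> = g i l"
        using fin l by (simp add: letter_op_relation n_pos if_distrib cong: if_cong)
      finally have eq: "(\<Sum>j<n. c i (Dl j l) * op (Dl j l)) = (\<Sum>j<n. B' i j * op (Dl j l)) + g i l" .
      have "g i l \<in> D (Suc s - \<alpha> i)"
        using g[OF i l] by (rule D_monoD) simp
      then show ?thesis
        unfolding eq using B'[OF i] l by (intro D_add D_sum D_op') auto
    qed
    have "\<beta> i \<in> D (Suc s - \<alpha> i)"
    proof (cases "Suc s \<le> \<alpha> i")
      case False
      then have "Suc 0 \<le> Suc s - \<alpha> i" by simp
      then show ?thesis using \<beta>(1)[OF Suc.prems(3)] D_monoD[of "\<beta> i" "Suc 0"] D_1 by blast
    qed (use \<beta>(2) Suc.prems(3) in simp)
    moreover have "(\<Sum>x\<in>X. c i x * op x) \<in> D (Suc s - \<alpha> i)"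
      unfolding sum_letters[OF fin]
    proof (rule D_add)
      show "(\<Sum>k\<in>I. \<Sum>j<n. c i (Cl k j) * op (Cl k j)) \<in> D (Suc s - \<alpha> i)"
        using cC Suc.prems(3) by (intro D_sum D_op') auto
      show "(\<Sum>l\<in>I. \<Sum>j<n. c i (Dl j l) * op (Dl j l)) \<in> D (Suc s - \<alpha> i)"
        by (rule D_sum) (rule cD[OF Suc.prems(3)])
    qed
    ultimately show ?case using bc[OF Suc.prems(3)] D_add by simp
  qed
  then show False using assms by blast
qed

end

section \<open>Absence of small rectangular identities\<close>

context alphabet
begin

text \<open>
  The least \<open>t\<close> with \<open>r \<in> D t\<close>: one more than the degree, and 0 for \<open>r = 0\<close>.
\<close>

definition dg :: "endo \<Rightarrow> nat" where "dg r = (LEAST t. r \<in> D t)"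

lemma D_dg: "r \<in> A \<Longrightarrow> r \<in> D (dg r)"
  unfolding dg_def A_def by (auto intro: LeastI)

lemma dg_le: "r \<in> D t \<Longrightarrow> dg r \<le> t"
  unfolding dg_def by (rule Least_le)

lemma dg_pos: "r \<in> A \<Longrightarrow> r \<noteq> 0 \<Longrightarrow> 0 < dg r"
  using D_dg[of r] by (cases "dg r") auto

lemma A_sum: "(\<And>x. x \<in> S \<Longrightarrow> f x \<in> A) \<Longrightarrow> sum f S \<in> A"
  by (induction S rule: infinite_finite_induct) (auto simp: A_add)

text \<open>
  If \<open>\<Sum>\<^sub>j a\<^sub>j u\<^sub>j = 0\<close> with fewer than \<open>n\<close> terms, and some \<open>a\<^sub>j\<close> and \<open>u\<^sub>j\<close> are both nonzero, then adding a right
  combination of the others lowers the degree of some \<open>a\<^sub>i\<close>.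
\<close>

lemma reduce_row:
  assumes J: "finite J" "card J < n"
    and a: "\<And>j. j \<in> J \<Longrightarrow> a j \<in> A" and u: "\<And>j. j \<in> J \<Longrightarrow> u j \<in> A"
    and sum: "(\<Sum>j\<in>J. a j * u j) = 0"
    and ex: "\<exists>j\<in>J. a j \<noteq> 0 \<and> u j \<noteq> 0"
  obtains i h where "i \<in> J" "h i = 0" "\<And>j. j \<in> J \<Longrightarrow> h j \<in> A"
    "dg (a i + (\<Sum>j\<in>J. a j * h j)) < dg (a i)"
proof -
  define J1 where "J1 = {j \<in> J. a j \<noteq> 0}"
  define \<alpha> where "\<alpha> = (\<lambda>j. dg (a j) - 1)"
  define J2 where "J2 = {j \<in> J1. u j \<noteq> 0}"
  \<comment> \<open>One more than the largest sum of the degrees of \<open>a j\<close> and \<open>u j\<close>, both nonzero.\<close>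
  define T where "T = Max ((\<lambda>j. \<alpha> j + dg (u j)) ` J2)"
  have J1: "finite J1" "card J1 < n"
    using J card_mono[of J J1] by (auto simp: J1_def)
  have J2: "finite J2" "J2 \<noteq> {}" using J ex by (auto simp: J2_def J1_def)
  have T: "\<alpha> j + dg (u j) \<le> T" if "j \<in> J2" for j
    unfolding T_def using J2 that by (intro Max_ge) auto
  have "T \<in> (\<lambda>j. \<alpha> j + dg (u j)) ` J2" unfolding T_def using J2 by (intro Max_in) auto
  then obtain m where m: "m \<in> J2" "T = \<alpha> m + dg (u m)" by blast
  have mpos: "0 < dg (u m)" using m u by (intro dg_pos) (auto simp: J2_def J1_def)
  define t where "t = T - 1"
  have Suct: "Suc t = T" using mpos m by (simp add: t_def)
  have al: "Suc (\<alpha> j) = dg (a j)" if "j \<in> J1" for j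
    using dg_pos[OF a, of j] that by (auto simp: \<alpha>_def J1_def)
  have sum1: "(\<Sum>j\<in>J1. a j * u j) = 0"
    using sum J by (subst sum.mono_neutral_left[of J]) (auto simp: J1_def)
  have "\<exists>i\<in>J1. \<exists>h. (\<forall>j\<in>J1. h j \<in> A) \<and> a i + (\<Sum>j\<in>J1 - {i}. a j * h j) \<in> D (\<alpha> i)"
  proof (rule weak_algorithm[OF J1, where b = u and t = t])
    fix i assume i: "i \<in> J1"
    then show "a i \<in> D (Suc (\<alpha> i))" using D_dg[OF a, of i] al by (simp add: J1_def)
    show "u i \<in> D (Suc t - \<alpha> i)"
    proof (cases "u i = 0")
      case False
      then have "dg (u i) \<le> Suc t - \<alpha> i" using T[of i] i Suct by (simp add: J2_def)
      then show ?thesis using D_monoD[OF D_dg[OF u]] i by (simp add: J1_def)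
    qed simp
  next
    have "u m \<notin> D (t - \<alpha> m)" using dg_le[of "u m" "t - \<alpha> m"] m mpos Suct by linarith
    then show "\<exists>i\<in>J1. u i \<notin> D (t - \<alpha> i)" using m by (auto simp: J2_def)
  qed (simp add: sum1)
  then obtain i h where i: "i \<in> J1" and h: "\<forall>j\<in>J1. h j \<in> A"
    and ih: "a i + (\<Sum>j\<in>J1 - {i}. a j * h j) \<in> D (\<alpha> i)" by blast
  let ?h = "\<lambda>j. if j \<in> J1 - {i} then h j else 0"
  have "(\<Sum>j\<in>J. a j * ?h j) = (\<Sum>j\<in>J1 - {i}. a j * h j)"
    using J by (intro sum.mono_neutral_cong_right) (auto simp: J1_def)
  then have "dg (a i + (\<Sum>j\<in>J. a j * ?h j)) < dg (a i)"
    using dg_le[OF ih] al[OF i] by simp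
  then show thesis using that[of i ?h] i h by (auto simp: J1_def)
qed

text \<open>
  By induction on the inner size and, within that, on the total degree of one row \<open>r\<close> of \<open>a\<close>. Each
  column of \<open>b\<close> other than \<open>r\<close> gives a relation between the entries of row \<open>r\<close> of \<open>a\<close>, so either that
  row can be reduced, or an entry of it is nonzero and the matching row of \<open>b\<close> vanishes in those columns.
\<close>

lemma no_rectangular_identity:
  fixes J :: "'j set" and K :: "'k set"
  assumes "finite J" "finite K" "card J < card K" "card J < n"
    and "\<And>i j. i \<in> K \<Longrightarrow> j \<in> J \<Longrightarrow> a i j \<in> A" "\<And>j l. j \<in> J \<Longrightarrow> l \<in> K \<Longrightarrow> b j l \<in> A"
    and "\<And>i l. i \<in> K \<Longrightarrow> l \<in> K \<Longrightarrow> (\<Sum>j\<in>J. a i j * b j l) = (if i = l then 1 else 0)"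
  shows False
  using assms
proof (induction "card J" arbitrary: J K a b rule: less_induct)
  case (less J K)
  note IH = less.hyps
  note J = less.prems(1,4) and K = less.prems(2,3)
  obtain r where r: "r \<in> K" using K by fastforce
  from less.prems(5-7) show False
  proof (induction "\<Sum>j\<in>J. dg (a r j)" arbitrary: a b rule: less_induct)
    case (less a b)
    note aA = less.prems(1) and bA = less.prems(2) and ab = less.prems(3)
    show False
    \<comment> \<open>If row \<open>j\<close> of \<open>b\<close> vanishes outside column \<open>r\<close>, then row \<open>r\<close> and column \<open>j\<close> of \<open>a\<close>
      can be deleted together with row \<open>j\<close> and column \<open>r\<close> of \<open>b\<close>.\<close>
    proof (cases "\<exists>j\<in>J. a r j \<noteq> 0 \<and> (\<forall>l\<in>K - {r}. b j l = 0)")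
      case True
      then obtain j where j: "j \<in> J" "\<And>l. l \<in> K - {r} \<Longrightarrow> b j l = 0" by blast
      show False
      proof (rule IH[of "J - {j}" "K - {r}" a b])
        have "0 < card J" using j J by (auto simp: card_gt_0_iff)
        then show "card (J - {j}) < card J" "card (J - {j}) < card (K - {r})" "card (J - {j}) < n"
          using j J K r by simp_all
        show "(\<Sum>j\<in>J - {j}. a i j * b j l) = (if i = l then 1 else 0)"
          if "i \<in> K - {r}" "l \<in> K - {r}" for i l
          using ab[of i l] that j J by (simp add: sum.remove)
      qed (use J K aA bA in auto)
    next
      case False
      have "\<exists>j\<in>J. a r j \<noteq> 0"
      proof (rule ccontr)
        assume "\<not> ?thesis"
        then have "(\<Sum>j\<in>J. a r j * b j r) = 0" by simp
        then show False using ab[OF r r] by simp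
      qed
      then obtain m l where l: "l \<in> K" "l \<noteq> r" "m \<in> J" "a r m \<noteq> 0" "b m l \<noteq> 0"
        using False by blast
      obtain i h where i: "i \<in> J" "h i = 0" and h: "\<And>j. j \<in> J \<Longrightarrow> h j \<in> A"
        and dg: "dg (a r i + (\<Sum>j\<in>J. a r j * h j)) < dg (a r i)"
        by (rule reduce_row[of J "a r" "\<lambda>j. b j l"]) (use J aA bA ab[OF r l(1)] l r in auto)
      \<comment> \<open>Column operation on \<open>a\<close> and the inverse row operation on \<open>b\<close>; signs vanish in characteristic 2.\<close>
      let ?a = "\<lambda>k j. a k j + (if j = i then \<Sum>j'\<in>J. a k j' * h j' else 0)"
      let ?b = "\<lambda>j l. b j l + h j * b i l"
      show False
      proof (rule less.hyps[of ?a ?b])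
        show "(\<Sum>j\<in>J. dg (?a r j)) < (\<Sum>j\<in>J. dg (a r j))"
          using J i dg by (intro sum_strict_mono_ex1) auto
        show "?a k j \<in> A" if "k \<in> K" "j \<in> J" for k j
          using that aA h by (auto intro!: A_add A_sum A_mult)
        show "?b j l \<in> A" if "j \<in> J" "l \<in> K" for j l
          using that bA h i by (intro A_add A_mult) auto
        show "(\<Sum>j\<in>J. ?a k j * ?b j l) = (if k = l then 1 else 0)" if "k \<in> K" "l \<in> K" for k l
        proof -
          have "(\<Sum>j\<in>J. ?a k j * ?b j l) = (\<Sum>j\<in>J. a k j * b j l) + (\<Sum>j\<in>J. a k j * h j) * b i l
              + (\<Sum>j\<in>J. if j = i then (\<Sum>j'\<in>J. a k j' * h j') * ?b i l else 0)"
            unfolding sum_distrib_right[of _ J "b i l"] sum.distrib[symmetric]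
            by (intro sum.cong refl) (simp add: algebra_simps)
          also have "\<dots> = (\<Sum>j\<in>J. a k j * b j l)"
            using i J by (simp add: add.assoc)
          finally show ?thesis using ab[OF that] by simp
        qed
      qed
    qed
  qed
qed


lemma countable_subring_A: "countable_subring A"
proof
  show "- r \<in> A" if "r \<in> A" for r
    using that by (simp add: minus_unique[of r r])
qed (simp_all add: A_countable A_add A_mult)

lemma no_rect_identity:
  assumes "k < n"
  shows "\<not> rect_identity A k (k + 1)"
proof
  assume "rect_identity A k (k + 1)"
  then obtain a b where "\<And>i j. i < k + 1 \<Longrightarrow> j < k \<Longrightarrow> a i j \<in> A"
    "\<And>j l. j < k \<Longrightarrow> l < k + 1 \<Longrightarrow> b j l \<in> A"
    "\<And>i l. i < k + 1 \<Longrightarrow> l < k + 1 \<Longrightarrow> (\<Sum>j<k. a i j * b j l) = (if i = l then 1 else 0)"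
    by (rule rect_identityE) (rule that)
  then show False
    using no_rectangular_identity[of "{..<k}" "{..<k + 1}" a b] assms by simp
qed

lemma rect_identity_A:
  assumes "n \<le> p" "{..<q} \<subseteq> I"
  shows "rect_identity A p q"
proof (rule rect_identityI)
  show "(\<Sum>j<p. (if j < n then op (Cl i j) else 0) * (if j < n then op (Dl j l) else 0))
      = (if i = l then 1 else 0)" if "i < q" "l < q" for i l
  proof -
    have "(\<Sum>j<p. (if j < n then op (Cl i j) else 0) * (if j < n then op (Dl j l) else 0))
        = (\<Sum>j<n. op (Cl i j) * op (Dl j l))"
      using assms(1) by (intro sum.mono_neutral_cong_right) auto
    then show ?thesis by (simp add: letter_op_relation n_pos)
  qed
qed (use assms in \<open>auto intro!: A_op\<close>)

end

section \<open>A ring with a trivial and a coinduced factor\<close>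

lemma sum_fun_apply: "(\<Sum>i\<in>F. f i) x = (\<Sum>i\<in>F. f i x)"
  for f :: "'i \<Rightarrow> 'x \<Rightarrow> 'r::comm_monoid_add"
  by (induction F rule: infinite_finite_induct) simp_all

text \<open>
  The ring \<open>T \<times> U\<^sup>G\<close> with the trivial action on \<open>T\<close> and translation on \<open>U\<^sup>G\<close>. It is realised by
  functions on \<open>'g option\<close> with pointwise operations: the value at \<open>None\<close> is the component in \<open>T\<close>,
  the value at \<open>Some y\<close> for \<open>y\<close> in \<open>G\<close> is the \<open>y\<close>-component in \<open>U\<^sup>G\<close>. For \<open>y\<close> outside \<open>G\<close> the value is by
  convention that at \<open>None\<close>, which keeps 0 and 1 in the ring.
\<close>

locale coinduced = T: countable_subring T + U: countable_subring U + G?: group G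
  for T U :: "'r::ring_1 set" and G :: "('g, 'h) monoid_scheme" (structure) +
  assumes finite_G: "finite (carrier G)"
begin

text \<open>
  The element with components \<open>u\<close> in \<open>U\<^sup>G\<close> and \<open>v\<close> in \<open>T\<close>.
\<close>

definition pack :: "('g \<Rightarrow> 'r) \<Rightarrow> 'r \<Rightarrow> 'g option \<Rightarrow> 'r" where
  "pack u v = (\<lambda>x. case x of None \<Rightarrow> v | Some y \<Rightarrow> if y \<in> carrier G then u y else v)"

definition S :: "('g option \<Rightarrow> 'r) set" where
  "S = {pack u v | u v. (\<forall>y\<in>carrier G. u y \<in> U) \<and> v \<in> T}"

text \<open>
  Translation: the \<open>y\<close>-component of \<open>g f\<close> is the \<open>g\<^sup>-\<^sup>1 y\<close>-component of \<open>f\<close>.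
\<close>

definition act :: "'g \<Rightarrow> ('g option \<Rightarrow> 'r) \<Rightarrow> 'g option \<Rightarrow> 'r" where
  "act g f = pack (\<lambda>y. f (Some (inv g \<otimes> y))) (f None)"

lemma pack_None [simp]: "pack u v None = v"
  and pack_Some [simp]: "y \<in> carrier G \<Longrightarrow> pack u v (Some y) = u y"
  by (simp_all add: pack_def)

lemma pack_cong: "(\<And>y. y \<in> carrier G \<Longrightarrow> u y = u' y) \<Longrightarrow> v = v' \<Longrightarrow> pack u v = pack u' v'"
  by (auto simp: pack_def fun_eq_iff split: option.split)

lemma pack_in_S: "(\<And>y. y \<in> carrier G \<Longrightarrow> u y \<in> U) \<Longrightarrow> v \<in> T \<Longrightarrow> pack u v \<in> S"
  by (auto simp: S_def)

lemma S_cases: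
  assumes "f \<in> S"
  obtains u v where "\<And>y. y \<in> carrier G \<Longrightarrow> u y \<in> U" "v \<in> T" "f = pack u v"
  using assms by (auto simp: S_def)

lemma pack_add: "pack u v + pack u' v' = pack (\<lambda>y. u y + u' y) (v + v')"
  and pack_mult: "pack u v * pack u' v' = pack (\<lambda>y. u y * u' y) (v * v')"
  and pack_uminus: "- pack u v = pack (\<lambda>y. - u y) (- v)"
  and pack_zero: "0 = pack (\<lambda>y. 0) 0" and pack_one: "1 = pack (\<lambda>y. 1) 1"
  by (auto simp: pack_def fun_eq_iff split: option.split)

lemma pack_sum: "(\<Sum>i\<in>F. pack (u i) (v i)) = pack (\<lambda>y. \<Sum>i\<in>F. u i y) (\<Sum>i\<in>F. v i)"
  by (auto simp: pack_def fun_eq_iff sum_fun_apply split: option.split)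

lemma act_pack: "g \<in> carrier G \<Longrightarrow> act g (pack u v) = pack (\<lambda>y. u (inv g \<otimes> y)) v"
  unfolding act_def by (rule pack_cong) simp_all

lemma countable_S: "countable S"
proof -
  obtain xs where xs: "set xs = carrier G" using finite_list[OF finite_G] by blast
  let ?p = "\<lambda>(ys, v). pack (\<lambda>y. the (map_of (zip xs ys) y)) v"
  have "S \<subseteq> ?p ` (lists U \<times> T)"
  proof
    fix f assume "f \<in> S"
    then obtain u v where f: "\<And>y. y \<in> carrier G \<Longrightarrow> u y \<in> U" "v \<in> T" "f = pack u v"
      by (rule S_cases) blast
    have "f = ?p (map u xs, v)"
      unfolding f prod.case by (rule pack_cong) (simp_all add: map_of_zip_map xs)
    moreover have "(map u xs, v) \<in> lists U \<times> T" using f xs by auto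
    ultimately show "f \<in> ?p ` (lists U \<times> T)" by blast
  qed
  then show ?thesis
    by (rule countable_subset) (simp add: T.count U.count)
qed

sublocale finite_group_action S G act
proof
  show "countable S" by (rule countable_S)
  show "0 \<in> S" "1 \<in> S" unfolding pack_zero pack_one by (auto intro!: pack_in_S)
  show "finite (carrier G)" by (rule finite_G)
next
  fix f f' assume "f \<in> S" "f' \<in> S"
  then obtain u v u' v' where f: "\<And>y. y \<in> carrier G \<Longrightarrow> u y \<in> U" "v \<in> T" "f = pack u v"
    and f': "\<And>y. y \<in> carrier G \<Longrightarrow> u' y \<in> U" "v' \<in> T" "f' = pack u' v'"
    by (elim S_cases) blast
  show "f + f' \<in> S" "f * f' \<in> S" "- f \<in> S"
    unfolding f(3) f'(3) pack_add pack_mult pack_uminus using f f'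
    by (auto intro!: pack_in_S T.S_add U.S_add T.S_mult U.S_mult T.S_uminus U.S_uminus)
  fix g assume g: "g \<in> carrier G"
  show "act g f \<in> S" "act g (f + f') = act g f + act g f'" "act g (f * f') = act g f * act g f'"
    unfolding f(3) f'(3) pack_add pack_mult act_pack[OF g] using f f' g
    by (auto intro!: pack_in_S)
  fix h assume h: "h \<in> carrier G"
  show "act (g \<otimes> h) f = act g (act h f)"
    unfolding f(3) using g h by (simp add: act_pack inv_mult_group m_assoc cong: pack_cong)
next
  fix f assume "f \<in> S"
  then show "act \<one> f = f" by (elim S_cases) (simp add: act_pack cong: pack_cong)
next
  fix g assume "g \<in> carrier G"
  then show "act g 1 = 1" by (simp add: pack_one act_pack)
qed

lemma gn_nat_ring_S:
  assumes "0 < N" and "rect_identity T N (N + 1)" "rect_identity U N (N + 1)"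
    and no: "\<And>k. k < N \<Longrightarrow> \<not> rect_identity U k (k + 1)"
  shows "gn (nat_ring S) = enat N"
proof (rule gn_eqI)
  obtain a b where ab: "\<And>i j. i < N + 1 \<Longrightarrow> j < N \<Longrightarrow> a i j \<in> T"
    "\<And>j l. j < N \<Longrightarrow> l < N + 1 \<Longrightarrow> b j l \<in> T"
    "\<And>i l. i < N + 1 \<Longrightarrow> l < N + 1 \<Longrightarrow> (\<Sum>j<N. a i j * b j l) = (if i = l then 1 else 0)"
    using assms(2) by (rule rect_identityE) (rule that)
  obtain c d where cd: "\<And>i j. i < N + 1 \<Longrightarrow> j < N \<Longrightarrow> c i j \<in> U"
    "\<And>j l. j < N \<Longrightarrow> l < N + 1 \<Longrightarrow> d j l \<in> U"
    "\<And>i l. i < N + 1 \<Longrightarrow> l < N + 1 \<Longrightarrow> (\<Sum>j<N. c i j * d j l) = (if i = l then 1 else 0)"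
    using assms(3) by (rule rect_identityE) (rule that)
  show "rmod_epi (nat_ring S) (free_rmod (nat_ring S) N) (free_rmod (nat_ring S) (N + 1)) \<noteq> {}"
  proof (rule matrices_imp_nat_ring_epi)
    show "(\<Sum>j<N. pack (\<lambda>_. c i j) (a i j) * pack (\<lambda>_. d j l) (b j l)) = (if i = l then 1 else 0)"
      if "i < N + 1" "l < N + 1" for i l
      unfolding pack_mult pack_sum ab(3)[OF that] cd(3)[OF that]
      by (simp add: pack_zero pack_one)
  qed (use ab cd in \<open>auto intro!: pack_in_S\<close>)
next
  fix k assume k: "k < N"
  show "rmod_epi (nat_ring S) (free_rmod (nat_ring S) k) (free_rmod (nat_ring S) (k + 1)) = {}"
  proof (rule ccontr)
    assume "\<not> ?thesis"
    then obtain a b where ab: "\<And>i j. i < k + 1 \<Longrightarrow> j < k \<Longrightarrow> a i j \<in> S"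
      "\<And>j l. j < k \<Longrightarrow> l < k + 1 \<Longrightarrow> b j l \<in> S"
      "\<And>i l. i < k + 1 \<Longrightarrow> l < k + 1 \<Longrightarrow> (\<Sum>j<k. a i j * b j l) = (if i = l then 1 else 0)"
      by (rule rect_identityE[OF nat_ring_epi_imp_rect_identity]) (rule that)
    have ev: "f (Some \<one>) \<in> U" if "f \<in> S" for f using that by (elim S_cases) simp
    have "rect_identity U k (k + 1)"
    proof (rule rect_identityI)
      show "(\<Sum>j<k. a i j (Some \<one>) * b j l (Some \<one>)) = (if i = l then 1 else 0)"
        if "i < k + 1" "l < k + 1" for i l
        using fun_cong[OF ab(3)[OF that], of "Some \<one>"] by (simp add: sum_fun_apply split: if_splits)
    qed (use ab ev in auto)
    then show False using no[OF k] by blast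
  qed
qed (rule assms)

text \<open>
  The element \<open>\<Sum>\<^sub>g u\<^sub>g g\<close> of the skew group ring of \<open>U\<^sup>G\<close> corresponds to the matrix with entries
  \<open>u\<^sub>g(y)\<close> at \<open>(y, g\<^sup>-\<^sup>1 y)\<close> for \<open>y, g\<close> in \<open>G\<close>. A rectangular identity over \<open>U\<close> with \<open>M + 1\<close> blocks of
  \<open>card G\<close> rows therefore yields one of shape \<open>(1, M + 1)\<close> over this skew group ring.
\<close>

lemma gn_skew_group_ring_S:
  assumes "0 < M" and "rect_identity T M (M + 1)"
    and U: "rect_identity U (card (carrier G)) ((M + 1) * card (carrier G))"
    and no: "\<And>k. k < M \<Longrightarrow> \<not> rect_identity T k (k + 1)"
  shows "gn RG = enat M"
proof (rule gn_eqI)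
  let ?n = "card (carrier G)"
  obtain ix where ix: "bij_betw ix (carrier G) {..<?n}"
    using ex_bij_betw_finite_nat[OF finite_G] by (metis atLeast0LessThan)
  have ix_less: "ix y < ?n" if "y \<in> carrier G" for y using ix that by (auto dest: bij_betwE)
  have ix_eq: "ix y = ix z \<longleftrightarrow> y = z" if "y \<in> carrier G" "z \<in> carrier G" for y z
    using ix that by (auto simp: bij_betw_def inj_on_def)
  define row where "row = (\<lambda>i y. i * ?n + ix y)"
  have row_less: "row i y < (M + 1) * ?n" if "i < M + 1" "y \<in> carrier G" for i y
  proof -
    have "row i y < (i + 1) * ?n" using ix_less[OF that(2)] by (simp add: row_def)
    also have "\<dots> \<le> (M + 1) * ?n" using that by (intro mult_right_mono) auto
    finally show ?thesis .
  qed
  have row_eq: "row i y = row l z \<longleftrightarrow> i = l \<and> y = z" if "y \<in> carrier G" "z \<in> carrier G" for i l y z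
  proof
    assume eq: "row i y = row l z"
    have "i = row i y div ?n" "l = row l z div ?n" "ix y = row i y mod ?n" "ix z = row l z mod ?n"
      using ix_less[OF that(1)] ix_less[OF that(2)] by (simp_all add: row_def)
    then show "i = l \<and> y = z" using eq ix_eq[OF that] by metis
  qed simp
  obtain a b where ab: "\<And>i j. i < M + 1 \<Longrightarrow> j < M \<Longrightarrow> a i j \<in> T"
    "\<And>j l. j < M \<Longrightarrow> l < M + 1 \<Longrightarrow> b j l \<in> T"
    "\<And>i l. i < M + 1 \<Longrightarrow> l < M + 1 \<Longrightarrow> (\<Sum>j<M. a i j * b j l) = (if i = l then 1 else 0)"
    using assms(2) by (rule rect_identityE) (rule that)
  obtain c d where cd: "\<And>i j. i < (M + 1) * ?n \<Longrightarrow> j < ?n \<Longrightarrow> c i j \<in> U"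
    "\<And>j l. j < ?n \<Longrightarrow> l < (M + 1) * ?n \<Longrightarrow> d j l \<in> U"
    "\<And>i l. i < (M + 1) * ?n \<Longrightarrow> l < (M + 1) * ?n \<Longrightarrow> (\<Sum>j<?n. c i j * d j l) = (if i = l then 1 else 0)"
    using U by (rule rect_identityE) (rule that)
  \<comment> \<open>On \<open>U\<^sup>G\<close> only the inner index 0 is used; on \<open>T\<close> the matrices \<open>a\<close> and \<open>b\<close> are placed at the unit of \<open>G\<close>.\<close>
  define a' where "a' = (\<lambda>i j g. pack (\<lambda>y. if j = 0 then c (row i y) (ix (inv g \<otimes> y)) else 0)
      (if g = \<one> then a i j else 0))"
  define b' where "b' = (\<lambda>j l g. pack (\<lambda>y. if j = 0 then d (ix y) (row l (inv g \<otimes> y)) else 0)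
      (if g = \<one> then b j l else 0))"
  show "rmod_epi RG (free_rmod RG M) (free_rmod RG (M + 1)) \<noteq> {}"
  proof (rule matrices_imp_skew_epi)
    show "a' i j g \<in> S" if "i < M + 1" "j < M" "g \<in> carrier G" for i j g
      unfolding a'_def using that ab(1) by (auto intro!: pack_in_S cd(1) row_less ix_less)
    show "b' j l g \<in> S" if "j < M" "l < M + 1" "g \<in> carrier G" for j l g
      unfolding b'_def using that ab(2) by (auto intro!: pack_in_S cd(2) row_less ix_less)
  next
    fix i l k assume il: "i < M + 1" "l < M + 1" and k: "k \<in> carrier G"
    have "(\<Sum>j<M. \<Sum>g\<in>carrier G. a' i j g * act g (b' j l (inv g \<otimes> k)))
        = pack (\<lambda>y. \<Sum>j<M. \<Sum>g\<in>carrier G. (if j = 0 then c (row i y) (ix (inv g \<otimes> y)) else 0) *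
              (if j = 0 then d (ix (inv g \<otimes> y)) (row l (inv (inv g \<otimes> k) \<otimes> (inv g \<otimes> y))) else 0))
            (\<Sum>j<M. \<Sum>g\<in>carrier G. (if g = \<one> then a i j else 0) * (if inv g \<otimes> k = \<one> then b j l else 0))"
      unfolding pack_sum[symmetric] a'_def b'_def
      by (intro sum.cong refl) (simp add: act_pack pack_mult)
    also have "\<dots> = pack (\<lambda>y. if i = l \<and> k = \<one> then 1 else 0) (if i = l \<and> k = \<one> then 1 else 0)"
    proof (rule pack_cong)
      fix y assume y: "y \<in> carrier G"
      have r: "inv (inv g \<otimes> k) \<otimes> (inv g \<otimes> y) = inv k \<otimes> y" if g: "g \<in> carrier G" for g
      proof -
        have "inv (inv g \<otimes> k) \<otimes> (inv g \<otimes> y) = inv k \<otimes> (g \<otimes> (inv g \<otimes> y))"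
          using g k y by (simp add: inv_mult_group m_assoc)
        also have "g \<otimes> (inv g \<otimes> y) = y" using g y by (simp flip: m_assoc)
        finally show ?thesis .
      qed
      have bij: "bij_betw (\<lambda>g. inv g \<otimes> y) (carrier G) (carrier G)"
      proof (rule bij_betw_byWitness[of _ "\<lambda>z. y \<otimes> inv z"])
        show "\<forall>g\<in>carrier G. y \<otimes> inv (inv g \<otimes> y) = g"
          using y by (auto simp: inv_mult_group simp flip: m_assoc)
        show "\<forall>z\<in>carrier G. inv (y \<otimes> inv z) \<otimes> y = z"
          using y by (auto simp: inv_mult_group m_assoc)
      qed (use y in auto)
      have "(\<Sum>j<M. \<Sum>g\<in>carrier G. (if j = 0 then c (row i y) (ix (inv g \<otimes> y)) else 0) *
            (if j = 0 then d (ix (inv g \<otimes> y)) (row l (inv (inv g \<otimes> k) \<otimes> (inv g \<otimes> y))) else 0))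
          = (\<Sum>j<M. if j = 0 then \<Sum>g\<in>carrier G. c (row i y) (ix (inv g \<otimes> y)) *
              d (ix (inv g \<otimes> y)) (row l (inv k \<otimes> y)) else 0)"
        by (intro sum.cong refl) (simp add: r)
      also have "\<dots> = (\<Sum>g\<in>carrier G. c (row i y) (ix (inv g \<otimes> y)) * d (ix (inv g \<otimes> y)) (row l (inv k \<otimes> y)))"
        using \<open>0 < M\<close> by simp
      also have "\<dots> = (\<Sum>j<?n. c (row i y) j * d j (row l (inv k \<otimes> y)))"
        by (rule sum.reindex_bij_betw[OF bij_betw_trans[OF bij ix], unfolded comp_def])
      also have "\<dots> = (if i = l \<and> y = inv k \<otimes> y then 1 else 0)"
        using cd(3)[OF row_less[OF il(1) y] row_less[OF il(2), of "inv k \<otimes> y"]] k y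
        by (simp add: row_eq)
      also have "y = inv k \<otimes> y \<longleftrightarrow> k = \<one>"
        using k y by (simp add: r_cancel_one' inv_eq_1_iff)
      finally show "(\<Sum>j<M. \<Sum>g\<in>carrier G. (if j = 0 then c (row i y) (ix (inv g \<otimes> y)) else 0) *
            (if j = 0 then d (ix (inv g \<otimes> y)) (row l (inv (inv g \<otimes> k) \<otimes> (inv g \<otimes> y))) else 0))
          = (if i = l \<and> k = \<one> then 1 else 0)" .
    next
      have "(\<Sum>g\<in>carrier G. (if g = \<one> then a i j else 0) * (if inv g \<otimes> k = \<one> then b j l else 0))
          = (\<Sum>g\<in>carrier G. if g = \<one> then (if k = \<one> then a i j * b j l else 0) else 0)" for j
        using k by (intro sum.cong refl) auto
      then show "(\<Sum>j<M. \<Sum>g\<in>carrier G. (if g = \<one> then a i j else 0) * (if inv g \<otimes> k = \<one> then b j l else 0))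
          = (if i = l \<and> k = \<one> then 1 else 0)"
        using ab(3)[OF il] finite_G by (cases "k = \<one>"; cases "i = l") simp_all
    qed
    finally show "(\<Sum>j<M. \<Sum>g\<in>carrier G. a' i j g * act g (b' j l (inv g \<otimes> k)))
        = (if i = l \<and> k = \<one> then 1 else 0)"
      by (simp add: pack_zero pack_one)
  qed
next
  fix k assume k: "k < M"
  show "rmod_epi RG (free_rmod RG k) (free_rmod RG (k + 1)) = {}"
  proof (rule ccontr)
    assume epi: "\<not> ?thesis"
    have "rect_identity T k (k + 1)"
    proof (rule skew_epi_imp_rect_identity[where \<psi> = "\<lambda>f. f None"])
      show "f None \<in> T" if "f \<in> S" for f using that by (elim S_cases) simp
    qed (use epi in \<open>simp_all add: T.S_add act_def\<close>)
    then show False using no[OF k] by blast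
  qed
qed (rule assms)

end

section \<open>Prescribed generating numbers\<close>

theorem proposition4p8:
  fixes m n :: nat and G :: "('g, 'h) monoid_scheme"
  assumes "0 < m" and "0 < n" and "m \<le> n"
    and "group G" and "order G = n"
  shows "\<exists>(R :: nat ring) (\<phi> :: 'g \<Rightarrow> nat \<Rightarrow> nat).
           ring R \<and> \<phi> \<in> hom G (ring_Aut R) \<and>
           gn R = enat n \<and> gn (skew_group_ring R G \<phi>) = enat m"
proof -
  interpret T: alphabet m "{..<(m + 1) * n}" using assms by unfold_locales auto
  interpret U: alphabet n "{..<(m + 1) * n}" using assms by unfold_locales auto
  have n: "card (carrier G) = n" using assms by (simp add: order_def)
  have "coinduced_axioms G" using n \<open>0 < n\<close> by unfold_locales (simp add: card_ge_0_finite)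
  then interpret coinduced T.A U.A G
    using T.countable_subring_A U.countable_subring_A \<open>group G\<close> by (intro coinduced.intro)
  have "2 * n \<le> (m + 1) * n" using assms by (intro mult_right_mono) auto
  then have le: "n + 1 \<le> (m + 1) * n" using \<open>0 < n\<close> by linarith
  then have le': "m + 1 \<le> (m + 1) * n" using \<open>m \<le> n\<close> by linarith
  show ?thesis
  proof (intro exI conjI)
    show "ring (nat_ring S)" by (rule ring_nat_ring)
    show "nat_act \<in> hom G (ring_Aut (nat_ring S))" by (rule nat_act_hom)
    show "gn (nat_ring S) = enat n"
      using assms le by (intro gn_nat_ring_S T.rect_identity_A U.rect_identity_A U.no_rect_identity) auto
    show "gn (skew_group_ring (nat_ring S) G nat_act) = enat m"
      using assms le' n
      by (intro gn_skew_group_ring_S T.rect_identity_A U.rect_identity_A T.no_rect_identity) auto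
  qed
qed

end
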